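(* Let $\Bbbk$ be an algebraically closed field of characteristic $p>2$ and let $\Psi_\Bbbk:Y_2^>(\Bbbk)\to W^{(2)}(\Bbbk)$ be the $\Bbbk$-algebra homomorphism with $e_r\mapsto x_1^r$. Then $$\mathrm{im}(\Psi_\Bbbk)=\bigoplus_{k\in\mathbb{N}}\{f\in\Bbbk[x_1,\dots,x_k]^{\Sigma_k}:\ f=0\text{ whenever }x_1=x_2+1=\dots=x_p+p-1\}$$ (the condition being vacuous for $k<p$), and the polynomials $P_\lambda$, with $\lambda$ ranging over all $p$-restricted partitions (of all lengths $k\in\mathbb{N}$), form a $\Bbbk$-basis of $\mathrm{im}(\Psi_\Bbbk)$.
   Context: $\mathbb{N}=\{0,1,\dots\}$. $Y_2^>(\Bbbk)$ is the $\Bbbk$-algebra generated by $e_r$ ($r\in\mathbb{N}$) with relations $[e_{r+1},e_s]-[e_r,e_{s+1}]=e_re_s+e_se_r$. $W^{(2)}(\Bbbk)=\bigoplus_kW^{(2)}_k(\Bbbk)$, $W^{(2)}_k(\Bbbk)=\Bbbk[x_1,\dots,x_k]^{\Sigma_k}$, with product $F\star G=\sum_\sigma\sigma\big(F(x_1,\dots,x_k)G(x_{k+1},\dots,x_{k+\ell})\prod_{r\le k<r'}\frac{x_r-x_{r'}+1}{x_r-x_{r'}}\big)$ for $F\in W_k,G\in W_\ell$, over $\sigma\in\Sigma_{k+\ell}$ increasing on $\{1..k\}$ and on $\{k+1..k+\ell\}$. A partition of length $k$ is $\lambda=(\lambda_1\ge\dots\ge\lambda_k)$, $\lambda_i\in\mathbb{N}$;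 $m_i(\lambda)=\#\{j:\lambda_j=i\}$; $\lambda$ is $p$-restricted if all $m_i(\lambda)<p$; $\mathrm{mul}(\lambda)=\prod_{i\ge1}m_i(\lambda)!$; $P_\lambda=\frac{1}{\mathrm{mul}(\lambda)}\sum_{\sigma\in\Sigma_k}\sigma\big(x_1^{\lambda_1}\cdots x_k^{\lambda_k}\prod_{i<j}\frac{x_i-x_j+1}{x_i-x_j}\big)\in\Bbbk[x_1,\dots,x_k]^{\Sigma_k}$ (the symmetrization is an integer-coefficient polynomial reduced to $\Bbbk$). *)

theory Defs
  imports "HOL-Library.Poly_Mapping" "HOL-Combinatorics.Permutations"
          "HOL-Computational_Algebra.Polynomial"
begin

text \<open>A polynomial is a finitely supported map from monomials (exponent vectors
  nat =>0 nat) to coefficients. Variable x_i (0-indexed) corresponds to the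
  paper's x_(i+1).\<close>

type_synonym 'a mpoly = "(nat \<Rightarrow>\<^sub>0 nat) \<Rightarrow>\<^sub>0 'a"

definition mvar :: "nat \<Rightarrow> 'a::comm_semiring_1 mpoly" where
  "mvar i = Poly_Mapping.single (Poly_Mapping.single i 1) 1"

definition mconst :: "'a::comm_semiring_1 \<Rightarrow> 'a mpoly" where
  "mconst c = Poly_Mapping.single 0 c"

definition mmono :: "nat list \<Rightarrow> 'a::comm_semiring_1 mpoly" where
  "mmono l = (\<Prod>i<length l. mvar i ^ (l ! i))"

definition mon_rename :: "(nat \<Rightarrow> nat) \<Rightarrow> (nat \<Rightarrow>\<^sub>0 nat) \<Rightarrow> (nat \<Rightarrow>\<^sub>0 nat)" where
  "mon_rename \<tau> m = (\<Sum>i\<in>Poly_Mapping.keys m. Poly_Mapping.single (\<tau> i) (Poly_Mapping.lookup m i))"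

definition rename :: "(nat \<Rightarrow> nat) \<Rightarrow> 'a::comm_semiring_1 mpoly \<Rightarrow> 'a mpoly" where
  "rename \<tau> f = (\<Sum>m\<in>Poly_Mapping.keys f.
        Poly_Mapping.single (mon_rename \<tau> m) (Poly_Mapping.lookup f m))"

definition meval :: "(nat \<Rightarrow> 'a::comm_semiring_1) \<Rightarrow> 'a mpoly \<Rightarrow> 'a" where
  "meval a f = (\<Sum>m\<in>Poly_Mapping.keys f.
       Poly_Mapping.lookup f m * (\<Prod>i\<in>Poly_Mapping.keys m. a i ^ Poly_Mapping.lookup m i))"

definition in_vars :: "nat \<Rightarrow> 'a::comm_semiring_1 mpoly \<Rightarrow> bool" where
  "in_vars k f \<longleftrightarrow> (\<forall>m\<in>Poly_Mapping.keys f. Poly_Mapping.keys m \<subseteq> {..<k})"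

definition sym_poly :: "nat \<Rightarrow> 'a::comm_semiring_1 mpoly \<Rightarrow> bool" where
  "sym_poly k f \<longleftrightarrow> in_vars k f \<and> (\<forall>\<sigma>. \<sigma> permutes {..<k} \<longrightarrow> rename \<sigma> f = f)"

definition vand :: "nat \<Rightarrow> 'a::comm_ring_1 mpoly" where
  "vand n = (\<Prod>i<n. \<Prod>j\<in>{i<..<n}. mvar i - mvar j)"

definition shuffles :: "nat \<Rightarrow> nat \<Rightarrow> (nat \<Rightarrow> nat) set" where
  "shuffles k l = {\<sigma>. \<sigma> permutes {..<k+l} \<and> strict_mono_on {..<k} \<sigma>
                       \<and> strict_mono_on {k..<k+l} \<sigma>}"

text \<open>The shuffle product F * G for F in W_k, G in W_l.  The summand
  sigma(F G' prod_{r<k<=r'} (x_r - x_r' + 1)/(x_r - x_r')) is rewritten as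
  sign(sigma) sigma(h) / vand(k+l) with
  h = F G' prod_{cross} (x_r - x_r' + 1) * prod_{i<j in the same block}(x_i - x_j),
  so that the sum is the (exact) quotient of a polynomial by vand(k+l).\<close>
definition star :: "nat \<Rightarrow> nat \<Rightarrow> 'a::comm_ring_1 mpoly \<Rightarrow> 'a mpoly \<Rightarrow> 'a mpoly" where
  "star k l F G =
    (let h = F * rename (\<lambda>i. i + k) G
             * (\<Prod>r<k. \<Prod>r'\<in>{k..<k+l}. mvar r - mvar r' + 1)
             * (\<Prod>i<k. \<Prod>j\<in>{i<..<k}. mvar i - mvar j)
             * (\<Prod>i\<in>{k..<k+l}. \<Prod>j\<in>{i<..<k+l}. mvar i - mvar j)
     in THE q. q * vand (k+l) = (\<Sum>\<sigma>\<in>shuffles k l. of_int (sign \<sigma>) * rename \<sigma> h))"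

definition in_W :: "(nat \<Rightarrow> 'a::comm_ring_1 mpoly) \<Rightarrow> bool" where
  "in_W w \<longleftrightarrow> finite {k. w k \<noteq> 0} \<and> (\<forall>k. sym_poly k (w k))"

definition W_one :: "nat \<Rightarrow> 'a::comm_ring_1 mpoly" where
  "W_one = (\<lambda>n. if n = 0 then 1 else 0)"

definition W_add :: "(nat \<Rightarrow> 'a::comm_ring_1 mpoly) \<Rightarrow> (nat \<Rightarrow> 'a mpoly) \<Rightarrow> nat \<Rightarrow> 'a mpoly" where
  "W_add v w = (\<lambda>n. v n + w n)"

definition W_smult :: "'a::comm_ring_1 \<Rightarrow> (nat \<Rightarrow> 'a mpoly) \<Rightarrow> nat \<Rightarrow> 'a mpoly" where
  "W_smult c w = (\<lambda>n. mconst c * w n)"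

definition W_mult :: "(nat \<Rightarrow> 'a::comm_ring_1 mpoly) \<Rightarrow> (nat \<Rightarrow> 'a mpoly) \<Rightarrow> nat \<Rightarrow> 'a mpoly" where
  "W_mult v w = (\<lambda>n. \<Sum>k\<le>n. star k (n - k) (v k) (w (n - k)))"

definition W_gen :: "nat \<Rightarrow> nat \<Rightarrow> 'a::comm_ring_1 mpoly" where
  "W_gen r = (\<lambda>n. if n = 1 then mvar 0 ^ r else 0)"

text \<open>Image of Psi: the unital subalgebra of W generated by the elements x_1^r
  (Y_2^>(k) is generated by the e_r and Psi(e_r) = x_1^r).\<close>
inductive_set im_Psi :: "(nat \<Rightarrow> 'a::comm_ring_1 mpoly) set" where
  one: "W_one \<in> im_Psi"
| gen: "W_gen r \<in> im_Psi"
| add: "v \<in> im_Psi \<Longrightarrow> w \<in> im_Psi \<Longrightarrow> W_add v w \<in> im_Psi"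
| smult: "w \<in> im_Psi \<Longrightarrow> W_smult c w \<in> im_Psi"
| mult: "v \<in> im_Psi \<Longrightarrow> w \<in> im_Psi \<Longrightarrow> W_mult v w \<in> im_Psi"

definition is_partition :: "nat list \<Rightarrow> bool" where
  "is_partition l \<longleftrightarrow> sorted_wrt (\<ge>) l"

definition mult_part :: "nat list \<Rightarrow> nat \<Rightarrow> nat" where
  "mult_part l i = count_list l i"

definition p_restricted :: "nat \<Rightarrow> nat list \<Rightarrow> bool" where
  "p_restricted p l \<longleftrightarrow> (\<forall>i. mult_part l i < p)"

definition mul_part :: "nat list \<Rightarrow> nat" where
  "mul_part l = (\<Prod>i\<in>set l - {0}. fact (mult_part l i))"

definition P_int :: "nat list \<Rightarrow> int mpoly" where
  "P_int l = (let k = length l in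
     THE q. q * (of_nat (mul_part l) * vand k) =
       (\<Sum>\<sigma> | \<sigma> permutes {..<k}. of_int (sign \<sigma>) *
           rename \<sigma> (mmono l * (\<Prod>i<k. \<Prod>j\<in>{i<..<k}. mvar i - mvar j + 1))))"

definition P_poly :: "nat list \<Rightarrow> 'a::comm_ring_1 mpoly" where
  "P_poly l = Poly_Mapping.map of_int (P_int l)"

definition P_W :: "nat list \<Rightarrow> nat \<Rightarrow> 'a::comm_ring_1 mpoly" where
  "P_W l = (\<lambda>n. if n = length l then P_poly l else 0)"

end

theory Submission
  imports Defs
begin

text \<open>
  Write \<open>Sym f\<close> for the sum over all permutations of \<open>f \<Prod>\<^sub>i\<^sub><\<^sub>j (x\<^sub>i - x\<^sub>j + 1) / (x\<^sub>i - x\<^sub>j)\<close>. Splitting a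
  permutation into a shuffle and a block permutation gives \<open>Sym f \<star> Sym g = Sym (f \<otimes> g)\<close>, so the image
  consists of symmetrizations and contains \<open>mul(\<lambda>) P\<^sub>\<lambda> = Sym x\<^sup>\<lambda>\<close>; for restricted \<open>\<lambda>\<close> the factor
  \<open>mul(\<lambda>)\<close> is invertible. On the locus \<open>x\<^sub>1 = x\<^sub>2 + 1 = \<dots> = x\<^sub>p + p - 1\<close> the first \<open>p\<close> coordinates
  form a cycle under subtracting \<open>1\<close>, so every summand of \<open>Sym f\<close> has a vanishing numerator factor.
  Conversely, if a symmetric \<open>f\<close> vanishes there, its top-degree part vanishes at \<open>x\<^sub>1 = \<dots> = x\<^sub>p\<close>;
  since the rotations of a non-constant exponent block come in orbits of size \<open>p\<close>, this kills exactly
  the coefficients at non-restricted exponents. The top-degree part of \<open>P\<^sub>\<lambda>\<close> is a nonzero multiple of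
  the monomial symmetric polynomial \<open>m\<^sub>\<lambda>\<close> when \<open>\<lambda>\<close> is restricted, so subtracting a combination of
  \<open>P\<^sub>\<lambda>\<close>'s lowers the degree of \<open>f\<close>, and the \<open>P\<^sub>\<lambda>\<close> are linearly independent.
\<close>

section \<open>Evaluation homomorphisms of multivariate polynomials\<close>

text \<open>The quotients in \<open>star\<close> and \<open>P_int\<close> are definite descriptions,
  so identities are proved after multiplication by \<open>vand\<close> and then cancelled in an
  integral domain. The quotients exist by the factor theorem for alternating polynomials; there p >
  2 enters, as 2 \<noteq> 0. Since mul(\<lambda>) may vanish in the field, its divisibility of the
  symmetrization is proved over the integers, block by block of equal parts, and the quotient is
  reduced afterwards. At some points of the wheel locus the Vandermonde product is zero and cannot
  be cancelled. Vanishing is therefore shown at a generic point with polynomial coordinates and then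
  specialized. For the converse, an algebraically closed field is infinite, so vanishing at points
  becomes vanishing of coefficients. If a_0 = ... = a_(p-1), the points with coordinates T a_i - i
  for i < p and T a_i beyond lie on the locus for all T, and the leading coefficient in T is the
  top-degree part at a. The leading coefficient of P_\<lambda> is a stabilizer order divided by
  mul(\<lambda>), that is m_0(\<lambda>)!: zero parts are not counted in mul(\<lambda>), yet their
  number must also stay below p.\<close>

locale comm_ring_hom =
  fixes \<phi> :: "'a::comm_ring_1 \<Rightarrow> 'b::comm_ring_1"
  assumes one [simp]: "\<phi> 1 = 1"
    and add: "\<phi> (x + y) = \<phi> x + \<phi> y"
    and mult: "\<phi> (x * y) = \<phi> x * \<phi> y"
begin

lemma zero [simp]: "\<phi> 0 = 0"
  using add[of 0 0] by simp

lemma uminus: "\<phi> (- x) = - \<phi> x"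
  using add[of x "- x"] by (simp add: eq_neg_iff_add_eq_0 add.commute)

lemma diff: "\<phi> (x - y) = \<phi> x - \<phi> y"
  using add[of x "- y"] by (simp add: uminus)

lemma sum: "\<phi> (sum f A) = (\<Sum>x\<in>A. \<phi> (f x))"
  by (induction A rule: infinite_finite_induct) (simp_all add: add)

lemma prod: "\<phi> (prod f A) = (\<Prod>x\<in>A. \<phi> (f x))"
  by (induction A rule: infinite_finite_induct) (simp_all add: mult)

lemma power: "\<phi> (x ^ n) = \<phi> x ^ n"
  by (induction n) (simp_all add: mult)

lemma of_nat [simp]: "\<phi> (of_nat n) = of_nat n"
  by (induction n) (simp_all add: add)

lemma of_int [simp]: "\<phi> (of_int n) = of_int n"
  by (cases n) (simp_all add: uminus diff)

end

definition mon_eval :: "(nat \<Rightarrow> 'b::comm_ring_1) \<Rightarrow> (nat \<Rightarrow>\<^sub>0 nat) \<Rightarrow> 'b" where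
  "mon_eval s m = (\<Prod>i\<in>Poly_Mapping.keys m. s i ^ Poly_Mapping.lookup m i)"

text \<open>The universal property of the polynomial ring: a map on coefficients and a choice of
  images of the variables. \<open>meval\<close>, \<open>rename\<close>, reduction of integer
  coefficients, truncation, grading and the wheel substitution are all instances, so each is a ring
  homomorphism at once.\<close>

definition poly_eval :: "('a::comm_ring_1 \<Rightarrow> 'b::comm_ring_1) \<Rightarrow> (nat \<Rightarrow> 'b) \<Rightarrow> 'a mpoly \<Rightarrow> 'b" where
  "poly_eval \<phi> s f = (\<Sum>m\<in>Poly_Mapping.keys f. \<phi> (Poly_Mapping.lookup f m) * mon_eval s m)"

lemma poly_mapping_decomp:
  "f = (\<Sum>m\<in>Poly_Mapping.keys f. Poly_Mapping.single m (Poly_Mapping.lookup f m))"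
  by (rule poly_mapping_eqI) (auto simp: lookup_sum lookup_single when_def in_keys_iff)

lemma poly_mapping_single_induct [case_names zero single add]:
  fixes f :: "'a \<Rightarrow>\<^sub>0 'b::comm_monoid_add"
  assumes "P 0" "\<And>m c. P (Poly_Mapping.single m c)" "\<And>f g. P f \<Longrightarrow> P g \<Longrightarrow> P (f + g)"
  shows "P f"
proof -
  have "P (\<Sum>m\<in>A. Poly_Mapping.single m (Poly_Mapping.lookup f m))" for A
    by (induction A rule: infinite_finite_induct) (auto intro: assms)
  then show ?thesis using poly_mapping_decomp[of f] by metis
qed

lemma mon_eval_superset:
  assumes "finite A" "Poly_Mapping.keys m \<subseteq> A"
  shows "mon_eval s m = (\<Prod>i\<in>A. s i ^ Poly_Mapping.lookup m i)"
  unfolding mon_eval_def using assms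
  by (intro prod.mono_neutral_left) (auto simp: in_keys_iff)

lemma mon_eval_add: "mon_eval s (m + n) = mon_eval s m * mon_eval s n"
proof -
  let ?A = "Poly_Mapping.keys m \<union> Poly_Mapping.keys n"
  have "Poly_Mapping.keys (m + n) \<subseteq> ?A" by (rule keys_add)
  then show ?thesis
    by (simp add: mon_eval_superset[of ?A] lookup_add power_add prod.distrib)
qed

lemma mon_eval_0 [simp]: "mon_eval s 0 = 1"
  by (simp add: mon_eval_def)

lemma mon_eval_single [simp]: "mon_eval s (Poly_Mapping.single i n) = s i ^ n"
  by (cases "n = 0") (auto simp: mon_eval_def)

lemma mconst_0 [simp]: "mconst 0 = 0" and mconst_1 [simp]: "mconst 1 = 1"
  by (simp_all add: mconst_def)

lemma mconst_hom: "comm_ring_hom (mconst :: 'a::comm_ring_1 \<Rightarrow> 'a mpoly)"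
  by unfold_locales (simp_all add: mconst_def single_add mult_single)

interpretation mconst: comm_ring_hom mconst by (rule mconst_hom)

lemma mvar_power: "mvar i ^ n = Poly_Mapping.single (Poly_Mapping.single i n) (1::'a::comm_ring_1)"
  by (induction n) (simp_all add: mvar_def mult_single single_add[symmetric])

lemma mon_eval_mvar: "mon_eval mvar m = Poly_Mapping.single m (1::'a::comm_ring_1)"
proof (induction m rule: poly_mapping_single_induct)
  case (add f g) then show ?case by (simp add: mon_eval_add mult_single)
qed (simp_all add: mvar_power)

lemma single_eq_mconst_mon_eval: "Poly_Mapping.single m c = mconst c * mon_eval mvar m"
  by (simp add: mon_eval_mvar mconst_def mult_single)

lemma mpoly_induct [case_names const var add mult]:
  fixes f :: "'a::comm_ring_1 mpoly"
  assumes const: "\<And>c. P (mconst c)" and var: "\<And>i. P (mvar i)"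
    and add: "\<And>f g. P f \<Longrightarrow> P g \<Longrightarrow> P (f + g)" and mult: "\<And>f g. P f \<Longrightarrow> P g \<Longrightarrow> P (f * g)"
  shows "P f"
proof (induction f rule: poly_mapping_single_induct)
  case zero show ?case using const[of 0] by simp
next
  case (single m c)
  have one: "P 1" using const[of 1] by simp
  have pw: "P (mvar i ^ n)" for i n
    by (induction n) (auto intro: one var mult)
  have "P (\<Prod>i\<in>A. mvar i ^ Poly_Mapping.lookup m i)" for A
    by (induction A rule: infinite_finite_induct) (auto intro: one pw mult)
  then show ?case unfolding single_eq_mconst_mon_eval mon_eval_def by (intro mult const)
qed (rule add)

text \<open>Uniqueness half of the universal property. Identities between composed substitutions are
  reduced to this check on constants and variables.\<close>

lemma comm_ring_hom_ext:
  fixes \<Phi> \<Psi> :: "'a::comm_ring_1 mpoly \<Rightarrow> 'b::comm_ring_1"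
  assumes "comm_ring_hom \<Phi>" "comm_ring_hom \<Psi>" "\<And>c. \<Phi> (mconst c) = \<Psi> (mconst c)"
    "\<And>i. \<Phi> (mvar i) = \<Psi> (mvar i)"
  shows "\<Phi> f = \<Psi> f"
proof -
  interpret a: comm_ring_hom \<Phi> by fact
  interpret b: comm_ring_hom \<Psi> by fact
  show ?thesis by (induction f rule: mpoly_induct) (simp_all add: assms a.add b.add a.mult b.mult)
qed

lemma comm_ring_hom_comp:
  "comm_ring_hom f \<Longrightarrow> comm_ring_hom g \<Longrightarrow> comm_ring_hom (\<lambda>x. f (g x))"
  by (simp add: comm_ring_hom_def)

context comm_ring_hom
begin

lemma poly_eval_single: "poly_eval \<phi> s (Poly_Mapping.single m c) = \<phi> c * mon_eval s m"
  by (cases "c = 0") (simp_all add: poly_eval_def)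

lemma poly_eval_add: "poly_eval \<phi> s (f + g) = poly_eval \<phi> s f + poly_eval \<phi> s g"
  unfolding poly_eval_def
  by (rule setsum_keys_plus_distrib[where f = "\<lambda>m c. \<phi> c * mon_eval s m"])
     (simp_all add: add distrib_right)

lemma poly_eval_mult: "poly_eval \<phi> s (f * g) = poly_eval \<phi> s f * poly_eval \<phi> s g"
proof (induction f rule: poly_mapping_single_induct)
  case (single m c)
  show ?case
  proof (induction g rule: poly_mapping_single_induct)
    case (single n d) then show ?case
      by (simp add: mult_single poly_eval_single mult mon_eval_add ac_simps)
  qed (simp_all add: distrib_left poly_eval_add, simp add: poly_eval_def)
qed (simp_all add: distrib_right poly_eval_add, simp add: poly_eval_def)

lemma poly_eval_hom: "comm_ring_hom (poly_eval \<phi> s)"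
  by unfold_locales
     (simp_all add: poly_eval_add poly_eval_mult single_one[symmetric] poly_eval_single del: single_one)

lemma poly_eval_mvar [simp]: "poly_eval \<phi> s (mvar i) = s i"
  by (simp add: mvar_def poly_eval_single)

lemma poly_eval_mconst [simp]: "poly_eval \<phi> s (mconst c) = \<phi> c"
  by (simp add: mconst_def poly_eval_single)

end

lemma comm_ring_hom_id: "comm_ring_hom (\<lambda>x. x)" and comm_ring_hom_of_int: "comm_ring_hom of_int"
  by unfold_locales simp_all

lemma meval_eq_poly_eval: "meval a f = poly_eval (\<lambda>x. x) a (f :: 'a::comm_ring_1 mpoly)"
  by (simp add: meval_def poly_eval_def mon_eval_def)

interpretation meval: comm_ring_hom "meval a" for a :: "nat \<Rightarrow> 'a::comm_ring_1"
  using comm_ring_hom.poly_eval_hom[OF comm_ring_hom_id] by (simp add: meval_eq_poly_eval[abs_def])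

lemma meval_mvar [simp]: "meval a (mvar i) = (a i :: 'a::comm_ring_1)"
  and meval_mconst [simp]: "meval a (mconst c) = (c :: 'a::comm_ring_1)"
  by (simp_all add: meval_eq_poly_eval comm_ring_hom.poly_eval_mvar comm_ring_hom.poly_eval_mconst
      comm_ring_hom_id)

lemma mon_eval_sum: "mon_eval s (sum f A) = (\<Prod>i\<in>A. mon_eval s (f i))"
  by (induction A rule: infinite_finite_induct) (simp_all add: mon_eval_add)

lemma single_mon_rename:
  "Poly_Mapping.single (mon_rename \<tau> m) (c::'a::comm_ring_1) = mconst c * mon_eval (\<lambda>i. mvar (\<tau> i)) m"
  unfolding single_eq_mconst_mon_eval by (simp add: mon_rename_def mon_eval_sum) (simp add: mon_eval_def)

lemma rename_eq_poly_eval: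
  "rename \<tau> f = poly_eval mconst (\<lambda>i. mvar (\<tau> i)) (f :: 'a::comm_ring_1 mpoly)"
  by (simp add: rename_def poly_eval_def single_mon_rename)

interpretation rename: comm_ring_hom "rename \<tau> :: 'a::comm_ring_1 mpoly \<Rightarrow> 'a mpoly" for \<tau>
  using mconst.poly_eval_hom by (simp add: rename_eq_poly_eval[abs_def])

lemma rename_mvar [simp]: "rename \<tau> (mvar i) = (mvar (\<tau> i) :: 'a::comm_ring_1 mpoly)"
  and rename_mconst [simp]: "rename \<tau> (mconst c) = (mconst c :: 'a::comm_ring_1 mpoly)"
  by (simp_all add: rename_eq_poly_eval)

lemma rename_single [simp]:
  "rename \<tau> (Poly_Mapping.single m c) = (Poly_Mapping.single (mon_rename \<tau> m) c :: 'a::comm_ring_1 mpoly)"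
  by (simp add: rename_eq_poly_eval mconst.poly_eval_single single_mon_rename)

lemma rename_rename: "rename \<sigma> (rename \<tau> f) = rename (\<sigma> \<circ> \<tau>) (f :: 'a::comm_ring_1 mpoly)"
  by (rule comm_ring_hom_ext[OF comm_ring_hom_comp[OF rename.comm_ring_hom_axioms rename.comm_ring_hom_axioms] rename.comm_ring_hom_axioms]) simp_all

lemma rename_id [simp]: "rename id f = (f :: 'a::comm_ring_1 mpoly)"
  by (rule comm_ring_hom_ext[OF rename.comm_ring_hom_axioms comm_ring_hom_id]) simp_all

lemma rename_ident [simp]: "rename (\<lambda>x. x) f = (f :: 'a::comm_ring_1 mpoly)"
  using rename_id[of f] by (simp add: id_def)

lemma meval_rename: "meval a (rename \<tau> f) = meval (a \<circ> \<tau>) (f :: 'a::comm_ring_1 mpoly)"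
  by (rule comm_ring_hom_ext[OF comm_ring_hom_comp[OF meval.comm_ring_hom_axioms rename.comm_ring_hom_axioms] meval.comm_ring_hom_axioms]) simp_all

lemma map_of_int_eq_poly_eval:
  "Poly_Mapping.map of_int f = poly_eval (\<lambda>n. mconst (of_int n :: 'a::comm_ring_1)) mvar f"
proof (rule poly_mapping_eqI)
  fix m
  have "Poly_Mapping.lookup (poly_eval (\<lambda>n. mconst (of_int n :: 'a)) mvar f) m
        = (\<Sum>m'\<in>Poly_Mapping.keys f. of_int (Poly_Mapping.lookup f m') when m' = m)"
    by (simp add: poly_eval_def lookup_sum mon_eval_mvar mconst_def mult_single lookup_single
        del: mconst.of_int single_of_int)
  also have "\<dots> = of_int (Poly_Mapping.lookup f m)"
    by (simp add: when_def in_keys_iff)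
  finally show "Poly_Mapping.lookup (Poly_Mapping.map of_int f) m
      = Poly_Mapping.lookup (poly_eval (\<lambda>n. mconst (of_int n :: 'a)) mvar f) m"
    by (simp add: Poly_Mapping.map.rep_eq when_def)
qed

interpretation map_of_int: comm_ring_hom "Poly_Mapping.map of_int :: int mpoly \<Rightarrow> 'a::comm_ring_1 mpoly"
  using comm_ring_hom.poly_eval_hom[OF comm_ring_hom_comp[OF mconst_hom comm_ring_hom_of_int]]
  by (simp add: map_of_int_eq_poly_eval[abs_def])

lemma map_of_int_mvar [simp]: "Poly_Mapping.map of_int (mvar i) = (mvar i :: 'a::comm_ring_1 mpoly)"
  by (simp add: mvar_def)

lemma map_of_int_mconst [simp]: "Poly_Mapping.map of_int (mconst c) = (mconst (of_int c) :: 'a::comm_ring_1 mpoly)"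
  by (simp add: mconst_def)

lemma map_of_int_rename:
  "Poly_Mapping.map of_int (rename \<tau> f) = (rename \<tau> (Poly_Mapping.map of_int f) :: 'a::comm_ring_1 mpoly)"
  by (rule comm_ring_hom_ext[OF comm_ring_hom_comp[OF map_of_int.comm_ring_hom_axioms rename.comm_ring_hom_axioms] comm_ring_hom_comp[OF rename.comm_ring_hom_axioms map_of_int.comm_ring_hom_axioms]])
     simp_all

section \<open>Variables and alternating polynomials\<close>

lemma in_vars_mconst [simp]: "in_vars k (mconst c)"
  by (auto simp: in_vars_def mconst_def split: if_splits)

lemma in_vars_mvar: "i < k \<Longrightarrow> in_vars k (mvar i)"
  by (auto simp: in_vars_def mvar_def split: if_splits)

lemma in_vars_add: "in_vars k f \<Longrightarrow> in_vars k g \<Longrightarrow> in_vars k (f + g)"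
  using keys_add[of f g] by (auto simp: in_vars_def)

lemma in_vars_mult:
  assumes "in_vars k f" "in_vars k g"
  shows "in_vars k (f * g)"
  unfolding in_vars_def
proof
  fix m assume "m \<in> Poly_Mapping.keys (f * g)"
  then obtain a b where "a \<in> Poly_Mapping.keys f" "b \<in> Poly_Mapping.keys g" "m = a + b"
    using keys_mult[of f g] by blast
  then show "Poly_Mapping.keys m \<subseteq> {..<k}"
    using assms keys_add[of a b] by (force simp: in_vars_def)
qed

lemma in_vars_0 [simp]: "in_vars k 0" and in_vars_1 [simp]: "in_vars k (1::'a::comm_ring_1 mpoly)"
  using in_vars_mconst[of k "0::'a"] in_vars_mconst[of k "1::'a"] by (auto simp: in_vars_def)

lemma in_vars_uminus: "in_vars k f \<Longrightarrow> in_vars k (- f :: 'a::comm_ring_1 mpoly)"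
  by (simp add: in_vars_def in_keys_iff)

lemma in_vars_diff: "in_vars k f \<Longrightarrow> in_vars k g \<Longrightarrow> in_vars k (f - g :: 'a::comm_ring_1 mpoly)"
  using in_vars_add[of k f "- g"] in_vars_uminus[of k g] by simp

lemma in_vars_sum: "(\<And>x. x \<in> A \<Longrightarrow> in_vars k (f x)) \<Longrightarrow> in_vars k (sum f A :: 'a::comm_ring_1 mpoly)"
  by (induction A rule: infinite_finite_induct) (auto intro: in_vars_add)

lemma in_vars_prod: "(\<And>x. x \<in> A \<Longrightarrow> in_vars k (f x)) \<Longrightarrow> in_vars k (prod f A :: 'a::comm_ring_1 mpoly)"
  by (induction A rule: infinite_finite_induct) (auto intro: in_vars_mult)

lemma in_vars_power: "in_vars k f \<Longrightarrow> in_vars k (f ^ n :: 'a::comm_ring_1 mpoly)"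
  by (induction n) (auto intro: in_vars_mult)

lemma in_vars_of_int [simp]: "in_vars k (of_int n :: 'a::comm_ring_1 mpoly)"
  using in_vars_mconst[of k "of_int n :: 'a"] by simp

lemma in_vars_poly_eval:
  fixes f :: "'a::comm_ring_1 mpoly"
  assumes "\<And>i. in_vars k (s i)"
  shows "in_vars k (poly_eval mconst s f)"
proof -
  interpret e: comm_ring_hom "poly_eval mconst s :: 'a mpoly \<Rightarrow> 'a mpoly" by (rule mconst.poly_eval_hom)
  show ?thesis
    by (induction f rule: mpoly_induct) (auto simp: assms e.add e.mult intro: in_vars_add in_vars_mult)
qed

lemma poly_eval_cong:
  assumes "in_vars k f" "\<And>i. i < k \<Longrightarrow> s i = t i"
  shows "poly_eval \<phi> s f = poly_eval \<phi> t f"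
proof -
  have "mon_eval s m = mon_eval t m" if "m \<in> Poly_Mapping.keys f" for m
    unfolding mon_eval_def
  proof (rule prod.cong)
    fix i assume "i \<in> Poly_Mapping.keys m"
    then have "i < k" using assms(1) that by (auto simp: in_vars_def)
    then show "s i ^ Poly_Mapping.lookup m i = t i ^ Poly_Mapping.lookup m i" by (simp add: assms(2))
  qed simp
  then show ?thesis by (simp add: poly_eval_def)
qed

lemma rename_cong:
  "in_vars k f \<Longrightarrow> (\<And>i. i < k \<Longrightarrow> \<sigma> i = \<tau> i) \<Longrightarrow> rename \<sigma> f = rename \<tau> (f :: 'a::comm_ring_1 mpoly)"
  unfolding rename_eq_poly_eval by (rule poly_eval_cong) auto

text \<open>Its fixed points are exactly the polynomials in the first \<open>k\<close> variables,
  which turns a condition on supports into an equation that can be multiplied and cancelled.\<close>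

definition truncate_vars :: "nat \<Rightarrow> 'a::comm_ring_1 mpoly \<Rightarrow> 'a mpoly" where
  "truncate_vars k = poly_eval mconst (\<lambda>i. if i < k then mvar i else 0)"

interpretation truncate_vars: comm_ring_hom "truncate_vars k" for k
  unfolding truncate_vars_def by (rule mconst.poly_eval_hom)

lemma in_vars_truncate_vars: "in_vars k (truncate_vars k f)"
  unfolding truncate_vars_def by (rule in_vars_poly_eval) (auto simp: in_vars_mvar)

lemma truncate_vars_id: "in_vars k f \<Longrightarrow> truncate_vars k f = f"
proof -
  assume "in_vars k f"
  then have "truncate_vars k f = rename id f"
    unfolding truncate_vars_def rename_eq_poly_eval by (rule poly_eval_cong) auto
  then show ?thesis by simp
qed

lemma in_vars_iff_truncate_vars: "in_vars k f \<longleftrightarrow> truncate_vars k f = f"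
  using truncate_vars_id in_vars_truncate_vars by metis

lemma in_vars_rename:
  assumes "in_vars k f" "\<And>i. i < k \<Longrightarrow> \<tau> i < k'"
  shows "in_vars k' (rename \<tau> (f :: 'a::comm_ring_1 mpoly))"
proof -
  have "rename \<tau> f = poly_eval mconst (\<lambda>i. if i < k then mvar (\<tau> i) else 0) f"
    unfolding rename_eq_poly_eval using assms(1) by (rule poly_eval_cong) auto
  then show ?thesis using assms(2) by (auto intro!: in_vars_poly_eval in_vars_mvar)
qed

text \<open>Truncation fixes \<open>q * g\<close> and \<open>g\<close>, so the truncated
  \<open>q\<close> has the same product with \<open>g\<close>, and \<open>g\<close> can be
  cancelled. Used for quotients by \<open>vand\<close>, whose supports are not known
  directly.\<close>

lemma in_vars_cancel:
  fixes q :: "'a::idom mpoly"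
  assumes "in_vars k (q * g)" "in_vars k g" "g \<noteq> 0"
  shows "in_vars k q"
proof -
  have "truncate_vars k q * g = q * g"
    using assms(1,2) by (simp add: in_vars_iff_truncate_vars truncate_vars.mult)
  then show ?thesis using assms(3) by (simp add: in_vars_iff_truncate_vars)
qed

lemma mvar_eq_iff [simp]: "(mvar i :: 'a::comm_ring_1 mpoly) = mvar j \<longleftrightarrow> i = j"
proof
  assume "(mvar i :: 'a mpoly) = mvar j"
  then have "meval (\<lambda>k. if k = i then 1 else 0) (mvar i :: 'a mpoly) = meval (\<lambda>k. if k = i then 1 else 0) (mvar j)"
    by simp
  then show "i = j" by (simp split: if_splits)
qed simp

section \<open>The Vandermonde product and divisibility of alternating polynomials\<close>

definition pairs :: "nat \<Rightarrow> (nat \<times> nat) set" where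
  "pairs n = (SIGMA i:{..<n}. {i<..<n})"

lemma finite_pairs [simp]: "finite (pairs n)"
  by (simp add: pairs_def)

lemma mem_pairs [simp]: "(i, j) \<in> pairs n \<longleftrightarrow> i < j \<and> j < n"
  by (auto simp: pairs_def)

lemma prod_pairs: "(\<Prod>i<n. \<Prod>j\<in>{i<..<n}. g i j) = (\<Prod>(i,j)\<in>pairs n. g i j)"
  unfolding pairs_def by (rule prod.Sigma) auto

lemma vand_pairs: "vand n = (\<Prod>(i,j)\<in>pairs n. mvar i - mvar j)"
  unfolding vand_def by (rule prod_pairs)

lemma vand_nonzero [simp]: "vand n \<noteq> (0::'a::idom mpoly)"
  by (auto simp: vand_pairs prod_zero_iff)

lemma in_vars_vand [simp]: "in_vars n (vand n :: 'a::comm_ring_1 mpoly)"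
  unfolding vand_pairs by (rule in_vars_prod) (auto intro!: in_vars_diff in_vars_mvar)

text \<open>The transposition permutes the factors up to sign, so the total sign is the parity of
  the number of pairs whose order it reverses.\<close>

lemma rename_transpose_vand:
  assumes "a < b" "b < n"
  shows "rename (transpose a b) (vand n) = (- vand n :: 'a::comm_ring_1 mpoly)"
proof -
  define t where "t = transpose a b"
  define d where "d = (\<lambda>x. (mvar (fst x) - mvar (snd x) :: 'a mpoly))"
  define \<phi> where "\<phi> = (\<lambda>x. if t (fst x) < t (snd x) then (t (fst x), t (snd x)) else (t (snd x), t (fst x)))"
  define I where "I = {x \<in> pairs n. t (snd x) < t (fst x)}"
  have tt: "t (t i) = i" for i by (simp add: t_def)
  have t_less: "t i < n" if "i < n" for i
    using assms that by (auto simp: t_def transpose_def)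
  have t_inj: "t i = t j \<longleftrightarrow> i = j" for i j using tt by metis
  have \<phi>_mem: "\<phi> x \<in> pairs n" if "x \<in> pairs n" for x
  proof (cases x)
    case (Pair i j)
    with that have "i < j" "i < n" "j < n" by auto
    then show ?thesis using t_less[of i] t_less[of j] t_inj[of i j] by (auto simp: Pair \<phi>_def)
  qed
  have bij: "bij_betw \<phi> (pairs n) (pairs n)"
  proof (rule bij_betw_byWitness[where f' = \<phi>])
    show "\<forall>x\<in>pairs n. \<phi> (\<phi> x) = x" by (auto simp: \<phi>_def tt)
    then show "\<forall>x\<in>pairs n. \<phi> (\<phi> x) = x" .
    show "\<phi> ` pairs n \<subseteq> pairs n" using \<phi>_mem by blast
    then show "\<phi> ` pairs n \<subseteq> pairs n" .
  qed
  \<comment> \<open>The reversed pairs are \<open>(a, b)\<close> itself and two for each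
    \<open>c\<close> strictly between \<open>a\<close> and \<open>b\<close>, hence an odd
    number.\<close>
  have I_eq: "I = insert (a, b) ((\<lambda>c. (a, c)) ` {a<..<b} \<union> (\<lambda>c. (c, b)) ` {a<..<b})"
    using assms by (auto simp: I_def t_def transpose_def image_iff split: if_splits)
  have "card I = Suc (card ((\<lambda>c. (a, c)) ` {a<..<b} \<union> (\<lambda>c. (c, b)) ` {a<..<b}))"
    unfolding I_eq by (rule card_insert_disjoint) auto
  also have "card ((\<lambda>c. (a, c)) ` {a<..<b} \<union> (\<lambda>c. (c, b)) ` {a<..<b}) = 2 * (b - Suc a)"
    by (subst card_Un_disjoint) (auto simp: card_image inj_on_def)
  finally have odd: "odd (card I)" by simp
  have "rename t (vand n) = (\<Prod>x\<in>pairs n. (if x \<in> I then - 1 else 1) * d (\<phi> x))"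
    unfolding vand_pairs rename.prod
    by (rule prod.cong) (auto simp: I_def d_def \<phi>_def rename.diff not_less)
  also have "\<dots> = (\<Prod>x\<in>pairs n. (if x \<in> I then - 1 else 1)) * (\<Prod>x\<in>pairs n. d (\<phi> x))"
    by (rule prod.distrib)
  also have "(\<Prod>x\<in>pairs n. d (\<phi> x)) = vand n"
    unfolding vand_pairs using prod.reindex_bij_betw[OF bij, of d] by (simp add: d_def case_prod_beta)
  also have "(\<Prod>x\<in>pairs n. (if x \<in> I then - 1 else 1)) = (- 1 :: 'a mpoly) ^ card I"
    using prod.inter_filter[of "pairs n" "\<lambda>_. - 1 :: 'a mpoly" "\<lambda>x. x \<in> I"]
    by (simp add: I_def Collect_conj_eq)
  finally show ?thesis using odd by (simp add: t_def)
qed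

lemma permutation_of_permutes: "\<sigma> permutes {..<n::nat} \<Longrightarrow> permutation \<sigma>"
  by (auto simp: permutation_permutes)

lemma rename_vand:
  assumes "\<sigma> permutes {..<n}"
  shows "rename \<sigma> (vand n) = (of_int (sign \<sigma>) * vand n :: 'a::comm_ring_1 mpoly)"
  using assms finite_lessThan[of n]
proof (induction \<sigma> rule: permutes_induct)
  case (swap a b \<sigma>)
  have t: "rename (transpose a b) (vand n) = (- vand n :: 'a mpoly)"
    using rename_transpose_vand[of a b n] rename_transpose_vand[of b a n] swap(1-3)
    by (cases "a < b") (auto simp: transpose_commute)
  have sgn: "sign (transpose a b \<circ> \<sigma>) = - sign \<sigma>"
    using swap by (simp add: sign_compose permutation_swap_id sign_swap_id permutation_of_permutes)
  show ?case
    unfolding rename_rename[symmetric] sgn by (simp add: swap.IH rename.mult t)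
qed simp

text \<open>Factor theorem: modulo x_i - x_j the two variables agree, so the replacement of x_j by
  x_i, which \<open>id(j := i)\<close> performs, changes nothing there. Products are handled by
  telescoping.\<close>

lemma linear_dvd_diff_rename:
  "(mvar i - mvar j) dvd (f - rename (id(j := i)) (f :: 'a::comm_ring_1 mpoly))"
proof (induction f rule: mpoly_induct)
  case (var k)
  show ?case using dvd_minus_iff[of "mvar i - mvar j :: 'a mpoly" "mvar i - mvar j"] by auto
next
  case (add f g)
  then show ?case using dvd_add[OF add] by (simp add: rename.add algebra_simps)
next
  case (mult f g)
  have "f * g - rename (id(j := i)) (f * g)
      = f * (g - rename (id(j := i)) g) + (f - rename (id(j := i)) f) * rename (id(j := i)) g"
    by (simp add: rename.mult algebra_simps)
  then show ?case using mult by (simp only: dvd_add dvd_mult dvd_mult2)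
qed simp

text \<open>This is what characteristic different from 2 provides: an alternating polynomial
  vanishes on the diagonals.\<close>

lemma eq_uminus_imp_0:
  fixes f :: "'a::idom mpoly"
  assumes "(2::'a) \<noteq> 0" "f = - f"
  shows "f = 0"
proof (rule poly_mapping_eqI)
  fix m
  have "Poly_Mapping.lookup f m = - Poly_Mapping.lookup f m"
    using assms(2) by (metis lookup_uminus)
  then have "2 * Poly_Mapping.lookup f m = 0"
    by (metis mult_2 eq_neg_iff_add_eq_0)
  then show "Poly_Mapping.lookup f m = Poly_Mapping.lookup 0 m" using assms(1) by simp
qed

text \<open>The linear factors are split off one by one. Setting x_j = x_i kills \<open>f\<close>
  but not the product of the factors already split off, so it kills the cofactor, to which the
  factor theorem applies.\<close>

lemma vand_dvd:
  fixes f :: "'a::idom mpoly"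
  assumes two: "(2::'a) \<noteq> 0"
    and alt: "\<And>i j. i < j \<Longrightarrow> j < n \<Longrightarrow> rename (transpose i j) f = - f"
  shows "vand n dvd f"
proof -
  have collapse: "rename (id(j := i)) f = 0" if "i < j" "j < n" for i j
  proof (rule eq_uminus_imp_0[OF two])
    \<comment> \<open>Swapping x_i and x_j before identifying them has no effect, so the collapsed
      polynomial equals its own negative.\<close>
    have eq: "id(j := i) \<circ> transpose i j = id(j := i)"
      using that by (auto simp: fun_eq_iff transpose_def)
    have "rename (id(j := i)) f = rename (id(j := i)) (rename (transpose i j) f)"
      unfolding rename_rename eq ..
    also have "\<dots> = - rename (id(j := i)) f"
      unfolding alt[OF that] rename.uminus ..
    finally show "rename (id(j := i)) f = - rename (id(j := i)) f" .
  qed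
  have "finite P \<Longrightarrow> P \<subseteq> pairs n \<Longrightarrow> (\<Prod>(i,j)\<in>P. mvar i - mvar j) dvd f" for P
  proof (induction P rule: finite_induct)
    case (insert x P)
    obtain i j where x: "x = (i, j)" by (cases x)
    with insert have ij: "i < j" "j < n" by auto
    from insert obtain g where g: "f = (\<Prod>(i,j)\<in>P. mvar i - mvar j) * g" by (auto elim: dvdE)
    \<comment> \<open>With \<open>a < b\<close> and \<open>i < j\<close>, the indices
      \<open>a\<close> and \<open>b\<close> are identified only if
      \<open>(a, b) = (i, j)\<close>.\<close>
    have "rename (id(j := i)) (mvar a - mvar b :: 'a mpoly) \<noteq> 0" if "(a, b) \<in> P" for a b
    proof -
      have "a < b" "(a, b) \<noteq> (i, j)" using insert that x by auto
      then show ?thesis using ij by (auto simp: rename.diff)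
    qed
    then have "rename (id(j := i)) (\<Prod>(i,j)\<in>P. mvar i - mvar j :: 'a mpoly) \<noteq> 0"
      unfolding rename.prod using insert(1) by (auto simp: prod_zero_iff)
    moreover have "rename (id(j := i)) (\<Prod>(i,j)\<in>P. mvar i - mvar j) * rename (id(j := i)) g = 0"
      using collapse[OF ij] unfolding g rename.mult .
    ultimately have "rename (id(j := i)) g = 0" by simp
    then have "(mvar i - mvar j) dvd g" using linear_dvd_diff_rename[of i j g] by simp
    then show ?case using insert(1,2) by (simp add: x g mult.commute mult_dvd_mono)
  qed simp
  from this[of "pairs n"] show ?thesis by (simp add: vand_pairs)
qed

definition alternate :: "nat \<Rightarrow> 'a::comm_ring_1 mpoly \<Rightarrow> 'a mpoly" where
  "alternate n f = (\<Sum>\<sigma> | \<sigma> permutes {..<n}. of_int (sign \<sigma>) * rename \<sigma> f)"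

lemma rename_alternate:
  assumes "\<pi> permutes {..<n}"
  shows "rename \<pi> (alternate n f) = of_int (sign \<pi>) * alternate n f"
proof -
  have s: "of_int (sign \<pi>) * (of_int (sign \<pi>) * x) = x" for x :: "'a mpoly"
    by (simp add: mult.assoc[symmetric] of_int_mult[symmetric] del: of_int_mult)
  have "of_int (sign \<pi>) * alternate n f
      = (\<Sum>\<sigma> | \<sigma> permutes {..<n}. of_int (sign \<pi>) * (of_int (sign (\<pi> \<circ> \<sigma>)) * rename (\<pi> \<circ> \<sigma>) f))"
    unfolding alternate_def sum_distrib_left by (rule setum_permutations_compose_left[OF assms])
  also have "\<dots> = (\<Sum>\<sigma> | \<sigma> permutes {..<n}. of_int (sign \<sigma>) * rename \<pi> (rename \<sigma> f))"
    using assms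
    by (intro sum.cong) (auto simp: sign_compose permutation_of_permutes rename_rename s mult.assoc)
  also have "\<dots> = rename \<pi> (alternate n f)"
    by (simp add: alternate_def rename.sum rename.mult)
  finally show ?thesis by simp
qed

lemma vand_dvd_alternate:
  fixes f :: "'a::idom mpoly"
  assumes "(2::'a) \<noteq> 0"
  shows "vand n dvd alternate n f"
proof (rule vand_dvd[OF assms])
  fix i j :: nat assume "i < j" "j < n"
  then show "rename (transpose i j) (alternate n f) = - alternate n f"
    by (subst rename_alternate) (auto simp: permutes_swap_id sign_swap_id)
qed

lemma in_vars_alternate: "in_vars n f \<Longrightarrow> in_vars n (alternate n f)"
  unfolding alternate_def
  by (auto intro!: in_vars_sum in_vars_mult in_vars_rename simp: permutes_in_image[of _ "{..<n}", simplified])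

lemma alternate_add: "alternate n (f + g) = alternate n f + alternate n g"
  by (simp add: alternate_def rename.add distrib_left sum.distrib)

lemma alternate_mconst: "alternate n (mconst c * f) = mconst c * alternate n f"
  by (simp add: alternate_def rename.mult sum_distrib_left ac_simps)

lemma alternate_0 [simp]: "alternate n 0 = 0"
  by (simp add: alternate_def)

section \<open>Shuffles and the shuffle product of symmetrizations\<close>

lemma strict_mono_on_image_unique:
  fixes f g :: "nat \<Rightarrow> 'a::linorder"
  assumes "strict_mono_on {a..<b} f" "strict_mono_on {a..<b} g" "f ` {a..<b} = g ` {a..<b}"
    and "i \<in> {a..<b}"
  shows "f i = g i"
proof -
  have "sorted_wrt (<) (map h [a..<b])" if "strict_mono_on {a..<b} h" for h :: "nat \<Rightarrow> 'a"
    using that unfolding sorted_wrt_map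
    by (intro sorted_wrt_mono_rel[OF _ sorted_wrt_upt]) (auto simp: strict_mono_on_def)
  then have "map f [a..<b] = map g [a..<b]"
    using assms by (intro strict_sorted_equal) auto
  then show ?thesis using assms(4) by (simp add: map_eq_conv)
qed

text \<open>The shuffle in the coset of \<open>\<sigma>\<close> modulo block permutations: it lists
  the image of each block in increasing order.\<close>

lemma shuffle_exists:
  assumes \<sigma>: "\<sigma> permutes {..<k + l}"
  obtains \<tau> where "\<tau> \<in> shuffles k l" "\<tau> ` {..<k} = \<sigma> ` {..<k}" "\<tau> ` {k..<k + l} = \<sigma> ` {k..<k + l}"
proof -
  define A where "A = \<sigma> ` {..<k}"
  define B where "B = \<sigma> ` {k..<k + l}"
  have inj: "inj \<sigma>" using \<sigma> by (rule permutes_inj)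
  have cards: "card A = k" "card B = l" and fin: "finite A" "finite B"
    by (simp_all add: A_def B_def card_image inj_on_subset[OF inj])
  have split: "{..<k + l} = {..<k} \<union> {k..<k + l}" by auto
  have un: "A \<union> B = {..<k + l}"
    using permutes_image[OF \<sigma>] by (simp add: A_def B_def split image_Un[symmetric])
  have disj: "A \<inter> B = {}"
    by (auto simp: A_def B_def dest!: injD[OF inj])
  obtain hA where hA: "bij_betw hA {..<k} A" "strict_mono_on {..<k} hA"
    using ex_bij_betw_strict_mono_card[OF fin(1)] cards by metis
  obtain hB where hB: "bij_betw hB {..<l} B" "strict_mono_on {..<l} hB"
    using ex_bij_betw_strict_mono_card[OF fin(2)] cards by metis
  define \<tau> where "\<tau> = (\<lambda>i. if i < k then hA i else if i < k + l then hB (i - k) else i)"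
  have imA: "\<tau> ` {..<k} = A"
    using hA(1) by (auto simp: bij_betw_def \<tau>_def image_iff)
  have "\<tau> ` {k..<k + l} = hB ` {..<l}"
  proof safe
    fix i assume "i < l"
    then show "hB i \<in> \<tau> ` {k..<k + l}" by (intro image_eqI[of _ _ "i + k"]) (auto simp: \<tau>_def)
  qed (auto simp: \<tau>_def)
  then have imB: "\<tau> ` {k..<k + l} = B"
    using hB(1) by (auto simp: bij_betw_def)
  have im: "\<tau> ` {..<k + l} = {..<k + l}"
    by (simp only: split image_Un imA imB) (simp only: un[symmetric] split[symmetric])
  have "inj_on \<tau> {..<k + l}"
    by (rule eq_card_imp_inj_on) (simp_all add: im)
  then have "bij_betw \<tau> {..<k + l} {..<k + l}" using im by (simp add: bij_betw_def)
  then have perm: "\<tau> permutes {..<k + l}"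
    by (rule bij_imp_permutes) (auto simp: \<tau>_def)
  have "strict_mono_on {..<k} \<tau>" using hA(2) by (auto simp: strict_mono_on_def \<tau>_def)
  moreover have "strict_mono_on {k..<k + l} \<tau>"
  proof (rule strict_mono_onI)
    fix r s assume "r \<in> {k..<k + l}" "s \<in> {k..<k + l}" "r < s"
    then show "\<tau> r < \<tau> s" using strict_mono_onD[OF hB(2), of "r - k" "s - k"] by (auto simp: \<tau>_def)
  qed
  ultimately have "\<tau> \<in> shuffles k l" using perm by (simp add: shuffles_def)
  with imA imB that show thesis by (auto simp: A_def B_def)
qed

lemma block_permutes:
  fixes k l :: nat
  assumes "\<alpha> permutes {..<k}" "\<beta> permutes {k..<k + l}"
  shows "\<alpha> \<circ> \<beta> permutes {..<k + l}" "i < k \<Longrightarrow> (\<alpha> \<circ> \<beta>) i = \<alpha> i" "i \<in> {k..<k + l} \<Longrightarrow> (\<alpha> \<circ> \<beta>) i = \<beta> i"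
    "(\<alpha> \<circ> \<beta>) ` {..<k} = {..<k}" "(\<alpha> \<circ> \<beta>) ` {k..<k + l} = {k..<k + l}"
proof -
  have a: "(\<alpha> \<circ> \<beta>) i = \<alpha> i" if "i < k" for i
  proof -
    have "i \<notin> {k..<k + l}" using that by simp
    then have "\<beta> i = i" by (rule permutes_not_in[OF assms(2)])
    then show ?thesis by simp
  qed
  have b: "(\<alpha> \<circ> \<beta>) i = \<beta> i" if "i \<in> {k..<k + l}" for i
    using permutes_in_image[OF assms(2), of i] permutes_not_in[OF assms(1), of "\<beta> i"] that by auto
  show "i < k \<Longrightarrow> (\<alpha> \<circ> \<beta>) i = \<alpha> i" "i \<in> {k..<k + l} \<Longrightarrow> (\<alpha> \<circ> \<beta>) i = \<beta> i" using a b by auto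
  show "\<alpha> \<circ> \<beta> permutes {..<k + l}"
    using assms by (intro permutes_compose) (auto intro: permutes_subset)
  have "(\<alpha> \<circ> \<beta>) ` {..<k} = \<alpha> ` {..<k}" using a by (intro image_cong) auto
  then show "(\<alpha> \<circ> \<beta>) ` {..<k} = {..<k}" using permutes_image[OF assms(1)] by simp
  have "(\<alpha> \<circ> \<beta>) ` {k..<k + l} = \<beta> ` {k..<k + l}" using b by (intro image_cong) auto
  then show "(\<alpha> \<circ> \<beta>) ` {k..<k + l} = {k..<k + l}" using permutes_image[OF assms(2)] by simp
qed

text \<open>Shuffles represent the left cosets of the block subgroup: block permutations do not
  change the images of the blocks, and a shuffle is determined by these images.\<close>

lemma bij_betw_shuffles:
  "bij_betw (\<lambda>(\<tau>, \<alpha>, \<beta>). \<tau> \<circ> (\<alpha> \<circ> \<beta>))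
     (shuffles k l \<times> {\<alpha>. \<alpha> permutes {..<k}} \<times> {\<beta>. \<beta> permutes {k..<k + l}}) {\<sigma>. \<sigma> permutes {..<k + l}}"
  unfolding bij_betw_def
proof (intro conjI set_eqI iffI)
  show "inj_on (\<lambda>(\<tau>, \<alpha>, \<beta>). \<tau> \<circ> (\<alpha> \<circ> \<beta>))
     (shuffles k l \<times> {\<alpha>. \<alpha> permutes {..<k}} \<times> {\<beta>. \<beta> permutes {k..<k + l}})"
  proof -
    have "\<tau> = \<tau>' \<and> \<alpha> = \<alpha>' \<and> \<beta> = \<beta>'" if
      \<tau>: "\<tau> \<in> shuffles k l" and \<tau>': "\<tau>' \<in> shuffles k l"
      and p: "\<alpha> permutes {..<k}" "\<beta> permutes {k..<k + l}"
      and p': "\<alpha>' permutes {..<k}" "\<beta>' permutes {k..<k + l}"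
      and eq: "\<tau> \<circ> (\<alpha> \<circ> \<beta>) = \<tau>' \<circ> (\<alpha>' \<circ> \<beta>')" for \<tau> \<alpha> \<beta> \<tau>' \<alpha>' \<beta>'
    proof -
    note bp = block_permutes[OF p] and bp' = block_permutes[OF p']
    have perm: "\<tau> permutes {..<k + l}" "\<tau>' permutes {..<k + l}"
      using \<tau> \<tau>' by (simp_all add: shuffles_def)
    have "\<tau> ` {..<k} = (\<tau> \<circ> (\<alpha> \<circ> \<beta>)) ` {..<k}" by (simp only: image_comp[of \<tau> "\<alpha> \<circ> \<beta>", symmetric] bp(4))
    also have "\<dots> = \<tau>' ` {..<k}" unfolding eq by (simp only: image_comp[of \<tau>' "\<alpha>' \<circ> \<beta>'", symmetric] bp'(4))
    finally have 1: "\<tau> i = \<tau>' i" if "i < k" for i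
      using strict_mono_on_image_unique[of 0 k \<tau> \<tau>' i] that \<tau> \<tau>'
      by (auto simp: shuffles_def atLeast0LessThan)
    have "\<tau> ` {k..<k + l} = (\<tau> \<circ> (\<alpha> \<circ> \<beta>)) ` {k..<k + l}" by (simp only: image_comp[of \<tau> "\<alpha> \<circ> \<beta>", symmetric] bp(5))
    also have "\<dots> = \<tau>' ` {k..<k + l}" unfolding eq by (simp only: image_comp[of \<tau>' "\<alpha>' \<circ> \<beta>'", symmetric] bp'(5))
    finally have 2: "\<tau> i = \<tau>' i" if "i \<in> {k..<k + l}" for i
      using strict_mono_on_image_unique[of k "k + l" \<tau> \<tau>' i] that \<tau> \<tau>'
      by (auto simp: shuffles_def)
    have \<tau>_eq: "\<tau> = \<tau>'"
    proof
      fix i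
      show "\<tau> i = \<tau>' i"
        using 1[of i] 2[of i] permutes_not_in[OF perm(1), of i] permutes_not_in[OF perm(2), of i]
        by (cases "i < k"; cases "i < k + l") auto
    qed
    have "inj \<tau>" using perm(1) by (rule permutes_inj)
    then have ab: "\<alpha> \<circ> \<beta> = \<alpha>' \<circ> \<beta>'"
      using eq unfolding \<tau>_eq[symmetric] by (simp add: fun_eq_iff inj_eq)
    have "\<alpha> i = \<alpha>' i" for i
      using bp(2)[of i] bp'(2)[of i] ab permutes_not_in[OF p(1), of i] permutes_not_in[OF p'(1), of i]
      by (cases "i < k") auto
    moreover have "\<beta> i = \<beta>' i" for i
      using bp(3)[of i] bp'(3)[of i] ab permutes_not_in[OF p(2), of i] permutes_not_in[OF p'(2), of i]
      by (cases "i \<in> {k..<k + l}") auto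
    ultimately show "\<tau> = \<tau>' \<and> \<alpha> = \<alpha>' \<and> \<beta> = \<beta>'" using \<tau>_eq by auto
    qed
    note key = this
    show ?thesis
    proof (rule inj_onI)
      fix x y
      assume xy: "x \<in> shuffles k l \<times> {\<alpha>. \<alpha> permutes {..<k}} \<times> {\<beta>. \<beta> permutes {k..<k + l}}"
        "y \<in> shuffles k l \<times> {\<alpha>. \<alpha> permutes {..<k}} \<times> {\<beta>. \<beta> permutes {k..<k + l}}"
        "(case x of (\<tau>, \<alpha>, \<beta>) \<Rightarrow> \<tau> \<circ> (\<alpha> \<circ> \<beta>)) = (case y of (\<tau>, \<alpha>, \<beta>) \<Rightarrow> \<tau> \<circ> (\<alpha> \<circ> \<beta>))"
      obtain \<tau> \<alpha> \<beta> where x: "x = (\<tau>, \<alpha>, \<beta>)" by (cases x)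
      obtain \<tau>' \<alpha>' \<beta>' where y: "y = (\<tau>', \<alpha>', \<beta>')" by (cases y)
      show "x = y" using key[of \<tau> \<tau>' \<alpha> \<beta> \<alpha>' \<beta>'] xy unfolding x y by auto
    qed
  qed
next
  fix \<sigma> :: "nat \<Rightarrow> nat"
  assume "\<sigma> \<in> {\<sigma>. \<sigma> permutes {..<k + l}}"
  then have \<sigma>: "\<sigma> permutes {..<k + l}" by simp
  obtain \<tau> where \<tau>: "\<tau> \<in> shuffles k l" and im: "\<tau> ` {..<k} = \<sigma> ` {..<k}" "\<tau> ` {k..<k + l} = \<sigma> ` {k..<k + l}"
    using shuffle_exists[OF \<sigma>] by blast
  have perm: "\<tau> permutes {..<k + l}" using \<tau> by (simp add: shuffles_def)
  \<comment> \<open>As \<open>\<tau>\<close> and \<open>\<sigma>\<close> have the same block images,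
    \<open>\<rho>\<close> maps each block to itself; its restrictions give \<open>\<alpha>\<close>
    and \<open>\<beta>\<close>.\<close>
  define \<rho> where "\<rho> = inv \<tau> \<circ> \<sigma>"
  have inj: "inj \<rho>"
    unfolding \<rho>_def using permutes_inj[OF permutes_inv[OF perm]] permutes_inj[OF \<sigma>] by (rule inj_compose)
  have invim: "inv \<tau> ` \<tau> ` X = X" for X
    using permutes_inj[OF perm] by (simp add: image_comp)
  have im\<rho>: "\<rho> ` {..<k} = {..<k}" "\<rho> ` {k..<k + l} = {k..<k + l}"
    unfolding \<rho>_def image_comp[symmetric] im[symmetric] by (rule invim)+
  have \<rho>_out: "\<rho> i = i" if "\<not> i < k + l" for i
    using that permutes_not_in[OF \<sigma>, of i] permutes_not_in[OF permutes_inv[OF perm], of i] by (simp add: \<rho>_def)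
  define \<alpha> where "\<alpha> = (\<lambda>i. if i < k then \<rho> i else i)"
  define \<beta> where "\<beta> = (\<lambda>i. if i \<in> {k..<k + l} then \<rho> i else i)"
  have "bij_betw \<rho> {..<k} {..<k}" "bij_betw \<rho> {k..<k + l} {k..<k + l}"
    using im\<rho> by (auto simp: bij_betw_def inj_on_subset[OF inj])
  then have bij: "bij_betw \<alpha> {..<k} {..<k}" "bij_betw \<beta> {k..<k + l} {k..<k + l}"
    using bij_betw_cong[of "{..<k}" \<alpha> \<rho> "{..<k}"] bij_betw_cong[of "{k..<k + l}" \<beta> \<rho> "{k..<k + l}"]
    by (auto simp: \<alpha>_def \<beta>_def)
  have \<alpha>: "\<alpha> permutes {..<k}"
    by (rule bij_imp_permutes[OF bij(1)]) (auto simp: \<alpha>_def)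
  have \<beta>: "\<beta> permutes {k..<k + l}"
    by (rule bij_imp_permutes[OF bij(2)]) (auto simp: \<beta>_def)
  have "(\<alpha> \<circ> \<beta>) i = \<rho> i" for i
  proof -
    consider "i < k" | "i \<in> {k..<k + l}" | "\<not> i < k + l" by force
    then show ?thesis
    proof cases
      case 1 then show ?thesis by (simp only: block_permutes(2)[OF \<alpha> \<beta>]) (simp add: \<alpha>_def)
    next
      case 2 then show ?thesis by (simp only: block_permutes(3)[OF \<alpha> \<beta>]) (simp add: \<beta>_def)
    next
      case 3 then show ?thesis by (simp add: \<rho>_out \<alpha>_def \<beta>_def)
    qed
  qed
  then have "\<alpha> \<circ> \<beta> = \<rho>" by (rule ext)
  moreover have "\<tau> \<circ> \<rho> = \<sigma>"
    unfolding \<rho>_def comp_assoc[symmetric] permutes_inv_o(1)[OF perm] by simp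
  ultimately show "\<sigma> \<in> (\<lambda>(\<tau>, \<alpha>, \<beta>). \<tau> \<circ> (\<alpha> \<circ> \<beta>)) `
     (shuffles k l \<times> {\<alpha>. \<alpha> permutes {..<k}} \<times> {\<beta>. \<beta> permutes {k..<k + l}})"
    using \<tau> \<alpha> \<beta> by (intro image_eqI[of _ _ "(\<tau>, \<alpha>, \<beta>)"]) auto
qed (auto simp: shuffles_def intro!: permutes_compose intro: permutes_subset[of _ "{..<k}"] permutes_subset[of _ "{k..<k + l}"])

section \<open>Numerator products and the splitting of alternating sums along blocks\<close>

definition qvand :: "nat \<Rightarrow> 'a::comm_ring_1 mpoly" where
  "qvand n = (\<Prod>(i,j)\<in>pairs n. mvar i - mvar j + 1)"

definition cross :: "nat \<Rightarrow> nat \<Rightarrow> 'a::comm_ring_1 mpoly" where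
  "cross k l = (\<Prod>r<k. \<Prod>r'\<in>{k..<k + l}. mvar r - mvar r' + 1)"

lemma in_vars_qvand [simp]: "in_vars n (qvand n :: 'a::comm_ring_1 mpoly)"
  unfolding qvand_def by (rule in_vars_prod) (auto intro!: in_vars_diff in_vars_mvar in_vars_add)

lemma rename_cross:
  assumes "\<alpha> permutes {..<k}" "\<beta> permutes {k..<k + l}"
  shows "rename (\<alpha> \<circ> \<beta>) (cross k l) = (cross k l :: 'a::comm_ring_1 mpoly)"
proof -
  have "rename (\<alpha> \<circ> \<beta>) (cross k l :: 'a mpoly) = (\<Prod>r<k. \<Prod>r'\<in>{k..<k + l}. mvar (\<alpha> r) - mvar (\<beta> r') + 1)"
    unfolding cross_def rename.prod
  proof (intro prod.cong refl)
    fix r r' assume "r \<in> {..<k}" "r' \<in> {k..<k + l}"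
    then have "(\<alpha> \<circ> \<beta>) r = \<alpha> r" "(\<alpha> \<circ> \<beta>) r' = \<beta> r'" using block_permutes(2,3)[OF assms] by blast+
    then show "rename (\<alpha> \<circ> \<beta>) (mvar r - mvar r' + 1) = (mvar (\<alpha> r) - mvar (\<beta> r') + 1 :: 'a mpoly)"
      by (simp only: rename.add rename.diff rename.one rename_mvar)
  qed
  also have "\<dots> = (\<Prod>r<k. \<Prod>r'\<in>{k..<k + l}. mvar (\<alpha> r) - mvar r' + 1)"
  proof (rule prod.cong[OF refl])
    show "(\<Prod>r'\<in>{k..<k + l}. mvar (\<alpha> r) - mvar (\<beta> r') + 1 :: 'a mpoly) = (\<Prod>r'\<in>{k..<k + l}. mvar (\<alpha> r) - mvar r' + 1)" for r
      using prod.permute[OF assms(2), of "\<lambda>r'. mvar (\<alpha> r) - mvar r' + 1 :: 'a mpoly"] by (simp add: comp_def)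
  qed
  also have "\<dots> = cross k l"
    unfolding cross_def
    using prod.permute[OF assms(1), of "\<lambda>r. \<Prod>r'\<in>{k..<k + l}. mvar r - mvar r' + 1 :: 'a mpoly"]
    by (simp add: comp_def)
  finally show ?thesis .
qed

lemma shift_pairs_prod:
  "(\<Prod>(i,j)\<in>pairs l. g (i + k) (j + k)) = (\<Prod>i\<in>{k..<k + l}. \<Prod>j\<in>{i<..<k + l}. g i j)"
proof -
  have "(\<Prod>i\<in>{k..<k + l}. \<Prod>j\<in>{i<..<k + l}. g i j) = (\<Prod>(i,j)\<in>(SIGMA i:{k..<k + l}. {i<..<k + l}). g i j)"
    by (rule prod.Sigma) auto
  also have "(SIGMA i:{k..<k + l}. {i<..<k + l}) = (\<lambda>(i,j). (i + k, j + k)) ` pairs l"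
  proof safe
    fix i j assume "i \<in> {k..<k + l}" "j \<in> {i<..<k + l}"
    then show "(i, j) \<in> (\<lambda>(i,j). (i + k, j + k)) ` pairs l"
      by (intro image_eqI[of _ _ "(i - k, j - k)"]) auto
  qed auto
  also have "(\<Prod>(i,j)\<in>(\<lambda>(i,j). (i + k, j + k)) ` pairs l. g i j) = (\<Prod>(i,j)\<in>pairs l. g (i + k) (j + k))"
    by (subst prod.reindex) (auto simp: inj_on_def case_prod_beta)
  finally show ?thesis by simp
qed

lemma rename_shift_vand:
  "rename (\<lambda>i. i + k) (vand l) = (\<Prod>i\<in>{k..<k + l}. \<Prod>j\<in>{i<..<k + l}. mvar i - mvar j :: 'a::comm_ring_1 mpoly)"
  unfolding shift_pairs_prod[symmetric] vand_pairs rename.prod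
  by (rule prod.cong) (auto simp: rename.diff)

text \<open>A pair of indices lies in the first block, in the second, or across. This factorization
  is what makes symmetrization multiplicative for the shuffle product.\<close>

lemma qvand_add:
  "qvand (k + l) = qvand k * rename (\<lambda>i. i + k) (qvand l) * (cross k l :: 'a::comm_ring_1 mpoly)"
proof -
  let ?g = "\<lambda>i j. mvar i - mvar j + 1 :: 'a mpoly"
  have "qvand (k + l) = (\<Prod>i<k + l. \<Prod>j\<in>{i<..<k + l}. ?g i j)"
    unfolding qvand_def prod_pairs ..
  also have "\<dots> = (\<Prod>i<k. \<Prod>j\<in>{i<..<k + l}. ?g i j) * (\<Prod>i\<in>{k..<k + l}. \<Prod>j\<in>{i<..<k + l}. ?g i j)"
    by (subst prod.union_disjoint[symmetric]) (auto intro!: prod.cong)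
  also have "(\<Prod>i<k. \<Prod>j\<in>{i<..<k + l}. ?g i j) = (\<Prod>i<k. (\<Prod>j\<in>{i<..<k}. ?g i j) * (\<Prod>j\<in>{k..<k + l}. ?g i j))"
    by (intro prod.cong refl, subst prod.union_disjoint[symmetric]) (auto intro!: prod.cong)
  also have "\<dots> = qvand k * cross k l"
    unfolding prod.distrib qvand_def prod_pairs cross_def ..
  also have "(\<Prod>i\<in>{k..<k + l}. \<Prod>j\<in>{i<..<k + l}. ?g i j) = rename (\<lambda>i. i + k) (qvand l)"
    unfolding shift_pairs_prod[symmetric] qvand_def rename.prod
    by (rule prod.cong) (auto simp: rename.diff rename.add)
  finally show ?thesis by (simp add: ac_simps)
qed

text \<open>Conjugation by the shift carries permutations of \<open>{..<l}\<close> bijectively to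
  those of the second block and preserves signs.\<close>

lemma rename_shift_alternate:
  assumes g: "in_vars l g"
  shows "rename (\<lambda>i. i + k) (alternate l g)
    = (\<Sum>\<beta> | \<beta> permutes {k..<k + l}. of_int (sign \<beta>) * rename \<beta> (rename (\<lambda>i. i + k) g))"
proof -
  define s where "s = (\<lambda>i::nat. i + k)"
  let ?M = "map_permutation {..<l} s"
  have inj: "inj_on s {..<l}" by (simp add: s_def)
  have im: "s ` {..<l} = {k..<k + l}"
  proof safe
    fix x assume "x \<in> {k..<k + l}"
    then show "x \<in> s ` {..<l}" by (intro image_eqI[of _ _ "x - k"]) (auto simp: s_def)
  qed (auto simp: s_def)
  have bij: "bij_betw s {..<l} {k..<k + l}" using inj im by (simp add: bij_betw_def)
  have bij': "bij_betw (\<lambda>i. i - k) {k..<k + l} {..<l}"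
    by (rule bij_betw_byWitness[where f' = s]) (auto simp: s_def)
  have bijM: "bij_betw ?M {\<beta>. \<beta> permutes {..<l}} {\<beta>. \<beta> permutes {k..<k + l}}"
  proof (rule bij_betw_byWitness[where f' = "map_permutation {k..<k + l} (\<lambda>i. i - k)"])
    show "\<forall>p\<in>{\<beta>. \<beta> permutes {..<l}}. map_permutation {k..<k + l} (\<lambda>i. i - k) (?M p) = p"
      using bij by (auto intro!: map_permutation_compose_inv simp: s_def)
    show "\<forall>p\<in>{\<beta>. \<beta> permutes {k..<k + l}}. ?M (map_permutation {k..<k + l} (\<lambda>i. i - k) p) = p"
      using bij' by (auto intro!: map_permutation_compose_inv simp: s_def)
    show "?M ` {\<beta>. \<beta> permutes {..<l}} \<subseteq> {\<beta>. \<beta> permutes {k..<k + l}}"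
      using bij by (auto intro!: map_permutation_permutes)
    show "map_permutation {k..<k + l} (\<lambda>i. i - k) ` {\<beta>. \<beta> permutes {k..<k + l}} \<subseteq> {\<beta>. \<beta> permutes {..<l}}"
      using bij' by (auto intro!: map_permutation_permutes)
  qed
  have "(\<Sum>\<beta> | \<beta> permutes {k..<k + l}. of_int (sign \<beta>) * rename \<beta> (rename s g))
      = (\<Sum>\<beta> | \<beta> permutes {..<l}. of_int (sign (?M \<beta>)) * rename (?M \<beta>) (rename s g))"
    by (rule sum.reindex_bij_betw[OF bijM, symmetric])
  also have "\<dots> = (\<Sum>\<beta> | \<beta> permutes {..<l}. of_int (sign \<beta>) * rename s (rename \<beta> g))"
  proof (intro sum.cong refl)
    fix \<beta> assume "\<beta> \<in> {\<beta>. \<beta> permutes {..<l}}"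
    then have \<beta>: "\<beta> permutes {..<l}" by simp
    have "rename (?M \<beta>) (rename s g) = rename s (rename \<beta> g)"
      unfolding rename_rename
      by (rule rename_cong[OF g]) (simp add: map_permutation_apply[OF inj])
    then show "of_int (sign (?M \<beta>)) * rename (?M \<beta>) (rename s g) = of_int (sign \<beta>) * rename s (rename \<beta> g)"
      by (simp add: sign_map_permutation[OF inj \<beta>])
  qed
  also have "\<dots> = rename s (alternate l g)"
    by (simp add: alternate_def rename.sum rename.mult)
  finally show ?thesis by (simp add: s_def)
qed

text \<open>Each permutation is a block permutation followed by a shuffle. In the inner sum
  \<open>f\<close> sees only \<open>\<alpha>\<close>, the shifted \<open>g\<close> only
  \<open>\<beta>\<close>, and \<open>cross\<close> neither, so that sum factors into two smaller
  alternating sums.\<close>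

lemma alternate_shuffles:
  fixes f g :: "'a::comm_ring_1 mpoly"
  assumes f: "in_vars k f" and g: "in_vars l g"
  shows "alternate (k + l) (f * rename (\<lambda>i. i + k) g * cross k l)
    = (\<Sum>\<tau>\<in>shuffles k l. of_int (sign \<tau>) *
         rename \<tau> (alternate k f * rename (\<lambda>i. i + k) (alternate l g) * cross k l))"
proof -
  define g' where "g' = rename (\<lambda>i. i + k) g"
  let ?A = "{\<alpha>. \<alpha> permutes {..<k}}" and ?B = "{\<beta>. \<beta> permutes {k..<k + l}}"
  let ?t = "\<lambda>\<alpha> \<beta>. (of_int (sign \<alpha>) * rename \<alpha> f) * (of_int (sign \<beta>) * rename \<beta> g') * cross k l"
  have block: "of_int (sign (\<alpha> \<circ> \<beta>)) * rename (\<alpha> \<circ> \<beta>) (f * g' * cross k l) = ?t \<alpha> \<beta>"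
    if "\<alpha> permutes {..<k}" "\<beta> permutes {k..<k + l}" for \<alpha> \<beta>
  proof -
    have "permutation \<alpha>" "permutation \<beta>" using that by (auto simp: permutation_permutes)
    then have sg: "sign (\<alpha> \<circ> \<beta>) = sign \<alpha> * sign \<beta>" by (rule sign_compose)
    have rf: "rename (\<alpha> \<circ> \<beta>) f = rename \<alpha> f"
      by (rule rename_cong[OF f]) (rule block_permutes(2)[OF that])
    have rg: "rename (\<alpha> \<circ> \<beta>) g' = rename \<beta> g'"
      unfolding g'_def rename_rename
    proof (rule rename_cong[OF g])
      fix i assume "i < l"
      then show "((\<alpha> \<circ> \<beta>) \<circ> (\<lambda>i. i + k)) i = (\<beta> \<circ> (\<lambda>i. i + k)) i"
        using block_permutes(3)[OF that, of "i + k"] by simp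
    qed
    show ?thesis unfolding rename.mult rf rg rename_cross[OF that] sg by (simp add: ac_simps)
  qed
  have "alternate (k + l) (f * g' * cross k l)
      = (\<Sum>(\<tau>, \<alpha>, \<beta>)\<in>shuffles k l \<times> ?A \<times> ?B. of_int (sign (\<tau> \<circ> (\<alpha> \<circ> \<beta>))) * rename (\<tau> \<circ> (\<alpha> \<circ> \<beta>)) (f * g' * cross k l))"
    unfolding alternate_def
    by (subst sum.reindex_bij_betw[OF bij_betw_shuffles, symmetric]) (simp add: case_prod_beta)
  also have "\<dots> = (\<Sum>(\<tau>, \<alpha>, \<beta>)\<in>shuffles k l \<times> ?A \<times> ?B. of_int (sign \<tau>) * rename \<tau> (?t \<alpha> \<beta>))"
  proof (rule sum.cong[OF refl], clarify)
    fix \<tau> \<alpha> \<beta> assume *: "\<tau> \<in> shuffles k l" "\<alpha> permutes {..<k}" "\<beta> permutes {k..<k + l}"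
    have "permutation \<tau>" "permutation (\<alpha> \<circ> \<beta>)"
      using *(1) block_permutes(1)[OF *(2,3)] by (auto simp: shuffles_def permutation_of_permutes simp del: o_apply)
    then have sg: "sign (\<tau> \<circ> (\<alpha> \<circ> \<beta>)) = sign \<tau> * sign (\<alpha> \<circ> \<beta>)" by (rule sign_compose)
    show "of_int (sign (\<tau> \<circ> (\<alpha> \<circ> \<beta>))) * rename (\<tau> \<circ> (\<alpha> \<circ> \<beta>)) (f * g' * cross k l)
        = of_int (sign \<tau>) * rename \<tau> (?t \<alpha> \<beta>)"
      unfolding sg rename_rename[symmetric, of \<tau> "\<alpha> \<circ> \<beta>"] block[OF *(2,3), symmetric] rename.mult[of \<tau> "of_int _"] rename.of_int
      by (simp only: of_int_mult mult.assoc)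
  qed
  also have "\<dots> = (\<Sum>\<tau>\<in>shuffles k l. \<Sum>\<alpha>\<in>?A. \<Sum>\<beta>\<in>?B. of_int (sign \<tau>) * rename \<tau> (?t \<alpha> \<beta>))"
    by (simp add: sum.cartesian_product)
  also have "\<dots> = (\<Sum>\<tau>\<in>shuffles k l. of_int (sign \<tau>) * rename \<tau> (\<Sum>\<alpha>\<in>?A. \<Sum>\<beta>\<in>?B. ?t \<alpha> \<beta>))"
    by (simp only: sum_distrib_left rename.sum)
  also have "(\<Sum>\<alpha>\<in>?A. \<Sum>\<beta>\<in>?B. ?t \<alpha> \<beta>) = alternate k f * rename (\<lambda>i. i + k) (alternate l g) * cross k l"
    unfolding rename_shift_alternate[OF g] alternate_def[of k] g'_def
    unfolding sum_product unfolding sum_distrib_right ..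
  finally show ?thesis by (simp only: g'_def)
qed

text \<open>The operator Sym with all fractions put over the common denominator \<open>vand\<close>;
  the sign by which a permutation changes this denominator becomes the sign in
  \<open>alternate\<close>.\<close>

definition symmetrize :: "nat \<Rightarrow> 'a::comm_ring_1 mpoly \<Rightarrow> 'a mpoly" where
  "symmetrize n f = (THE q. q * vand n = alternate n (f * qvand n))"

lemma symmetrize_eqI:
  fixes q :: "'a::idom mpoly"
  assumes "q * vand n = alternate n (f * qvand n)"
  shows "symmetrize n f = q"
  unfolding symmetrize_def using assms by (intro the_equality) (auto simp flip: assms)

lemma symmetrize_vand:
  fixes f :: "'a::idom mpoly"
  assumes "(2::'a) \<noteq> 0"
  shows "symmetrize n f * vand n = alternate n (f * qvand n)"
proof -
  obtain q where "alternate n (f * qvand n) = vand n * q"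
    using vand_dvd_alternate[OF assms, of n "f * qvand n"] by (elim dvdE)
  then have "q * vand n = alternate n (f * qvand n)" by (simp add: mult.commute)
  then show ?thesis using symmetrize_eqI by metis
qed

lemma symmetrize_0 [simp]: "symmetrize n (0::'a::idom mpoly) = 0"
  by (rule symmetrize_eqI) simp

lemma symmetrize_add:
  fixes f g :: "'a::idom mpoly"
  assumes "(2::'a) \<noteq> 0"
  shows "symmetrize n (f + g) = symmetrize n f + symmetrize n g"
  by (rule symmetrize_eqI) (simp add: distrib_right alternate_add symmetrize_vand[OF assms])

lemma symmetrize_mconst:
  fixes f :: "'a::idom mpoly"
  assumes "(2::'a) \<noteq> 0"
  shows "symmetrize n (mconst c * f) = mconst c * symmetrize n f"
  by (rule symmetrize_eqI) (simp add: mult.assoc alternate_mconst symmetrize_vand[OF assms])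

lemma sym_poly_symmetrize:
  fixes f :: "'a::idom mpoly"
  assumes two: "(2::'a) \<noteq> 0" and f: "in_vars n f"
  shows "sym_poly n (symmetrize n f)"
  unfolding sym_poly_def
proof (intro conjI allI impI)
  show "in_vars n (symmetrize n f)"
    by (rule in_vars_cancel[of _ _ "vand n"])
       (simp_all add: symmetrize_vand[OF two] in_vars_alternate in_vars_mult f)
  fix \<sigma> assume \<sigma>: "\<sigma> permutes {..<n}"
  let ?s = "of_int (sign \<sigma>) :: 'a mpoly"
  have "rename \<sigma> (symmetrize n f) * (?s * vand n) = rename \<sigma> (symmetrize n f * vand n)"
    by (simp add: rename.mult rename_vand[OF \<sigma>])
  also have "\<dots> = symmetrize n f * (?s * vand n)"
    unfolding symmetrize_vand[OF two] rename_alternate[OF \<sigma>]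
    unfolding symmetrize_vand[OF two, symmetric] by (simp only: ac_simps)
  finally have "rename \<sigma> (symmetrize n f) * (?s * vand n) = symmetrize n f * (?s * vand n)" .
  moreover have "?s \<noteq> 0" by (simp add: sign_def)
  ultimately show "rename \<sigma> (symmetrize n f) = symmetrize n f" by simp
qed

text \<open>Attaches the Vandermonde factors inside each block to \<open>F\<close> and to the
  shifted \<open>G\<close>; for symmetrizations these products are exactly the alternating
  sums.\<close>

lemma star_eqI:
  fixes q :: "'a::idom mpoly"
  assumes "q * vand (k + l) = (\<Sum>\<sigma>\<in>shuffles k l. of_int (sign \<sigma>) *
     rename \<sigma> ((F * vand k) * rename (\<lambda>i. i + k) (G * vand l) * cross k l))"
  shows "star k l F G = q"
proof -
  have h: "F * rename (\<lambda>i. i + k) G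
             * (\<Prod>r<k. \<Prod>r'\<in>{k..<k+l}. mvar r - mvar r' + 1)
             * (\<Prod>i<k. \<Prod>j\<in>{i<..<k}. mvar i - mvar j)
             * (\<Prod>i\<in>{k..<k+l}. \<Prod>j\<in>{i<..<k+l}. mvar i - mvar j)
     = (F * vand k) * rename (\<lambda>i. i + k) (G * vand l) * cross k l"
    unfolding rename.mult rename_shift_vand cross_def[symmetric] vand_def[symmetric] by (simp only: ac_simps)
  show ?thesis
    unfolding star_def Let_def h assms[symmetric]
    by (rule the_equality) auto
qed

lemma star_symmetrize:
  fixes f g :: "'a::idom mpoly"
  assumes two: "(2::'a) \<noteq> 0" and f: "in_vars k f" and g: "in_vars l g"
  shows "star k l (symmetrize k f) (symmetrize l g) = symmetrize (k + l) (f * rename (\<lambda>i. i + k) g)"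
proof (rule star_eqI)
  have *: "f * rename (\<lambda>i. i + k) g * qvand (k + l)
      = (f * qvand k) * rename (\<lambda>i. i + k) (g * qvand l) * cross k l"
    by (simp add: qvand_add rename.mult ac_simps)
  have "symmetrize (k + l) (f * rename (\<lambda>i. i + k) g) * vand (k + l)
      = alternate (k + l) ((f * qvand k) * rename (\<lambda>i. i + k) (g * qvand l) * cross k l)"
    unfolding symmetrize_vand[OF two] * ..
  also have "\<dots> = (\<Sum>\<sigma>\<in>shuffles k l. of_int (sign \<sigma>) *
     rename \<sigma> (alternate k (f * qvand k) * rename (\<lambda>i. i + k) (alternate l (g * qvand l)) * cross k l))"
    by (intro alternate_shuffles in_vars_mult f g in_vars_qvand)
  finally show "symmetrize (k + l) (f * rename (\<lambda>i. i + k) g) * vand (k + l)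
      = (\<Sum>\<sigma>\<in>shuffles k l. of_int (sign \<sigma>) *
     rename \<sigma> (symmetrize k f * vand k * rename (\<lambda>i. i + k) (symmetrize l g * vand l) * cross k l))"
    by (simp only: symmetrize_vand[OF two])
qed

lemma star_0_left [simp]: "star k l 0 G = (0::'a::idom mpoly)"
  and star_0_right [simp]: "star k l F 0 = (0::'a::idom mpoly)"
  by (rule star_eqI; simp)+

section \<open>Homogeneous components\<close>

definition mon_degree :: "(nat \<Rightarrow>\<^sub>0 nat) \<Rightarrow> nat" where
  "mon_degree m = (\<Sum>i\<in>Poly_Mapping.keys m. Poly_Mapping.lookup m i)"

text \<open>The homogeneous components of \<open>f\<close> are the coefficients of \<open>f (T x)\<close> as a polynomial in \<open>T\<close>.\<close>

definition grade :: "'a::comm_ring_1 mpoly \<Rightarrow> 'a mpoly poly" where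
  "grade = poly_eval (\<lambda>c. [:mconst c:]) (\<lambda>i. [:0, mvar i:])"

definition hom_part :: "nat \<Rightarrow> 'a::comm_ring_1 mpoly \<Rightarrow> 'a mpoly" where
  "hom_part d f = coeff (grade f) d"

lemma comm_ring_hom_const_mconst: "comm_ring_hom (\<lambda>c. [:mconst (c::'a::comm_ring_1):])"
  by unfold_locales (simp_all add: mconst.add mconst.mult)

interpretation grade: comm_ring_hom grade
  unfolding grade_def by (rule comm_ring_hom.poly_eval_hom[OF comm_ring_hom_const_mconst])

lemma mon_degree_superset:
  assumes "finite A" "Poly_Mapping.keys m \<subseteq> A"
  shows "mon_degree m = (\<Sum>i\<in>A. Poly_Mapping.lookup m i)"
  unfolding mon_degree_def using assms by (intro sum.mono_neutral_left) (auto simp: in_keys_iff)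

lemma mon_degree_add: "mon_degree (m + n) = mon_degree m + mon_degree n"
proof -
  let ?A = "Poly_Mapping.keys m \<union> Poly_Mapping.keys n"
  have "Poly_Mapping.keys (m + n) \<subseteq> ?A" by (rule keys_add)
  then show ?thesis
    by (simp add: mon_degree_superset[of ?A] lookup_add sum.distrib)
qed

lemma mon_degree_0 [simp]: "mon_degree 0 = 0"
  by (simp add: mon_degree_def)

lemma mon_degree_single [simp]: "mon_degree (Poly_Mapping.single i n) = n"
  by (cases "n = 0") (simp_all add: mon_degree_def)

lemma grade_mvar [simp]: "grade (mvar i) = [:0, mvar i:]"
  and grade_mconst [simp]: "grade (mconst c) = [:mconst c:]"
  unfolding grade_def
  by (simp_all add: comm_ring_hom.poly_eval_mvar comm_ring_hom.poly_eval_mconst comm_ring_hom_const_mconst)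

lemma mon_eval_grade: "mon_eval (\<lambda>i. [:0, mvar i:]) m = monom (Poly_Mapping.single m (1::'a::comm_ring_1)) (mon_degree m)"
proof (induction m rule: poly_mapping_single_induct)
  case (single i n)
  have "[:0, mvar i :: 'a mpoly:] ^ n = monom (mvar i ^ n) n"
    using monom_power[of "mvar i :: 'a mpoly" 1 n] by (simp add: monom_Suc monom_0)
  then show ?case by (simp add: mvar_power)
next
  case (add f g) then show ?case by (simp add: mon_eval_add mult_monom mult_single mon_degree_add)
qed simp

lemma grade_single: "grade (Poly_Mapping.single m c) = monom (Poly_Mapping.single m c) (mon_degree m)"
  unfolding grade_def comm_ring_hom.poly_eval_single[OF comm_ring_hom_const_mconst] mon_eval_grade
  by (simp add: smult_monom mconst_def mult_single)

lemma hom_part_add: "hom_part d (f + g) = hom_part d f + hom_part d g"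
  by (simp add: hom_part_def grade.add)

lemma hom_part_sum: "hom_part d (sum f A) = (\<Sum>x\<in>A. hom_part d (f x))"
  by (simp add: hom_part_def grade.sum coeff_sum)

lemma hom_part_mconst_mult: "hom_part d (mconst c * f) = mconst c * hom_part d f"
  by (simp add: hom_part_def grade.mult)

lemma lookup_hom_part:
  "Poly_Mapping.lookup (hom_part d f) m = (Poly_Mapping.lookup f m when mon_degree m = d)"
proof (induction f rule: poly_mapping_single_induct)
  case zero then show ?case by (simp add: hom_part_def)
next
  case (single n c)
  then show ?case by (auto simp: hom_part_def grade_single lookup_single when_def)
next
  case (add f g) then show ?case by (simp add: hom_part_add lookup_add when_add_distrib)
qed

lemma hom_part_mult_homogeneous:
  assumes "grade g = monom g e"
  shows "hom_part (d + e) (f * g) = hom_part d f * g"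
  unfolding hom_part_def grade.mult assms
  unfolding mult.commute[of "grade f"] by (simp add: coeff_monom_mult)

lemma mon_degree_sum: "mon_degree (sum f A) = (\<Sum>x\<in>A. mon_degree (f x))"
  by (induction A rule: infinite_finite_induct) (simp_all add: mon_degree_add)

lemma mon_degree_mon_rename [simp]: "mon_degree (mon_rename \<sigma> m) = mon_degree m"
  by (simp add: mon_rename_def mon_degree_sum) (simp add: mon_degree_def)

lemma hom_part_rename: "hom_part d (rename \<sigma> f) = rename \<sigma> (hom_part d (f :: 'a::comm_ring_1 mpoly))"
proof (induction f rule: poly_mapping_single_induct)
  case (single m c) then show ?case by (simp add: hom_part_def grade_single)
next
  case (add f g) then show ?case by (simp add: hom_part_add rename.add)
qed (simp add: hom_part_def)

lemma hom_part_alternate: "hom_part d (alternate n f) = alternate n (hom_part d f)"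
proof -
  have "hom_part d (of_int c * f) = of_int c * hom_part d f" for c and f :: "'a mpoly"
    using hom_part_mconst_mult[of d "of_int c" f] by simp
  then show ?thesis by (simp add: alternate_def hom_part_sum hom_part_rename)
qed

lemma grade_vand: "grade (vand n) = monom (vand n) (card (pairs n))"
proof -
  have "grade (mvar i - mvar j) = monom (mvar i - mvar j :: 'a mpoly) 1" for i j
    by (simp add: grade.diff monom_Suc monom_0)
  moreover have "(\<Prod>x\<in>S. monom (c x) 1) = monom (prod c S) (card S)" if "finite S"
    for S :: "(nat \<times> nat) set" and c :: "_ \<Rightarrow> 'a mpoly"
    using that by (induction S rule: finite_induct) (simp_all add: mult_monom)
  ultimately show ?thesis by (simp add: vand_pairs grade.prod case_prod_beta)
qed

text \<open>Only a bound on the degree, since \<open>c x\<close> may vanish. Applied to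
  \<open>qvand\<close>, whose factors have the graded form 1 + (x_i - x_j) T.\<close>

lemma degree_coeff_prod_linear:
  fixes c :: "'b \<Rightarrow> 'a::comm_ring_1"
  assumes "finite S"
  shows "degree (\<Prod>x\<in>S. [:1, c x:]) \<le> card S \<and> coeff (\<Prod>x\<in>S. [:1, c x:]) (card S) = prod c S"
  using assms
proof (induction S rule: finite_induct)
  case (insert x S)
  let ?P = "\<Prod>x\<in>S. [:1, c x:]"
  have "degree ([:1, c x:] * ?P) \<le> degree [:1, c x:] + degree ?P" by (rule degree_mult_le)
  also have "\<dots> \<le> Suc (card S)" using insert by simp
  finally have "degree ([:1, c x:] * ?P) \<le> Suc (card S)" .
  moreover have "coeff ([:1, c x:] * ?P) (Suc (card S)) = c x * prod c S"
    using insert coeff_eq_0[of ?P "Suc (card S)"] by simp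
  ultimately show ?case using insert(1,2) by simp
qed simp

lemma hom_part_qvand:
  "hom_part (card (pairs n)) (qvand n) = (vand n :: 'a::comm_ring_1 mpoly)"
  "d > card (pairs n) \<Longrightarrow> hom_part d (qvand n) = (0 :: 'a mpoly)"
proof -
  have "grade (mvar i - mvar j + 1) = [:1, mvar i - mvar j :: 'a mpoly:]" for i j
    by (simp add: grade.diff grade.add one_pCons)
  then have g: "grade (qvand n :: 'a mpoly) = (\<Prod>x\<in>pairs n. [:1, mvar (fst x) - mvar (snd x):])"
    by (simp add: qvand_def grade.prod case_prod_beta)
  note * = degree_coeff_prod_linear[OF finite_pairs[of n], of "\<lambda>x. mvar (fst x) - mvar (snd x) :: 'a mpoly"]
  show "hom_part (card (pairs n)) (qvand n) = (vand n :: 'a mpoly)"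
    using * by (simp add: hom_part_def g vand_pairs case_prod_beta)
  show "hom_part d (qvand n) = (0 :: 'a mpoly)" if "d > card (pairs n)"
    unfolding hom_part_def g using * that by (intro coeff_eq_0) simp
qed

text \<open>In top degree \<open>qvand\<close> becomes \<open>vand\<close>, whose signs cancel those
  of \<open>alternate\<close>, and the plain sum over permutations remains. Degrees above
  \<open>d\<close> are included to show that nothing higher occurs.\<close>

lemma hom_part_symmetrize:
  fixes f :: "'a::idom mpoly"
  assumes two: "(2::'a) \<noteq> 0" and f: "grade f = monom f d" and D: "d \<le> D"
  shows "hom_part D (symmetrize n f) = (if D = d then \<Sum>\<sigma> | \<sigma> permutes {..<n}. rename \<sigma> f else 0)"
proof -
  let ?e = "card (pairs n)"
  \<comment> \<open>Multiplication by \<open>vand\<close> shifts degrees by \<open>?e\<close>, and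
    by \<open>f\<close> it shifts them by \<open>d\<close>; what is left is a component of
    \<open>qvand\<close> in degree at least \<open>?e\<close>.\<close>
  have DE: "D + ?e = (D - d + ?e) + d" using D by simp
  have "hom_part D (symmetrize n f) * vand n = hom_part (D + ?e) (symmetrize n f * vand n)"
    by (rule hom_part_mult_homogeneous[OF grade_vand, symmetric])
  also have "\<dots> = alternate n (hom_part (D + ?e) (qvand n * f))"
    unfolding symmetrize_vand[OF two] hom_part_alternate by (simp only: mult.commute)
  also have "\<dots> = alternate n (hom_part (D - d + ?e) (qvand n) * f)"
    unfolding DE hom_part_mult_homogeneous[OF f] ..
  finally have *: "hom_part D (symmetrize n f) * vand n = alternate n (hom_part (D - d + ?e) (qvand n) * f)" .
  show ?thesis
  proof (cases "D = d")
    case True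
    have s: "of_int (sign \<sigma>) * (of_int (sign \<sigma>) * x) = x" for x :: "'a mpoly" and \<sigma> :: "nat \<Rightarrow> nat"
      by (simp add: mult.assoc[symmetric] of_int_mult[symmetric] del: of_int_mult)
    have "alternate n (vand n * f) = (\<Sum>\<sigma> | \<sigma> permutes {..<n}. rename \<sigma> f) * vand n"
      unfolding alternate_def sum_distrib_right
    proof (intro sum.cong refl)
      fix \<sigma> assume "\<sigma> \<in> {\<sigma>. \<sigma> permutes {..<n}}"
      then have "of_int (sign \<sigma>) * rename \<sigma> (vand n * f)
          = of_int (sign \<sigma>) * (of_int (sign \<sigma>) * (vand n * rename \<sigma> f))"
        by (simp only: mem_Collect_eq rename.mult rename_vand mult.assoc)
      also have "\<dots> = rename \<sigma> f * vand n" unfolding s by (rule mult.commute)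
      finally show "of_int (sign \<sigma>) * rename \<sigma> (vand n * f) = rename \<sigma> f * vand n" .
    qed
    then show ?thesis using * True by (simp add: hom_part_qvand)
  next
    case False
    then have "D - d + ?e > ?e" using D by simp
    then show ?thesis using * False by (simp add: hom_part_qvand)
  qed
qed

section \<open>Leading coefficients of symmetrized monomials\<close>

definition list_mon :: "nat list \<Rightarrow> (nat \<Rightarrow>\<^sub>0 nat)" where
  "list_mon l = (\<Sum>i<length l. Poly_Mapping.single i (l ! i))"

lemma lookup_list_mon: "Poly_Mapping.lookup (list_mon l) i = (if i < length l then l ! i else 0)"
  by (simp add: list_mon_def lookup_sum lookup_single when_def)

lemma mmono_eq_single: "mmono l = Poly_Mapping.single (list_mon l) (1::'a::comm_ring_1)"
  unfolding mmono_def mon_eval_mvar[symmetric] list_mon_def mon_eval_sum by simp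

lemma mon_degree_list_mon [simp]: "mon_degree (list_mon l) = sum_list l"
  by (simp add: list_mon_def mon_degree_sum sum_list_sum_nth atLeast0LessThan)

lemma in_vars_mmono: "in_vars (length l) (mmono l :: 'a::comm_ring_1 mpoly)"
  unfolding mmono_def by (intro in_vars_prod in_vars_power in_vars_mvar) simp

text \<open>Monomials of degree above \<open>sum_list l\<close> are allowed on purpose: both sides
  are then zero, so one formula gives the leading coefficients and the degree bound.\<close>

lemma lookup_symmetrize_mmono:
  fixes m :: "nat \<Rightarrow>\<^sub>0 nat"
  assumes two: "(2::'a::idom) \<noteq> 0" and deg: "sum_list l \<le> mon_degree m"
  shows "Poly_Mapping.lookup (symmetrize n (mmono l :: 'a mpoly)) m
    = of_nat (card {\<sigma>. \<sigma> permutes {..<n} \<and> mon_rename \<sigma> (list_mon l) = m})"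
proof -
  have f: "grade (mmono l :: 'a mpoly) = monom (mmono l) (sum_list l)"
    by (simp add: mmono_eq_single grade_single)
  have "Poly_Mapping.lookup (symmetrize n (mmono l :: 'a mpoly)) m
      = Poly_Mapping.lookup (hom_part (mon_degree m) (symmetrize n (mmono l :: 'a mpoly))) m"
    by (simp add: lookup_hom_part)
  also have "\<dots> = of_nat (card {\<sigma>. \<sigma> permutes {..<n} \<and> mon_rename \<sigma> (list_mon l) = m})"
  proof (cases "mon_degree m = sum_list l")
    case True
    have "Poly_Mapping.lookup (\<Sum>\<sigma> | \<sigma> permutes {..<n}. rename \<sigma> (mmono l :: 'a mpoly)) m
       = (\<Sum>\<sigma> | \<sigma> permutes {..<n}. if mon_rename \<sigma> (list_mon l) = m then 1 else 0)"
      by (simp add: lookup_sum mmono_eq_single lookup_single when_def)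
    also have "\<dots> = of_nat (card {\<sigma>. \<sigma> permutes {..<n} \<and> mon_rename \<sigma> (list_mon l) = m})"
      by (subst sum.inter_filter[symmetric]) (simp_all add: finite_permutations)
    finally show ?thesis
      unfolding hom_part_symmetrize[OF two f deg] using True by simp
  next
    case False
    then have empty: "{\<sigma>. \<sigma> permutes {..<n} \<and> mon_rename \<sigma> (list_mon l) = m} = {}"
      using mon_degree_mon_rename[of _ "list_mon l"] by fastforce
    show ?thesis
      unfolding hom_part_symmetrize[OF two f deg] empty using False by simp
  qed
  finally show ?thesis .
qed

section \<open>Integrality of the symmetrized monomials\<close>

lemma mon_rename_0 [simp]: "mon_rename \<sigma> 0 = 0"
  by (simp add: mon_rename_def)

lemma mmono_Nil [simp]: "mmono [] = (1::'a::comm_ring_1 mpoly)"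
  by (simp add: mmono_def)

text \<open>The empty monomial has degree 0, so the formula for leading coefficients covers every
  coefficient; all permutations fix the zero exponent vector.\<close>

lemma symmetrize_1:
  assumes two: "(2::'a::idom) \<noteq> 0"
  shows "symmetrize n 1 = (of_nat (fact n) :: 'a mpoly)"
proof (rule poly_mapping_eqI)
  fix m
  have "Poly_Mapping.lookup (symmetrize n (mmono [] :: 'a mpoly)) m
    = of_nat (card {\<sigma>. \<sigma> permutes {..<n} \<and> mon_rename \<sigma> (list_mon []) = m})"
    by (rule lookup_symmetrize_mmono[OF two]) simp
  also have "\<dots> = (of_nat (fact n) when m = 0)"
    using card_permutations[of "{..<n}" n] by (auto simp: list_mon_def when_def)
  finally show "Poly_Mapping.lookup (symmetrize n 1) m = Poly_Mapping.lookup (of_nat (fact n) :: 'a mpoly) m"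
    by (auto simp: lookup_of_nat when_def simp del: of_nat_fact)
qed

lemma symmetrize_mult_sym:
  fixes f g :: "'a::idom mpoly"
  assumes two: "(2::'a) \<noteq> 0" and sym: "\<And>\<sigma>. \<sigma> permutes {..<n} \<Longrightarrow> rename \<sigma> g = g"
  shows "symmetrize n (g * f) = g * symmetrize n f"
proof (rule symmetrize_eqI)
  have "alternate n (g * (f * qvand n)) = g * alternate n (f * qvand n)"
    unfolding alternate_def sum_distrib_left
    by (intro sum.cong refl) (simp add: rename.mult sym ac_simps)
  then show "g * symmetrize n f * vand n = alternate n (g * f * qvand n)"
    by (simp only: mult.assoc symmetrize_vand[OF two])
qed

text \<open>A monomial with equal exponents is symmetric and comes out of the symmetrization,
  leaving Sym 1. This is the source of the factorials in \<open>mul_part\<close>.\<close>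

lemma symmetrize_mmono_replicate:
  assumes two: "(2::'a::idom) \<noteq> 0"
  shows "symmetrize m (mmono (replicate m r) :: 'a mpoly) = of_nat (fact m) * mmono (replicate m r)"
proof -
  have "rename \<sigma> (mmono (replicate m r) :: 'a mpoly) = mmono (replicate m r)" if "\<sigma> permutes {..<m}" for \<sigma>
  proof -
    have "rename \<sigma> (mmono (replicate m r) :: 'a mpoly) = (\<Prod>i<m. mvar (\<sigma> i) ^ r)"
      by (simp add: mmono_def rename.prod rename.power)
    also have "\<dots> = (\<Prod>i<m. mvar i ^ r)"
      using prod.permute[OF that, of "\<lambda>i. mvar i ^ r :: 'a mpoly"] by (simp add: comp_def)
    finally show ?thesis by (simp add: mmono_def)
  qed
  then show ?thesis
    using symmetrize_mult_sym[OF two, of m "mmono (replicate m r)" 1]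
    by (simp add: symmetrize_1[OF two] mult.commute)
qed

lemma mmono_append:
  "mmono (l @ l') = mmono l * rename (\<lambda>i. i + length l) (mmono l' :: 'a::comm_ring_1 mpoly)"
proof -
  have "mmono (l @ l') = (\<Prod>i\<in>{..<length l} \<union> {length l..<length l + length l'}. mvar i ^ ((l @ l') ! i) :: 'a mpoly)"
    unfolding mmono_def by (intro prod.cong) auto
  also have "\<dots> = (\<Prod>i<length l. mvar i ^ ((l @ l') ! i)) * (\<Prod>i\<in>{length l..<length l + length l'}. mvar i ^ ((l @ l') ! i))"
    by (intro prod.union_disjoint) auto
  also have "(\<Prod>i<length l. mvar i ^ ((l @ l') ! i)) = (mmono l :: 'a mpoly)"
    unfolding mmono_def by (intro prod.cong) (auto simp: nth_append)
  also have "(\<Prod>i\<in>{length l..<length l + length l'}. mvar i ^ ((l @ l') ! i))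
      = (\<Prod>i\<in>{0..<length l'}. mvar (i + length l) ^ ((l @ l') ! (i + length l)) :: 'a mpoly)"
    using prod.shift_bounds_nat_ivl[of "\<lambda>i. mvar i ^ ((l @ l') ! i) :: 'a mpoly" 0 "length l" "length l'"]
    by (simp add: add.commute)
  also have "\<dots> = rename (\<lambda>i. i + length l) (mmono l')"
    by (simp add: mmono_def rename.prod rename.power nth_append atLeast0LessThan)
  finally show ?thesis .
qed

text \<open>Every term of the shuffle expansion contains the factor \<open>M * N\<close>. What
  remains is again alternating, hence itself divisible by \<open>vand\<close>, so the factor
  survives the division over the integers.\<close>

lemma of_nat_dvd_symmetrize_append:
  fixes M N :: nat
  assumes l1: "symmetrize (length l1) (mmono l1 :: int mpoly) = of_nat M * Q1"
    and l2: "symmetrize (length l2) (mmono l2 :: int mpoly) = of_nat N * Q2" and pos: "M * N > 0"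
  shows "of_nat (M * N) dvd symmetrize (length (l1 @ l2)) (mmono (l1 @ l2) :: int mpoly)"
proof -
  define k l where "k = length l1" and "l = length l2"
  have two: "(2::int) \<noteq> 0" by simp
  define S where "S = (\<Sum>\<tau>\<in>shuffles k l. of_int (sign \<tau>) *
      rename \<tau> ((Q1 * vand k) * rename (\<lambda>i. i + k) (Q2 * vand l) * cross k l))"
  let ?A = "alternate (k + l) (mmono (l1 @ l2) * qvand (k + l)) :: int mpoly"
  have "mmono (l1 @ l2) * qvand (k + l)
      = (mmono l1 * qvand k) * rename (\<lambda>i. i + k) (mmono l2 * qvand l) * (cross k l :: int mpoly)"
    unfolding mmono_append qvand_add rename.mult k_def by (simp only: ac_simps)
  then have "?A = alternate (k + l) ((mmono l1 * qvand k) * rename (\<lambda>i. i + k) (mmono l2 * qvand l) * cross k l)"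
    by (simp only:)
  also have "\<dots> = (\<Sum>\<tau>\<in>shuffles k l. of_int (sign \<tau>) *
         rename \<tau> (alternate k (mmono l1 * qvand k) * rename (\<lambda>i. i + k) (alternate l (mmono l2 * qvand l)) * cross k l))"
    by (intro alternate_shuffles in_vars_mult in_vars_qvand) (simp_all add: k_def l_def in_vars_mmono)
  also have "\<dots> = (\<Sum>\<tau>\<in>shuffles k l. of_nat (M * N) * (of_int (sign \<tau>) *
      rename \<tau> ((Q1 * vand k) * rename (\<lambda>i. i + k) (Q2 * vand l) * cross k l)))"
  proof (intro sum.cong refl)
    fix \<tau>
    have 1: "alternate k (mmono l1 * qvand k) = of_nat M * (Q1 * vand k)"
      using l1 by (simp add: k_def symmetrize_vand[OF two, symmetric] mult.assoc)
    have 2: "alternate l (mmono l2 * qvand l) = of_nat N * (Q2 * vand l)"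
      using l2 by (simp add: l_def symmetrize_vand[OF two, symmetric] mult.assoc)
    show "of_int (sign \<tau>) * rename \<tau> (alternate k (mmono l1 * qvand k) * rename (\<lambda>i. i + k) (alternate l (mmono l2 * qvand l)) * cross k l)
        = of_nat (M * N) * (of_int (sign \<tau>) *
      rename \<tau> ((Q1 * vand k) * rename (\<lambda>i. i + k) (Q2 * vand l) * cross k l))"
      unfolding 1 2 rename.mult rename.of_nat of_nat_mult by (simp only: ac_simps)
  qed
  also have "\<dots> = of_nat (M * N) * S"
    by (simp only: S_def sum_distrib_left)
  finally have A: "?A = of_nat (M * N) * S" .
  \<comment> \<open>Cancelling this factor transfers the sign rule from \<open>?A\<close> to
    \<open>S\<close>.\<close>
  have nz: "(of_nat (M * N) :: int mpoly) \<noteq> 0" using pos by (simp only: of_nat_eq_0_iff)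
  have "vand (k + l) dvd S"
  proof (rule vand_dvd[OF two])
    fix i j assume ij: "i < j" "j < k + l"
    have "of_nat (M * N) * rename (transpose i j) S = rename (transpose i j) ?A"
      unfolding A rename.mult rename.of_nat ..
    also have "\<dots> = - ?A"
      using ij by (subst rename_alternate) (auto simp: permutes_swap_id sign_swap_id)
    also have "\<dots> = of_nat (M * N) * (- S)" unfolding A by (rule mult_minus_right[symmetric])
    finally show "rename (transpose i j) S = - S" using nz by (simp only: mult_cancel_left) blast
  qed
  then obtain Q where Q: "S = vand (k + l) * Q" by (elim dvdE)
  have "symmetrize (k + l) (mmono (l1 @ l2) :: int mpoly) = of_nat (M * N) * Q"
    by (rule symmetrize_eqI) (simp only: A Q ac_simps)
  then show ?thesis by (simp add: k_def l_def)
qed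

text \<open>Splits off the whole block of the largest part, so that the multiplicities of the two
  pieces do not interfere.\<close>

lemma partition_block:
  assumes "is_partition l" "l \<noteq> []"
  obtains r m l' where "l = replicate m r @ l'" "m > 0" "is_partition l'" "r \<notin> set l'"
proof -
  define r where "r = hd l"
  define l' where "l' = dropWhile (\<lambda>x. x = r) l"
  define m where "m = length (takeWhile (\<lambda>x. x = r) l)"
  have "takeWhile (\<lambda>x. x = r) l = replicate m r"
    unfolding m_def by (rule replicate_length_same[symmetric]) (auto dest: set_takeWhileD)
  then have l: "l = replicate m r @ l'"
    unfolding l'_def by (metis takeWhile_dropWhile_id)
  have m: "m > 0" using assms(2) by (cases l) (auto simp: m_def r_def)
  have sorted: "sorted_wrt (\<ge>) l'" "\<forall>x\<in>set l'. x \<le> r"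
    using assms(1) m unfolding is_partition_def by (subst (asm) l, auto simp: sorted_wrt_append)+
  have "r \<notin> set l'"
  proof (cases l')
    case (Cons y ys)
    then have "y \<noteq> r" using hd_dropWhile[of "\<lambda>x. x = r" l] by (auto simp: l'_def)
    then show ?thesis using sorted Cons by auto
  qed simp
  then show thesis using that[of m r l'] l m sorted by (simp add: is_partition_def)
qed

text \<open>Induction over the blocks of equal parts. Zero parts contribute their factorial too, so
  this is stronger than divisibility by \<open>mul_part l\<close>.\<close>

lemma prod_fact_dvd_symmetrize:
  assumes "is_partition l"
  shows "of_nat (\<Prod>i\<in>set l. fact (mult_part l i)) dvd symmetrize (length l) (mmono l :: int mpoly)"
  using assms
proof (induction "length l" arbitrary: l rule: less_induct)
  case less
  show ?case
  proof (cases "l = []")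
    case False
    from partition_block[OF less.prems False] obtain r m l' where
      l: "l = replicate m r @ l'" and m: "m > 0" and l': "is_partition l'" "r \<notin> set l'" by metis
    have "of_nat (\<Prod>i\<in>set l'. fact (mult_part l' i)) dvd symmetrize (length l') (mmono l' :: int mpoly)"
      using less.hyps[of l'] l' m by (simp add: l)
    then obtain Q where Q: "symmetrize (length l') (mmono l' :: int mpoly) = of_nat (\<Prod>i\<in>set l'. fact (mult_part l' i)) * Q"
      by (elim dvdE)
    have "of_nat (fact m * (\<Prod>i\<in>set l'. fact (mult_part l' i))) dvd symmetrize (length l) (mmono l :: int mpoly)"
      unfolding l
    proof (rule of_nat_dvd_symmetrize_append)
      show "symmetrize (length (replicate m r)) (mmono (replicate m r)) = (of_nat (fact m) * mmono (replicate m r) :: int mpoly)"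
        using symmetrize_mmono_replicate[of m r, where 'a = int] by simp
    qed (rule Q, simp add: prod_pos)
    moreover have "(\<Prod>i\<in>set l. fact (mult_part l i)) = fact m * (\<Prod>i\<in>set l'. fact (mult_part l' i) :: nat)"
    proof -
      have "count_list (replicate m r) i = (if i = r then m else 0)" for i
        by (induction m) auto
      then have mult: "mult_part l r = m" "\<And>i. i \<in> set l' \<Longrightarrow> mult_part l i = mult_part l' i"
        using l' by (auto simp: l mult_part_def count_list_0_iff)
      have "set l = insert r (set l')" using m by (auto simp: l)
      then show ?thesis using l' by (simp add: mult)
    qed
    ultimately show ?thesis by (simp only:)
  qed simp
qed

text \<open>Justifies the definite description in \<open>P_int\<close>: the quotient exists over the
  integers.\<close>

lemma P_int_spec:
  assumes "is_partition l"
  shows "P_int l * of_nat (mul_part l) = symmetrize (length l) (mmono l)"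
proof -
  let ?n = "length l"
  have two: "(2::int) \<noteq> 0" by simp
  have "mul_part l dvd (\<Prod>i\<in>set l. fact (mult_part l i))"
    unfolding mul_part_def by (rule prod_dvd_prod_subset) auto
  then have "(of_nat (mul_part l) :: int mpoly) dvd of_nat (\<Prod>i\<in>set l. fact (mult_part l i))"
    by (elim dvdE) (metis dvd_triv_left of_nat_mult)
  then have "of_nat (mul_part l) dvd symmetrize ?n (mmono l :: int mpoly)"
    using prod_fact_dvd_symmetrize[OF assms] by (rule dvd_trans)
  then obtain Q where Q: "symmetrize ?n (mmono l :: int mpoly) = of_nat (mul_part l) * Q" by (elim dvdE)
  have "mul_part l \<noteq> 0" by (simp add: mul_part_def)
  then have nz: "of_nat (mul_part l) * vand ?n \<noteq> (0 :: int mpoly)" by simp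
  have alt: "(\<Sum>\<sigma> | \<sigma> permutes {..<?n}. of_int (sign \<sigma>) *
           rename \<sigma> (mmono l * (\<Prod>i<?n. \<Prod>j\<in>{i<..<?n}. mvar i - mvar j + 1)))
      = Q * (of_nat (mul_part l) * vand ?n)"
    unfolding prod_pairs qvand_def[symmetric] alternate_def[symmetric] symmetrize_vand[OF two, symmetric] Q
    by (simp only: ac_simps)
  have "P_int l = Q"
    unfolding P_int_def Let_def alt using nz by (intro the_equality) auto
  then show ?thesis by (simp add: Q mult.commute)
qed

text \<open>Reduction of the integral identity, kept in multiplied form because
  \<open>mul_part l\<close> may be zero in \<open>'a\<close>.\<close>

lemma P_poly_spec:
  assumes two: "(2::'a::idom) \<noteq> 0" and l: "is_partition l"
  shows "(P_poly l :: 'a mpoly) * of_nat (mul_part l) = symmetrize (length l) (mmono l)"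
proof -
  let ?\<phi> = "Poly_Mapping.map of_int :: int mpoly \<Rightarrow> 'a mpoly" and ?n = "length l"
  have v: "?\<phi> (vand ?n) = vand ?n" "?\<phi> (qvand ?n) = qvand ?n"
    unfolding vand_pairs qvand_def map_of_int.prod
    by (auto intro!: prod.cong simp: map_of_int.diff map_of_int.add)
  have m: "?\<phi> (mmono l) = mmono l"
    by (simp add: mmono_def map_of_int.prod map_of_int.power)
  have a: "?\<phi> (alternate ?n f) = alternate ?n (?\<phi> f)" for f
    by (simp add: alternate_def map_of_int.sum map_of_int.mult map_of_int_rename)
  have "(P_int l * of_nat (mul_part l)) * vand ?n = alternate ?n (mmono l * qvand ?n)"
    unfolding P_int_spec[OF l] by (rule symmetrize_vand) simp
  then have "?\<phi> ((P_int l * of_nat (mul_part l)) * vand ?n) = ?\<phi> (alternate ?n (mmono l * qvand ?n))"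
    by (rule arg_cong)
  then have "(P_poly l * of_nat (mul_part l)) * vand ?n = alternate ?n (mmono l * qvand ?n :: 'a mpoly)"
    by (simp only: P_poly_def map_of_int.mult map_of_int.of_nat a v m)
  then show ?thesis by (rule symmetrize_eqI[symmetric])
qed

section \<open>The image consists of symmetrizations\<close>

lemma in_vars_mono: "in_vars k f \<Longrightarrow> k \<le> n \<Longrightarrow> in_vars n f"
  by (fastforce simp: in_vars_def)

lemma symmetrize_sum:
  fixes f :: "'b \<Rightarrow> 'a::idom mpoly"
  assumes "(2::'a) \<noteq> 0"
  shows "symmetrize n (sum f A) = (\<Sum>x\<in>A. symmetrize n (f x))"
  by (induction A rule: infinite_finite_induct) (simp_all add: symmetrize_add[OF assms])

lemma symmetrize_1_var: "symmetrize (Suc 0) f = (f :: 'a::idom mpoly)"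
proof (rule symmetrize_eqI)
  have "pairs (Suc 0) = {}" by (auto simp: pairs_def)
  moreover have "{\<sigma>. \<sigma> permutes {..<Suc 0}} = {id}" by (auto simp: lessThan_Suc permutes_sing)
  ultimately show "f * vand (Suc 0) = alternate (Suc 0) (f * qvand (Suc 0))"
    by (simp add: vand_pairs qvand_def alternate_def)
qed

text \<open>This turns out to be the product of the generators with exponents \<open>l\<close>,
  concentrated in degree \<open>length l\<close>.\<close>

definition sym_W :: "nat list \<Rightarrow> nat \<Rightarrow> 'a::comm_ring_1 mpoly" where
  "sym_W l = (\<lambda>n. if n = length l then symmetrize n (mmono l) else 0)"

lemma W_mult_gen_sym_W:
  assumes two: "(2::'a::idom) \<noteq> 0"
  shows "W_mult (W_gen r) (sym_W l) = (sym_W (r # l) :: nat \<Rightarrow> 'a mpoly)"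
proof
  fix n
  have "W_mult (W_gen r) (sym_W l) n
      = (\<Sum>k\<le>n. if k = 1 then star 1 (n - 1) (mvar 0 ^ r) (sym_W l (n - 1)) else (0 :: 'a mpoly))"
    unfolding W_mult_def by (intro sum.cong refl) (simp add: W_gen_def)
  also have "\<dots> = (if 1 \<le> n then star 1 (n - 1) (mvar 0 ^ r) (sym_W l (n - 1)) else 0)"
    by simp
  also have "\<dots> = sym_W (r # l) n"
  proof (cases "n = Suc (length l)")
    case True
    have x: "mmono [r] = (mvar 0 ^ r :: 'a mpoly)" by (simp add: mmono_def)
    have "star (Suc 0) (length l) (symmetrize (Suc 0) (mmono [r])) (symmetrize (length l) (mmono l))
        = symmetrize (Suc 0 + length l) (mmono [r] * rename (\<lambda>i. i + Suc 0) (mmono l :: 'a mpoly))"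
      using in_vars_mmono[of "[r]"] by (intro star_symmetrize[OF two] in_vars_mmono) simp
    also have "mmono [r] * rename (\<lambda>i. i + Suc 0) (mmono l :: 'a mpoly) = mmono (r # l)"
      using mmono_append[of "[r]" l, where 'a = 'a] by simp
    finally show ?thesis using True by (simp add: sym_W_def symmetrize_1_var x)
  next
    case False
    then show ?thesis by (auto simp: sym_W_def)
  qed
  finally show "W_mult (W_gen r) (sym_W l) n = (sym_W (r # l) :: nat \<Rightarrow> 'a mpoly) n" .
qed

lemma sym_W_in_im_Psi:
  assumes two: "(2::'a::idom) \<noteq> 0"
  shows "(sym_W l :: nat \<Rightarrow> 'a mpoly) \<in> im_Psi"
proof (induction l)
  case Nil
  have "sym_W [] = (W_one :: nat \<Rightarrow> 'a mpoly)"
    by (auto simp: sym_W_def W_one_def symmetrize_1[OF two])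
  then show ?case by (simp add: im_Psi.one)
next
  case (Cons r l)
  then show ?case unfolding W_mult_gen_sym_W[OF two, symmetric] by (intro im_Psi.mult im_Psi.gen)
qed

text \<open>The invariant carried through the closure rules. The condition \<open>in_vars\<close> on
  the preimage is what \<open>star_symmetrize\<close> needs in the product case.\<close>

lemma im_Psi_symmetrize:
  assumes two: "(2::'a::idom) \<noteq> 0" and w: "(w :: nat \<Rightarrow> 'a mpoly) \<in> im_Psi"
  shows "finite {k. w k \<noteq> 0} \<and> (\<forall>n. \<exists>f. in_vars n f \<and> w n = symmetrize n f)"
  using w
proof induction
  case one
  have "\<exists>f. in_vars n f \<and> W_one n = symmetrize n (f :: 'a mpoly)" for n
    by (cases "n = 0") (auto simp: W_one_def symmetrize_1[OF two] intro: exI[of _ 1] exI[of _ 0])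
  then show ?case by (auto simp: W_one_def)
next
  case (gen r)
  have "\<exists>f. in_vars n f \<and> W_gen r n = symmetrize n (f :: 'a mpoly)" for n
  proof (cases "n = 1")
    case True then show ?thesis
      by (auto simp: W_gen_def symmetrize_1_var intro!: exI[of _ "mvar 0 ^ r"] in_vars_power in_vars_mvar)
  qed (auto simp: W_gen_def intro: exI[of _ 0])
  then show ?case by (auto simp: W_gen_def)
next
  case (add v w)
  have "finite {k. W_add v w k \<noteq> 0}"
    by (rule finite_subset[of _ "{k. v k \<noteq> 0} \<union> {k. w k \<noteq> 0}"]) (use add in \<open>auto simp: W_add_def\<close>)
  moreover have "\<exists>f. in_vars n f \<and> W_add v w n = symmetrize n f" for n
    using add by (metis W_add_def in_vars_add symmetrize_add[OF two])
  ultimately show ?case by blast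
next
  case (smult w c)
  have "finite {k. W_smult c w k \<noteq> 0}"
    by (rule finite_subset[of _ "{k. w k \<noteq> 0}"]) (use smult in \<open>auto simp: W_smult_def\<close>)
  moreover have "\<exists>f. in_vars n f \<and> W_smult c w n = symmetrize n f" for n
    using smult by (metis W_smult_def in_vars_mult in_vars_mconst symmetrize_mconst[OF two])
  ultimately show ?case by blast
next
  case (mult v w)
  have star0: "star k l (v k) (w l) = 0" if "v k = 0 \<or> w l = 0" for k l using that by auto
  have "{n. W_mult v w n \<noteq> 0} \<subseteq> (\<lambda>(a, b). a + b) ` ({k. v k \<noteq> 0} \<times> {k. w k \<noteq> 0})"
  proof
    fix n assume "n \<in> {n. W_mult v w n \<noteq> 0}"
    then obtain k where k: "k \<le> n" "star k (n - k) (v k) (w (n - k)) \<noteq> 0"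
      unfolding W_mult_def by (auto elim: sum.not_neutral_contains_not_neutral)
    then have "v k \<noteq> 0" "w (n - k) \<noteq> 0" using star0 by blast+
    then show "n \<in> (\<lambda>(a, b). a + b) ` ({k. v k \<noteq> 0} \<times> {k. w k \<noteq> 0})"
      using k(1) by (intro image_eqI[of _ _ "(k, n - k)"]) auto
  qed
  then have fin: "finite {n. W_mult v w n \<noteq> 0}"
    by (rule finite_subset) (use mult.IH in auto)
  from mult.IH(1) obtain f where f: "\<And>n. in_vars n (f n)" "\<And>n. v n = symmetrize n (f n)" by metis
  from mult.IH(2) obtain g where g: "\<And>n. in_vars n (g n)" "\<And>n. w n = symmetrize n (g n)" by metis
  have "\<exists>h. in_vars n h \<and> W_mult v w n = symmetrize n h" for n
  proof -
    let ?h = "\<lambda>k. f k * rename (\<lambda>i. i + k) (g (n - k))"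
    have "star k (n - k) (v k) (w (n - k)) = symmetrize n (?h k)" if "k \<le> n" for k
      using star_symmetrize[OF two f(1)[of k] g(1)[of "n - k"]] that by (simp add: f(2) g(2))
    then have "W_mult v w n = symmetrize n (\<Sum>k\<le>n. ?h k)"
      by (simp add: W_mult_def symmetrize_sum[OF two])
    moreover have "in_vars n (\<Sum>k\<le>n. ?h k)"
      by (intro in_vars_sum in_vars_mult) (auto intro: in_vars_mono[OF f(1)] in_vars_rename[OF g(1)])
    ultimately show ?thesis by blast
  qed
  with fin show ?case by blast
qed

section \<open>Symmetrizations vanish on the wheel locus\<close>

text \<open>The generic point of the wheel locus. It takes values in polynomials because
  \<open>vand\<close> may vanish at particular points of the locus and could not be cancelled
  there.\<close>

definition wheel_subst :: "nat \<Rightarrow> 'a::comm_ring_1 mpoly \<Rightarrow> 'a mpoly" where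
  "wheel_subst p = poly_eval mconst (\<lambda>i. if i < p then mvar 0 - of_nat i else mvar i)"

interpretation wheel_subst: comm_ring_hom "wheel_subst p" for p
  unfolding wheel_subst_def by (rule mconst.poly_eval_hom)

lemma wheel_subst_mvar: "wheel_subst p (mvar i) = (if i < p then mvar 0 - of_nat i else mvar i)"
  by (simp add: wheel_subst_def)

text \<open>For i < j < p the factor x_i - x_j becomes the constant j - i, nonzero in characteristic
  p because 0 < j - i < p. All other factors still contain a free variable.\<close>

lemma wheel_subst_vand_nonzero:
  fixes p :: nat
  assumes char: "CHAR('a::idom) = p"
  shows "wheel_subst p (vand n) \<noteq> (0 :: 'a mpoly)"
proof -
  have "wheel_subst p (mvar i - mvar j) \<noteq> (0 :: 'a mpoly)" if ij: "i < j" for i j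
  proof
    assume 0: "wheel_subst p (mvar i - mvar j) = (0 :: 'a mpoly)"
    consider "j < p" | "i < p" "j \<ge> p" | "i \<ge> p" using ij by linarith
    then show False
    proof cases
      case 1
      with 0 ij have "(of_nat i :: 'a mpoly) = of_nat j" by (simp add: wheel_subst.diff wheel_subst_mvar)
      then have "(of_nat i :: 'a) = of_nat j" by (metis meval.of_nat)
      then have "(of_nat (j - i) :: 'a) = 0" using ij by (simp add: of_nat_diff)
      then have "p dvd j - i" by (simp only: of_nat_eq_0_iff_char_dvd char)
      then show False using 1 ij by (auto dest: dvd_imp_le)
    next
      case 2
      \<comment> \<open>At this point x_0 - i has the value 0 and x_j the value 1; here j > 0, so
        x_0 and x_j are different variables.\<close>
      from 0 have "meval (\<lambda>t. if t = j then 1 else of_nat i) (wheel_subst p (mvar i - mvar j) :: 'a mpoly) = 0"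
        by simp
      then show False using 2 ij by (simp add: wheel_subst.diff wheel_subst_mvar meval.diff)
    next
      case 3 then show False using 0 ij by (simp add: wheel_subst.diff wheel_subst_mvar)
    qed
  qed
  then show ?thesis by (auto simp: vand_pairs wheel_subst.prod prod_zero_iff)
qed

text \<open>In the cyclic order on the first \<open>p\<close> variables some variable must precede its predecessor.\<close>

lemma wheel_subst_rename_qvand:
  fixes p :: nat
  assumes char: "CHAR('a::idom) = p" and p: "p > 1" "p \<le> n" and \<sigma>: "\<sigma> permutes {..<n}"
  shows "wheel_subst p (rename \<sigma> (qvand n)) = (0 :: 'a mpoly)"
proof -
  \<comment> \<open>Since \<open>\<sigma>\<close> sends \<open>pos c\<close> to \<open>c\<close>,
    the factors of the renamed \<open>qvand\<close> are the x_c - x_d + 1 with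
    \<open>pos c < pos d\<close>.\<close>
  define pos where "pos = inv \<sigma>"
  have \<sigma>_pos: "\<sigma> (pos c) = c" for c using permutes_inverses(1)[OF \<sigma>] by (simp add: pos_def)
  have pos_less: "pos c < n" if "c < n" for c
    using permutes_in_image[OF permutes_inv[OF \<sigma>], of c] that by (simp add: pos_def)
  have zero: ?thesis if "pos c < pos d" "c < p" "d < p"
    "mvar 0 - of_nat c - (mvar 0 - of_nat d) + 1 = (0 :: 'a mpoly)" for c d
  proof -
    have "wheel_subst p (rename \<sigma> (mvar (pos c) - mvar (pos d) + 1)) = (0 :: 'a mpoly)"
      using that by (simp add: rename.add rename.diff \<sigma>_pos wheel_subst.add wheel_subst.diff wheel_subst_mvar)
    moreover have "(pos c, pos d) \<in> pairs n" using that p pos_less[of d] by simp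
    ultimately show ?thesis
      unfolding qvand_def rename.prod wheel_subst.prod
      by (intro prod_zero bexI[of _ "(pos c, pos d)"]) auto
  qed
  show ?thesis
  proof (cases "\<exists>c. Suc c < p \<and> pos (Suc c) < pos c")
    case True
    then obtain c where c: "Suc c < p" "pos (Suc c) < pos c" by blast
    \<comment> \<open>The factor x_(c+1) - x_c + 1 vanishes, as consecutive coordinates of the wheel
      differ by 1.\<close>
    then show ?thesis by (intro zero[of "Suc c" c]) auto
  next
    case False
    have "pos c < pos (Suc c)" if "Suc c < p" for c
      using False that \<sigma>_pos[of c] \<sigma>_pos[of "Suc c"] by (metis linorder_neqE_nat n_not_Suc_n)
    then have "Suc c < p \<Longrightarrow> pos 0 < pos (Suc c)" for c
      by (induction c) (auto intro: less_trans)
    \<comment> \<open>Now 0, ..., p - 1 occur in this order, and the factor x_0 - x_(p-1) + 1 takes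
      the value p = 0: the wheel closes up.\<close>
    from this[of "p - 2"] have *: "pos 0 < pos (p - 1)" using p by (simp add: numeral_2_eq_2 Suc_diff_Suc)
    have "(of_nat (p - 1) + 1 :: 'a mpoly) = mconst (of_nat (Suc (p - 1)))"
      unfolding mconst.of_nat by (simp only: of_nat_Suc add.commute)
    also have "\<dots> = 0" using p char of_nat_CHAR[where 'a = 'a] by (simp del: of_nat_Suc)
    finally show ?thesis using * p by (intro zero[of 0 "p - 1"]) (auto simp: algebra_simps)
  qed
qed

text \<open>The symmetrization is zero already at the generic point, where \<open>vand\<close> can
  be cancelled, and evaluation at any point of the locus factors through
  \<open>wheel_subst\<close>.\<close>

lemma meval_symmetrize_wheel:
  fixes p :: nat and f :: "'a::idom mpoly"
  assumes char: "CHAR('a) = p" and p: "p > 1" "p \<le> n" and two: "(2::'a) \<noteq> 0"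
    and a: "\<forall>i<p. a i + of_nat i = a 0"
  shows "meval a (symmetrize n f) = 0"
proof -
  have "wheel_subst p (symmetrize n f) * wheel_subst p (vand n) = 0"
    unfolding wheel_subst.mult[symmetric] symmetrize_vand[OF two] alternate_def wheel_subst.sum
    by (intro sum.neutral ballI)
       (simp add: wheel_subst.mult rename.mult wheel_subst_rename_qvand[OF char p])
  then have 0: "wheel_subst p (symmetrize n f) = 0"
    using wheel_subst_vand_nonzero[OF char, of n] by simp
  have "meval a (wheel_subst p g) = meval a g" for g
  proof (rule comm_ring_hom_ext[OF comm_ring_hom_comp[OF meval.comm_ring_hom_axioms wheel_subst.comm_ring_hom_axioms] meval.comm_ring_hom_axioms])
    show "meval a (wheel_subst p (mconst c)) = meval a (mconst c)" for c
      by (simp add: wheel_subst_def)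
    show "meval a (wheel_subst p (mvar i)) = meval a (mvar i)" for i
      using a by (auto simp: wheel_subst_mvar meval.diff diff_eq_eq)
  qed
  from this[of "symmetrize n f"] show ?thesis by (simp add: 0)
qed

section \<open>Coefficients of symmetric polynomials\<close>

lemma lookup_mon_rename:
  "Poly_Mapping.lookup (mon_rename \<tau> m) j = (\<Sum>i\<in>Poly_Mapping.keys m. Poly_Mapping.lookup m i when \<tau> i = j)"
  by (simp add: mon_rename_def lookup_sum lookup_single)

lemma lookup_mon_rename_bij:
  assumes "bij \<sigma>"
  shows "Poly_Mapping.lookup (mon_rename \<sigma> m) j = Poly_Mapping.lookup m (inv \<sigma> j)"
proof -
  have "\<sigma> i = j \<longleftrightarrow> i = inv \<sigma> j" for i using assms by (metis bij_inv_eq_iff)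
  then show ?thesis by (simp add: lookup_mon_rename when_def in_keys_iff)
qed

lemma lookup_rename:
  fixes f :: "'a::comm_ring_1 mpoly"
  shows "Poly_Mapping.lookup (rename \<tau> f) M
    = (\<Sum>m | m \<in> Poly_Mapping.keys f \<and> mon_rename \<tau> m = M. Poly_Mapping.lookup f m)"
  by (simp add: rename_def lookup_sum lookup_single when_def sum.inter_filter[symmetric])

lemma lookup_rename_bij:
  fixes f :: "'a::comm_ring_1 mpoly"
  assumes "bij \<sigma>"
  shows "Poly_Mapping.lookup (rename \<sigma> f) (mon_rename \<sigma> m) = Poly_Mapping.lookup f m"
proof -
  have "mon_rename \<sigma> m' = mon_rename \<sigma> m \<longleftrightarrow> m' = m" for m'
  proof
    assume *: "mon_rename \<sigma> m' = mon_rename \<sigma> m"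
    show "m' = m"
    proof (rule poly_mapping_eqI)
      fix i
      show "Poly_Mapping.lookup m' i = Poly_Mapping.lookup m i"
        using arg_cong[OF *, of "\<lambda>x. Poly_Mapping.lookup x (\<sigma> i)"] assms
        by (simp add: lookup_mon_rename_bij bij_is_inj)
    qed
  qed simp
  then have "{m'. m' \<in> Poly_Mapping.keys f \<and> mon_rename \<sigma> m' = mon_rename \<sigma> m}
      = (if m \<in> Poly_Mapping.keys f then {m} else {})" by auto
  then show ?thesis by (simp add: lookup_rename in_keys_iff)
qed

lemma lookup_sym_poly:
  fixes f :: "'a::comm_ring_1 mpoly"
  assumes "sym_poly n f" "\<sigma> permutes {..<n}"
  shows "Poly_Mapping.lookup f (mon_rename \<sigma> m) = Poly_Mapping.lookup f m"
  using lookup_rename_bij[OF permutes_bij[OF assms(2)], of f m] assms by (simp add: sym_poly_def)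

text \<open>\<open>permute_list\<close> pulls entries back along \<open>\<sigma>\<close> while
  \<open>mon_rename\<close> pushes exponents forward, so the two cancel.\<close>

lemma mon_rename_list_mon_permute:
  assumes "\<sigma> permutes {..<length l}"
  shows "mon_rename \<sigma> (list_mon (permute_list \<sigma> l)) = list_mon l"
proof (rule poly_mapping_eqI)
  fix i
  have "inv \<sigma> i < length l \<longleftrightarrow> i < length l"
    using permutes_in_image[OF permutes_inv[OF assms], of i] by simp
  then show "Poly_Mapping.lookup (mon_rename \<sigma> (list_mon (permute_list \<sigma> l))) i = Poly_Mapping.lookup (list_mon l) i"
    using assms permutes_inverses(1)[OF assms]
    by (simp add: lookup_mon_rename_bij permutes_bij lookup_list_mon permute_list_nth)
qed

lemma lookup_sym_poly_mset:
  fixes f :: "'a::comm_ring_1 mpoly"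
  assumes "sym_poly (length l) f" "mset l = mset l'"
  shows "Poly_Mapping.lookup f (list_mon l') = Poly_Mapping.lookup f (list_mon l)"
proof -
  obtain \<sigma> where "\<sigma> permutes {..<length l}" "permute_list \<sigma> l = l'"
    using mset_eq_permutation[of l' l] assms(2) by metis
  then show ?thesis
    using lookup_sym_poly[OF assms(1), of \<sigma> "list_mon l'"] mon_rename_list_mon_permute[of \<sigma> l] by simp
qed

lemma list_mon_eq_mon_rename_imp_mset:
  assumes \<sigma>: "\<sigma> permutes {..<length l'}" and eq: "mon_rename \<sigma> (list_mon l') = list_mon l"
    and len: "length l = length l'"
  shows "mset l = mset l'"
proof -
  have inv: "inv \<sigma> permutes {..<length l'}" by (rule permutes_inv[OF \<sigma>])
  have "l = permute_list (inv \<sigma>) l'"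
  proof (rule nth_equalityI)
    fix i assume i: "i < length l"
    have "l ! i = Poly_Mapping.lookup (mon_rename \<sigma> (list_mon l')) i"
      using i by (simp add: eq lookup_list_mon)
    also have "\<dots> = l' ! (inv \<sigma> i)"
      using i len permutes_in_image[OF inv, of i] \<sigma> by (simp add: lookup_mon_rename_bij permutes_bij lookup_list_mon)
    finally show "l ! i = permute_list (inv \<sigma>) l' ! i" using i len inv by (simp add: permute_list_nth)
  qed (simp add: len)
  then show ?thesis using inv by (metis mset_permute_list)
qed

lemma partition_mset_unique:
  assumes "is_partition l" "is_partition l'" "mset l = mset l'"
  shows "l = l'"
proof -
  have "sorted (rev l)" "sorted (rev l')" using assms(1,2) by (simp_all add: is_partition_def sorted_wrt_rev)
  then have "rev l = rev l'" using assms(3) by (metis mset_rev properties_for_sort)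
  then show ?thesis by simp
qed

lemma partition_exists:
  fixes l :: "nat list"
  obtains l' where "is_partition l'" "mset l' = mset l"
  using that[of "rev (sort l)"] by (simp add: is_partition_def sorted_wrt_rev)

lemma list_mon_of_mon:
  assumes "Poly_Mapping.keys m \<subseteq> {..<n}"
  shows "list_mon (map (Poly_Mapping.lookup m) [0..<n]) = m"
proof (rule poly_mapping_eqI)
  fix i
  show "Poly_Mapping.lookup (list_mon (map (Poly_Mapping.lookup m) [0..<n])) i = Poly_Mapping.lookup m i"
    using assms by (auto simp: lookup_list_mon in_keys_iff)
qed

section \<open>Stabilizers of restricted partitions\<close>

text \<open>Adding a point \<open>a\<close> multiplies the order of the stabilizer by the size of
  the fibre through \<open>a\<close>: the image \<open>b\<close> of \<open>a\<close> is free in this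
  fibre, and the rest is a permutation of the old points. The fibre is nonempty with fewer than
  \<open>p\<close> elements.\<close>

lemma prime_not_dvd_card_stabilizer:
  fixes f :: "'a \<Rightarrow> 'b" and p :: nat
  assumes "finite A" "prime p" "\<And>y. card {x \<in> A. f x = y} < p"
  shows "\<not> p dvd card {\<sigma>. \<sigma> permutes A \<and> (\<forall>x\<in>A. f (\<sigma> x) = f x)}"
  using assms(1,3)
proof (induction A rule: finite_induct)
  case empty
  have "{\<sigma>. \<sigma> permutes {} \<and> (\<forall>x\<in>{}. f (\<sigma> x) = f x)} = {id}" by (auto simp: permutes_empty)
  then show ?case using prime_gt_1_nat[OF assms(2)] by simp
next
  case (insert a A)
  let ?St = "\<lambda>A. {\<sigma>. \<sigma> permutes A \<and> (\<forall>x\<in>A. f (\<sigma> x) = f x)}"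
  let ?B = "{x \<in> insert a A. f x = f a}"
  let ?h = "\<lambda>(b, q). transpose a b \<circ> q"
  have ft: "f (transpose a b x) = f x" if "f b = f a" for b x
    using that by (auto simp: transpose_def)
  have qa: "q a = a" if "q permutes A" for q using permutes_not_in[OF that insert(2)] .
  have inj: "inj_on ?h (?B \<times> ?St A)"
  proof (rule inj_onI)
    fix x y assume xy: "x \<in> ?B \<times> ?St A" "y \<in> ?B \<times> ?St A" "?h x = ?h y"
    obtain b q c r where x: "x = (b, q)" and y: "y = (c, r)" by (cases x, cases y)
    have eq: "transpose a b \<circ> q = transpose a c \<circ> r" using xy(3) by (simp only: x y prod.case)
    from xy have "q permutes A" "r permutes A" by (simp_all add: x y)
    then have "b = c" using fun_cong[OF eq, of a] by (simp add: qa)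
    moreover have "q = r"
    proof
      fix z
      have "transpose a b (transpose a b (q z)) = transpose a b (transpose a b (r z))"
        using fun_cong[OF eq, of z] \<open>b = c\<close> by simp
      then show "q z = r z" by simp
    qed
    ultimately show "x = y" by (simp add: x y)
  qed
  have "?St (insert a A) = ?h ` (?B \<times> ?St A)"
  proof (intro set_eqI iffI)
    fix \<sigma> assume "\<sigma> \<in> ?St (insert a A)"
    then have \<sigma>: "\<sigma> permutes insert a A" "\<forall>x\<in>insert a A. f (\<sigma> x) = f x" by auto
    then have "\<sigma> \<in> ?h ` {(b, q). b \<in> insert a A \<and> q \<in> {q. q permutes A}}"
      using permutes_insert[of a A] by blast
    then obtain b q where bq: "b \<in> insert a A" "q permutes A" "\<sigma> = transpose a b \<circ> q"
      by (elim imageE) (simp only: mem_Collect_eq case_prod_beta, blast)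
    have "\<sigma> a = b" using bq by (simp add: qa)
    then have fb: "f b = f a" using \<sigma>(2) by auto
    have "f (q x) = f x" if "x \<in> A" for x
      using \<sigma>(2) that ft[OF fb, of "q x"] by (simp add: bq(3))
    then show "\<sigma> \<in> ?h ` (?B \<times> ?St A)"
      using bq fb by (intro image_eqI[of _ _ "(b, q)"]) auto
  next
    fix \<sigma> assume "\<sigma> \<in> ?h ` (?B \<times> ?St A)"
    then obtain b q where bq: "b \<in> insert a A" "f b = f a" "q permutes A" "\<forall>x\<in>A. f (q x) = f x"
      and \<sigma>: "\<sigma> = transpose a b \<circ> q" by auto
    have "\<sigma> \<in> ?h ` {(b, q). b \<in> insert a A \<and> q \<in> {q. q permutes A}}"
      by (rule image_eqI[of _ _ "(b, q)"]) (use bq \<sigma> in simp_all)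
    then have "\<sigma> permutes insert a A" using permutes_insert[of a A] by blast
    moreover have "f (\<sigma> x) = f x" if "x \<in> insert a A" for x
      using that bq qa[OF bq(3)] by (auto simp: \<sigma> ft)
    ultimately show "\<sigma> \<in> ?St (insert a A)" by blast
  qed
  then have "card (?St (insert a A)) = card ?B * card (?St A)"
    by (simp only: card_image[OF inj] card_cartesian_product)
  moreover have "\<not> p dvd card ?B"
  proof -
    have "card ?B > 0" using insert(1) by (auto simp: card_gt_0_iff)
    then show ?thesis using insert.prems[of "f a"] by (auto dest: dvd_imp_le)
  qed
  moreover have "\<not> p dvd card (?St A)"
  proof (rule insert.IH)
    fix y
    have "card {x \<in> A. f x = y} \<le> card {x \<in> insert a A. f x = y}"
      using insert(1) by (intro card_mono) auto
    then show "card {x \<in> A. f x = y} < p" using insert.prems[of y] by simp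
  qed
  ultimately show ?case using assms(2) by (simp add: prime_dvd_mult_iff)
qed

lemma mult_part_eq_card: "mult_part l y = card {i \<in> {..<length l}. l ! i = y}"
  by (simp add: mult_part_def count_list_eq_length_filter length_filter_conv_card)
     (metis (lifting))

lemma prime_not_dvd_card_list_stabilizer:
  fixes p :: nat
  assumes "prime p" "p_restricted p l"
  shows "\<not> p dvd card {\<sigma>. \<sigma> permutes {..<length l} \<and> mon_rename \<sigma> (list_mon l) = list_mon l}"
proof -
  have "mon_rename \<sigma> (list_mon l) = list_mon l \<longleftrightarrow> (\<forall>i\<in>{..<length l}. l ! (\<sigma> i) = l ! i)"
    if \<sigma>: "\<sigma> permutes {..<length l}" for \<sigma>
  proof
    assume eq: "mon_rename \<sigma> (list_mon l) = list_mon l"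
    show "\<forall>i\<in>{..<length l}. l ! (\<sigma> i) = l ! i"
    proof
      fix i assume i: "i \<in> {..<length l}"
      have "Poly_Mapping.lookup (mon_rename \<sigma> (list_mon l)) (\<sigma> i) = Poly_Mapping.lookup (list_mon l) i"
        using \<sigma> by (simp add: lookup_mon_rename_bij permutes_bij permutes_inverses)
      then show "l ! (\<sigma> i) = l ! i"
        using i permutes_in_image[OF \<sigma>, of i] by (simp add: eq lookup_list_mon)
    qed
  next
    assume *: "\<forall>i\<in>{..<length l}. l ! (\<sigma> i) = l ! i"
    have "permute_list \<sigma> l = l"
      using * \<sigma> by (intro nth_equalityI) (simp_all add: permute_list_nth)
    then show "mon_rename \<sigma> (list_mon l) = list_mon l"
      using mon_rename_list_mon_permute[OF \<sigma>] by simp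
  qed
  then have "{\<sigma>. \<sigma> permutes {..<length l} \<and> mon_rename \<sigma> (list_mon l) = list_mon l}
      = {\<sigma>. \<sigma> permutes {..<length l} \<and> (\<forall>i\<in>{..<length l}. l ! (\<sigma> i) = l ! i)}" by blast
  then show ?thesis
    using prime_not_dvd_card_stabilizer[of "{..<length l}" p "\<lambda>i. l ! i"] assms
    by (simp add: p_restricted_def mult_part_eq_card)
qed

section \<open>Sums over orbits of prime order\<close>

text \<open>The periods \<open>p\<close> and \<open>d\<close> are coprime, so Bezout yields period
  1.\<close>

lemma funpow_prime_fixed:
  fixes p :: nat
  assumes "prime p" "(\<kappa> ^^ p) y = y" "(\<kappa> ^^ d) y = y" "0 < d" "d < p"
  shows "\<kappa> y = y"
proof -
  have "coprime d p"
    using assms by (metis coprime_commute dvd_imp_le not_le prime_imp_coprime_nat)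
  then obtain u v where uv: "d * u = p * v + 1"
    using bezout_nat[of d p] assms(4) by auto
  have "y = (\<kappa> ^^ (d * u)) y" using funpow_mod_eq[OF assms(3), of "d * u"] by simp
  also have "\<dots> = (\<kappa> ^^ 1) y"
    unfolding uv using funpow_mod_eq[OF assms(2), of "p * v"] by simp
  finally show ?thesis by simp
qed

text \<open>Nontrivial orbits have exactly \<open>p\<close> elements and \<open>F\<close> is
  constant on them, so each contributes p times a value, which is zero. The induction removes one
  such orbit at a time.\<close>

lemma sum_eq_sum_fixed_points:
  fixes F :: "'b \<Rightarrow> 'a::comm_ring_1" and p :: nat
  assumes char: "CHAR('a) = p" and p: "prime p" and "finite X"
    and "\<And>x. x \<in> X \<Longrightarrow> \<kappa> x \<in> X" "\<And>x. x \<in> X \<Longrightarrow> (\<kappa> ^^ p) x = x" "\<And>x. x \<in> X \<Longrightarrow> F (\<kappa> x) = F x"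
  shows "sum F X = sum F {x \<in> X. \<kappa> x = x}"
  using assms(3-)
proof (induction X rule: finite_psubset_induct)
  case (psubset X)
  show ?case
  proof (cases "\<forall>x\<in>X. \<kappa> x = x")
    case True
    then have "{x \<in> X. \<kappa> x = x} = X" by blast
    then show ?thesis by simp
  next
    case False
    then obtain x where x: "x \<in> X" "\<kappa> x \<noteq> x" by blast
    have p0: "p > 0" using prime_gt_0_nat[OF p] .
    define orb where "orb = (\<lambda>i. (\<kappa> ^^ i) x) ` {..<p}"
    have in_orb: "(\<kappa> ^^ i) x \<in> orb" for i
      unfolding orb_def using funpow_mod_eq[OF psubset.prems(2)[OF x(1)], of i] p0
      by (intro image_eqI[of _ _ "i mod p"]) auto
    have in_X: "(\<kappa> ^^ i) x \<in> X" for i by (induction i) (auto intro: x psubset.prems(1))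
    have F_const: "F ((\<kappa> ^^ i) x) = F x" for i
      by (induction i) (auto simp: psubset.prems(3) in_X)
    \<comment> \<open>A fixed point in the orbit stays put up to time \<open>p\<close>, where the
      orbit is back at \<open>x\<close>; then \<open>x\<close> itself would be fixed.\<close>
    have nofix: "\<kappa> ((\<kappa> ^^ i) x) \<noteq> (\<kappa> ^^ i) x" if "i < p" for i
    proof
      assume "\<kappa> ((\<kappa> ^^ i) x) = (\<kappa> ^^ i) x"
      then have *: "(\<kappa> ^^ j) ((\<kappa> ^^ i) x) = (\<kappa> ^^ i) x" for j by (induction j) auto
      have "(\<kappa> ^^ i) x = (\<kappa> ^^ (p - i + i)) x" using *[of "p - i"] by (simp only: funpow_add comp_apply)
      also have "\<dots> = x" using psubset.prems(2)[OF x(1)] that by simp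
      finally show False using *[of 1] x(2) by simp
    qed
    have inj: "inj_on (\<lambda>i. (\<kappa> ^^ i) x) {..<p}"
    proof (rule linorder_inj_onI')
      fix i j assume ij: "i \<in> {..<p}" "j \<in> {..<p}" "i < j"
      show "(\<kappa> ^^ i) x \<noteq> (\<kappa> ^^ j) x"
      proof
        assume eq: "(\<kappa> ^^ i) x = (\<kappa> ^^ j) x"
        have "(\<kappa> ^^ j) x = (\<kappa> ^^ (j - i + i)) x" using ij by simp
        also have "\<dots> = (\<kappa> ^^ (j - i)) ((\<kappa> ^^ i) x)" by (simp only: funpow_add comp_apply)
        finally have period: "(\<kappa> ^^ (j - i)) ((\<kappa> ^^ i) x) = (\<kappa> ^^ i) x" using eq by simp
        have "\<kappa> ((\<kappa> ^^ i) x) = (\<kappa> ^^ i) x"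
          by (rule funpow_prime_fixed[OF p psubset.prems(2)[OF in_X] period]) (use ij in auto)
        then show False using nofix[of i] ij by simp
      qed
    qed
    have "sum F orb = (\<Sum>i<p. F ((\<kappa> ^^ i) x))" unfolding orb_def by (simp add: sum.reindex[OF inj])
    also have "\<dots> = of_nat p * F x" by (simp add: F_const)
    also have "\<dots> = 0" using char of_nat_CHAR[where 'a = 'a] by simp
    finally have sum_orb: "sum F orb = 0" .
    have sub: "orb \<subseteq> X" using in_X by (auto simp: orb_def)
    have "x \<in> orb" using in_orb[of 0] by simp
    have "sum F X = sum F (X - orb) + sum F orb" by (rule sum.subset_diff[OF sub psubset.hyps])
    also have "\<dots> = sum F (X - orb)" by (simp add: sum_orb)
    also have "\<dots> = sum F {x \<in> X - orb. \<kappa> x = x}"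
    proof (rule psubset.IH)
      show "X - orb \<subset> X" using \<open>x \<in> orb\<close> x by blast
      show "\<kappa> y \<in> X - orb" if "y \<in> X - orb" for y
      proof
        show "\<kappa> y \<in> X" using that psubset.prems by auto
        show "\<kappa> y \<notin> orb"
        proof
          assume "\<kappa> y \<in> orb"
          then obtain i where i: "\<kappa> y = (\<kappa> ^^ i) x" by (auto simp: orb_def)
          \<comment> \<open>Another \<open>p - 1\<close> steps lead from \<open>\<kappa> y\<close>
            back to \<open>y\<close>, so \<open>y\<close> would lie in the removed orbit as
            well.\<close>
          have "y = (\<kappa> ^^ Suc (p - 1)) y" using psubset.prems(2)[of y] that p0 by simp
          also have "\<dots> = (\<kappa> ^^ (p - 1)) (\<kappa> y)" by (simp only: funpow_Suc_right comp_apply)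
          also have "\<dots> = (\<kappa> ^^ (p - 1 + i)) x" by (simp only: i funpow_add comp_apply)
          finally show False using in_orb[of "p - 1 + i"] that by simp
        qed
      qed
    qed (use psubset.prems in auto)
    also have "{x \<in> X - orb. \<kappa> x = x} = {x \<in> X. \<kappa> x = x}"
      using nofix by (auto simp: orb_def)
    finally show ?thesis .
  qed
qed

section \<open>Top-degree coefficients on the wheel locus\<close>

text \<open>Over a finite field the product of all X - a, increased by 1, has no root.\<close>

lemma infinite_field:
  assumes "\<forall>q :: 'k::field poly. degree q \<ge> 1 \<longrightarrow> (\<exists>x. poly q x = 0)"
  shows "infinite (UNIV :: 'k set)"
proof
  assume fin: "finite (UNIV :: 'k set)"
  define r where "r = (\<Prod>a\<in>(UNIV::'k set). [:- a, 1:])"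
  have r0: "poly r x = 0" for x using fin by (simp add: r_def poly_prod prod_zero_iff)
  have "degree r = (\<Sum>a\<in>(UNIV::'k set). degree [:- a, 1:])"
    unfolding r_def by (rule degree_prod_eq_sum_degree) simp
  then have "degree r = card (UNIV :: 'k set)" by simp
  moreover have "card (UNIV :: 'k set) > 0" using fin by (simp add: card_gt_0_iff)
  ultimately have "degree (r + 1) \<ge> 1" by (simp add: degree_add_eq_left)
  then obtain x where "poly (r + 1) x = 0" using assms by blast
  then show False by (simp add: r0)
qed

lemma poly_eq_0_infinite:
  fixes q :: "'k::field poly"
  assumes "infinite (UNIV :: 'k set)" "\<And>x. poly q x = 0"
  shows "q = 0"
  using assms poly_roots_finite[of q] by force

lemma digits_unique:
  fixes N :: nat
  assumes "\<And>i. i < k \<Longrightarrow> a i < N" "\<And>i. i < k \<Longrightarrow> b i < N"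
    and "(\<Sum>i<k. a i * N ^ i) = (\<Sum>i<k. b i * N ^ i)"
  shows "\<forall>i<k. a i = b i"
  using assms
proof (induction k)
  case (Suc k)
  have bound: "(\<Sum>i<k. c i * N ^ i) < N ^ k" if "\<And>i. i < k \<Longrightarrow> c i < N" for c and k
    using that
  proof (induction k)
    case (Suc k)
    have "(\<Sum>i<Suc k. c i * N ^ i) < N ^ k + c k * N ^ k" using Suc by simp
    also have "\<dots> = Suc (c k) * N ^ k" by simp
    also have "\<dots> \<le> N * N ^ k" using Suc.prems[of k] by (intro mult_right_mono) auto
    finally show ?case by simp
  qed simp
  have div: "(s + c * M) div M = c" if "s < M" for s c M :: nat
    using that by (subst div_mult_self1) auto
  have A: "(\<Sum>i<k. a i * N ^ i) < N ^ k" and B: "(\<Sum>i<k. b i * N ^ i) < N ^ k"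
    using Suc.prems by (auto intro!: bound)
  have eq: "(\<Sum>i<k. a i * N ^ i) + a k * N ^ k = (\<Sum>i<k. b i * N ^ i) + b k * N ^ k"
    using Suc.prems(3) by simp
  have "((\<Sum>i<k. a i * N ^ i) + a k * N ^ k) div N ^ k = a k"
    by (rule div[OF A])
  moreover have "((\<Sum>i<k. b i * N ^ i) + b k * N ^ k) div N ^ k = b k"
    by (rule div[OF B])
  ultimately have ab: "a k = b k" using eq by simp
  then have "(\<Sum>i<k. a i * N ^ i) = (\<Sum>i<k. b i * N ^ i)" using eq by simp
  then have "\<forall>i<k. a i = b i"
    using Suc.prems(1,2) less_SucI by (intro Suc.IH) blast+
  then show ?case using ab by (auto simp: less_Suc_eq)
qed simp

text \<open>Kronecker substitution \<open>x\<^sub>i \<mapsto> T ^ (N ^ i)\<close> separates the finitely many monomials.\<close>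

lemma meval_eq_0_imp_eq_0:
  fixes f :: "'k::field mpoly"
  assumes inf: "infinite (UNIV :: 'k set)" and 0: "\<And>a. meval a f = 0" and vars: "in_vars k f"
  shows "f = 0"
proof -
  define B where "B = (\<Union>m\<in>Poly_Mapping.keys f. Poly_Mapping.lookup m ` Poly_Mapping.keys m)"
  \<comment> \<open>A base above every exponent that occurs, so that exponent vectors are digit
    sequences; the inserted 0 covers an empty \<open>B\<close>.\<close>
  define N where "N = Suc (Max (insert 0 B))"
  have finB: "finite B" by (simp add: B_def)
  have less_N: "Poly_Mapping.lookup m i < N" if "m \<in> Poly_Mapping.keys f" for m i
  proof (cases "i \<in> Poly_Mapping.keys m")
    case True
    then have "Poly_Mapping.lookup m i \<in> B" using that by (auto simp: B_def)
    then have "Poly_Mapping.lookup m i \<le> Max (insert 0 B)" using finB by (intro Max_ge) auto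
    then show ?thesis by (simp add: N_def)
  qed (simp add: in_keys_iff N_def)
  define e where "e m = (\<Sum>i<k. Poly_Mapping.lookup m i * N ^ i)" for m
  have keys: "Poly_Mapping.keys m \<subseteq> {..<k}" if "m \<in> Poly_Mapping.keys f" for m
    using vars that by (auto simp: in_vars_def)
  have inj: "m = m'" if "m \<in> Poly_Mapping.keys f" "m' \<in> Poly_Mapping.keys f" "e m = e m'" for m m'
  proof (rule poly_mapping_eqI)
    fix i
    have "\<forall>i<k. Poly_Mapping.lookup m i = Poly_Mapping.lookup m' i"
      using that by (intro digits_unique[of k _ N]) (auto simp: e_def less_N)
    moreover have "Poly_Mapping.lookup m i = 0 \<and> Poly_Mapping.lookup m' i = 0" if "\<not> i < k"
      using that keys \<open>m \<in> Poly_Mapping.keys f\<close> \<open>m' \<in> Poly_Mapping.keys f\<close> by (metis in_keys_iff lessThan_iff subsetD)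
    ultimately show "Poly_Mapping.lookup m i = Poly_Mapping.lookup m' i" by (cases "i < k") auto
  qed
  define q where "q = (\<Sum>m\<in>Poly_Mapping.keys f. monom (Poly_Mapping.lookup f m) (e m))"
  have "poly q T = meval (\<lambda>i. T ^ (N ^ i)) f" for T
  proof -
    have "mon_eval (\<lambda>i. T ^ (N ^ i)) m = T ^ e m" if "m \<in> Poly_Mapping.keys f" for m
      using mon_eval_superset[OF finite_lessThan keys[OF that], of "\<lambda>i. T ^ (N ^ i)"]
      by (simp add: e_def power_sum power_mult[symmetric] mult.commute)
    then show ?thesis by (simp add: q_def poly_sum poly_monom meval_eq_poly_eval poly_eval_def)
  qed
  then have q0: "q = 0" using poly_eq_0_infinite[OF inf, of q] 0 by simp
  show ?thesis
  proof (rule ccontr)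
    assume "f \<noteq> 0"
    then obtain m where m: "m \<in> Poly_Mapping.keys f" using keys_eq_empty by blast
    have "coeff q (e m) = (\<Sum>m'\<in>Poly_Mapping.keys f. if m' = m then Poly_Mapping.lookup f m' else 0)"
      unfolding q_def coeff_sum using inj[OF _ m] by (intro sum.cong) auto
    also have "\<dots> = Poly_Mapping.lookup f m" using m by simp
    finally show False using m q0 by (simp add: in_keys_iff)
  qed
qed

lemma coeff_mult_degree_le:
  assumes "degree p \<le> m" "degree q \<le> n"
  shows "coeff (p * q) (m + n) = coeff p m * coeff q n"
proof -
  have "coeff (p * q) (m + n) = (\<Sum>i\<le>m + n. coeff p i * coeff q (m + n - i))" by (rule coeff_mult)
  also have "\<dots> = (\<Sum>i\<le>m + n. if i = m then coeff p m * coeff q n else 0)"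
  proof (intro sum.cong refl)
    fix i
    show "coeff p i * coeff q (m + n - i) = (if i = m then coeff p m * coeff q n else 0)"
      using assms coeff_eq_0[of p i] coeff_eq_0[of q "m + n - i"] by (cases i m rule: linorder_cases) auto
  qed
  also have "\<dots> = coeff p m * coeff q n" by simp
  finally show ?thesis .
qed

text \<open>On the line b + T a, a monomial of degree e becomes a polynomial in T of degree at most
  e whose T^e coefficient is the monomial at a. So T^d sees only the top-degree part, and the base
  point b drops out.\<close>

lemma coeff_line_substitution:
  fixes f :: "'k::comm_ring_1 mpoly"
  assumes "\<And>m. m \<in> Poly_Mapping.keys f \<Longrightarrow> mon_degree m \<le> d"
  shows "coeff (poly_eval (\<lambda>c. [:c:]) (\<lambda>i. [:b i, a i:]) f) d = meval a (hom_part d f)"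
proof -
  have const: "comm_ring_hom (\<lambda>c::'k. [:c:])" by unfold_locales simp_all
  interpret L: comm_ring_hom "poly_eval (\<lambda>c::'k. [:c:]) (\<lambda>i. [:b i, a i:])"
    by (rule comm_ring_hom.poly_eval_hom[OF const])
  have mon: "degree (mon_eval (\<lambda>i. [:b i, a i:]) m) \<le> mon_degree m \<and>
      coeff (mon_eval (\<lambda>i. [:b i, a i:]) m) (mon_degree m) = mon_eval a m" for m
  proof (induction m rule: poly_mapping_single_induct)
    case (single i n)
    show ?case
    proof (induction n)
      case (Suc n)
      let ?q = "[:b i, a i:] ^ n"
      have q: "degree ?q \<le> n" "coeff ?q n = a i ^ n" using Suc by simp_all
      have "degree ([:b i, a i:] * ?q) \<le> degree [:b i, a i:] + degree ?q" by (rule degree_mult_le)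
      moreover have "degree [:b i, a i:] \<le> 1" by simp
      ultimately have "degree ([:b i, a i:] * ?q) \<le> Suc n" using q by linarith
      moreover have "coeff ([:b i, a i:] * ?q) (Suc n) = a i ^ Suc n"
        using q coeff_eq_0[of ?q "Suc n"] by simp
      ultimately show ?case by simp
    qed simp
  next
    case (add m n)
    let ?p = "mon_eval (\<lambda>i. [:b i, a i:]) m" and ?q = "mon_eval (\<lambda>i. [:b i, a i:]) n"
    have "degree (?p * ?q) \<le> degree ?p + degree ?q" by (rule degree_mult_le)
    moreover have "coeff (?p * ?q) (mon_degree m + mon_degree n)
        = coeff ?p (mon_degree m) * coeff ?q (mon_degree n)"
      using add by (intro coeff_mult_degree_le) auto
    ultimately show ?case using add by (simp add: mon_eval_add mon_degree_add)
  qed simp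
  have one: "coeff (poly_eval (\<lambda>c. [:c:]) (\<lambda>i. [:b i, a i:]) (Poly_Mapping.single m c)) d
      = meval a (hom_part d (Poly_Mapping.single m c))" if "mon_degree m \<le> d" for m c
  proof (cases "mon_degree m = d")
    case True
    then show ?thesis using mon[of m]
      by (simp add: comm_ring_hom.poly_eval_single[OF const] hom_part_def grade_single
          meval_eq_poly_eval comm_ring_hom.poly_eval_single[OF comm_ring_hom_id])
  next
    case False
    then have "degree (mon_eval (\<lambda>i. [:b i, a i:]) m) < d" using mon[of m] that by linarith
    then show ?thesis using False
      by (simp add: comm_ring_hom.poly_eval_single[OF const] hom_part_def grade_single coeff_eq_0)
  qed
  show ?thesis
    by (subst (1 2) poly_mapping_decomp[of f])
       (use one assms in \<open>simp add: L.sum coeff_sum hom_part_sum meval.sum\<close>)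
qed

lemma meval_hom_part_eq_0:
  fixes f :: "'k::field mpoly"
  assumes inf: "infinite (UNIV :: 'k set)"
    and deg: "\<And>m. m \<in> Poly_Mapping.keys f \<Longrightarrow> mon_degree m \<le> d"
    and line: "\<And>T. meval (\<lambda>i. b i + T * a i) f = 0"
  shows "meval a (hom_part d f) = 0"
proof -
  let ?q = "poly_eval (\<lambda>c. [:c:]) (\<lambda>i. [:b i, a i:]) f"
  have const: "comm_ring_hom (\<lambda>c::'k. [:c:])" by unfold_locales simp_all
  have eval: "comm_ring_hom (\<lambda>q. poly q (T::'k))" for T by unfold_locales simp_all
  have "poly ?q T = meval (\<lambda>i. b i + T * a i) f" for T
    by (rule comm_ring_hom_ext[OF comm_ring_hom_comp[OF eval comm_ring_hom.poly_eval_hom[OF const]] meval.comm_ring_hom_axioms])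
       (simp_all add: comm_ring_hom.poly_eval_mconst[OF const] comm_ring_hom.poly_eval_mvar[OF const])
  then have "?q = 0" using line by (intro poly_eq_0_infinite[OF inf]) simp
  then show ?thesis using coeff_line_substitution[OF deg, of f b a] by simp
qed

section \<open>Rotating and merging the first \<open>p\<close> variables\<close>

lemma mon_rename_comp: "mon_rename \<sigma> (mon_rename \<tau> m) = mon_rename (\<sigma> \<circ> \<tau>) m"
  using arg_cong[OF rename_rename[of \<sigma> \<tau> "Poly_Mapping.single m (1::int)"], of Poly_Mapping.keys]
  by (simp del: o_apply)

lemma mon_rename_ident [simp]: "mon_rename (\<lambda>x. x) m = m"
  unfolding mon_rename_def by (rule poly_mapping_decomp[symmetric])

lemma funpow_mon_rename: "(mon_rename \<sigma> ^^ k) m = mon_rename (\<sigma> ^^ k) m"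
proof (induction k)
  case (Suc k)
  then show ?case by (simp only: funpow.simps(2) comp_apply[of "mon_rename \<sigma>"] mon_rename_comp)
qed simp

definition rotate_vars :: "nat \<Rightarrow> nat \<Rightarrow> nat" where
  "rotate_vars p i = (if i < p then Suc i mod p else i)"

lemma funpow_rotate_vars: "(rotate_vars p ^^ k) i = (if i < p then (i + k) mod p else i)"
  by (induction k) (auto simp: rotate_vars_def mod_Suc_eq)

lemma rotate_vars_permutes:
  assumes "p \<le> n" "p > 0"
  shows "rotate_vars p permutes {..<n}"
proof (rule permutes_subset)
  show "rotate_vars p permutes {..<p}"
  proof (rule bij_imp_permutes)
    show "bij_betw (rotate_vars p) {..<p} {..<p}"
    proof (rule bij_betw_byWitness[where f' = "\<lambda>i. (i + (p - 1)) mod p"])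
      show "\<forall>i\<in>{..<p}. (rotate_vars p i + (p - 1)) mod p = i"
      proof
        fix i assume i: "i \<in> {..<p}"
        then have "(rotate_vars p i + (p - 1)) mod p = (Suc i mod p + (p - 1)) mod p"
          by (simp add: rotate_vars_def)
        also have "\<dots> = (Suc i + (p - 1)) mod p" by (rule mod_add_left_eq)
        also have "Suc i + (p - 1) = i + p" using assms by simp
        finally show "(rotate_vars p i + (p - 1)) mod p = i" using i by simp
      qed
      show "\<forall>i\<in>{..<p}. rotate_vars p ((i + (p - 1)) mod p) = i"
      proof
        fix i assume i: "i \<in> {..<p}"
        have "rotate_vars p ((i + (p - 1)) mod p) = Suc ((i + (p - 1)) mod p) mod p"
          using assms by (simp add: rotate_vars_def)
        also have "\<dots> = Suc (i + (p - 1)) mod p" by (rule mod_Suc_eq)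
        also have "Suc (i + (p - 1)) = i + p" using assms by simp
        finally show "rotate_vars p ((i + (p - 1)) mod p) = i" using i by simp
      qed
    qed (use assms in \<open>auto simp: rotate_vars_def\<close>)
  qed (simp add: rotate_vars_def)
qed (use assms in auto)

text \<open>As a renaming, this is restriction to the diagonal x_0 = ... = x_(p-1).\<close>

definition merge_vars :: "nat \<Rightarrow> nat \<Rightarrow> nat" where
  "merge_vars p i = (if i < p then 0 else i)"

lemma lookup_merge_vars:
  assumes "p > 0"
  shows "Poly_Mapping.lookup (mon_rename (merge_vars p) m) 0 = (\<Sum>i<p. Poly_Mapping.lookup m i)"
    and "j \<ge> p \<Longrightarrow> Poly_Mapping.lookup (mon_rename (merge_vars p) m) j = Poly_Mapping.lookup m j"
proof -
  have "Poly_Mapping.lookup (mon_rename (merge_vars p) m) 0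
      = (\<Sum>i\<in>Poly_Mapping.keys m. if i \<in> {..<p} then Poly_Mapping.lookup m i else 0)"
    unfolding lookup_mon_rename using assms by (intro sum.cong) (auto simp: merge_vars_def)
  also have "\<dots> = (\<Sum>i\<in>Poly_Mapping.keys m \<inter> {..<p}. Poly_Mapping.lookup m i)"
    by (simp add: sum.inter_restrict)
  also have "\<dots> = (\<Sum>i<p. Poly_Mapping.lookup m i)"
    by (rule sum.mono_neutral_left) (auto simp: in_keys_iff)
  finally show "Poly_Mapping.lookup (mon_rename (merge_vars p) m) 0 = (\<Sum>i<p. Poly_Mapping.lookup m i)" .
  assume j: "j \<ge> p"
  have "Poly_Mapping.lookup (mon_rename (merge_vars p) m) j
      = (\<Sum>i\<in>Poly_Mapping.keys m. if i = j then Poly_Mapping.lookup m i else 0)"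
    unfolding lookup_mon_rename using assms j by (intro sum.cong) (auto simp: merge_vars_def)
  then show "Poly_Mapping.lookup (mon_rename (merge_vars p) m) j = Poly_Mapping.lookup m j"
    by (simp add: in_keys_iff)
qed

lemma sym_poly_hom_part:
  assumes "sym_poly n (f :: 'a::comm_ring_1 mpoly)"
  shows "sym_poly n (hom_part d f)"
  using assms by (auto simp: sym_poly_def in_vars_def hom_part_rename[symmetric] in_keys_iff lookup_hom_part)

text \<open>Rotating the first \<open>p\<close> exponents groups the monomials that become equal after merging
  the first \<open>p\<close> variables into orbits of size \<open>p\<close>, apart from the monomial with equal exponents.\<close>

lemma lookup_equal_block_eq_0:
  fixes g :: "'k::comm_ring_1 mpoly" and p :: nat
  assumes char: "CHAR('k) = p" and p: "prime p" "p \<le> n" and sym: "sym_poly n g"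
    and merge: "rename (merge_vars p) g = 0" and len: "length (replicate p r @ l) = n"
  shows "Poly_Mapping.lookup g (list_mon (replicate p r @ l)) = 0"
proof (rule ccontr)
  assume nz: "Poly_Mapping.lookup g (list_mon (replicate p r @ l)) \<noteq> 0"
  define m0 where "m0 = list_mon (replicate p r @ l)"
  define \<kappa> where "\<kappa> = mon_rename (rotate_vars p)"
  \<comment> \<open>The monomials of \<open>g\<close> that merge to the same monomial as
    \<open>m0\<close>; their coefficients add up to one coefficient of the merged polynomial, which
    is zero.\<close>
  define X where "X = {m. m \<in> Poly_Mapping.keys g \<and> mon_rename (merge_vars p) m = mon_rename (merge_vars p) m0}"
  have p0: "p > 0" using p by (simp add: prime_gt_0_nat)
  have rot: "rotate_vars p permutes {..<n}" using p p0 by (intro rotate_vars_permutes)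
  have merge_rot: "merge_vars p \<circ> rotate_vars p = merge_vars p"
    using p0 by (auto simp: fun_eq_iff merge_vars_def rotate_vars_def)
  have low: "Poly_Mapping.lookup m0 i = r" if "i < p" for i
    using that by (simp add: m0_def lookup_list_mon nth_append)
  have inv: "Poly_Mapping.lookup g (\<kappa> m) = Poly_Mapping.lookup g m" for m
    unfolding \<kappa>_def by (rule lookup_sym_poly[OF sym rot])
  \<comment> \<open>Invariance under rotation makes the first \<open>p\<close> exponents equal.
    Their sum is p r as a natural number, not only modulo p, so each is \<open>r\<close>; merging
    leaves the later exponents alone.\<close>
  have fixed: "m = m0" if m: "m \<in> X" "\<kappa> m = m" for m
  proof -
    have step: "Poly_Mapping.lookup m (rotate_vars p i) = Poly_Mapping.lookup m i" for i
      using lookup_mon_rename_bij[OF permutes_bij[OF rot], of m "rotate_vars p i"] m(2)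
        permutes_inverses(2)[OF rot, of i] by (simp add: \<kappa>_def)
    have const: "i < p \<Longrightarrow> Poly_Mapping.lookup m i = Poly_Mapping.lookup m 0" for i
    proof (induction i)
      case (Suc i) then show ?case using step[of i] by (simp add: rotate_vars_def)
    qed simp
    have eq: "mon_rename (merge_vars p) m = mon_rename (merge_vars p) m0" using m by (simp add: X_def)
    have "(\<Sum>i<p. Poly_Mapping.lookup m i) = (\<Sum>i<p. Poly_Mapping.lookup m0 i)"
      unfolding lookup_merge_vars(1)[OF p0, symmetric] eq ..
    moreover have "(\<Sum>i<p. Poly_Mapping.lookup m i) = (\<Sum>i<p. Poly_Mapping.lookup m 0)"
      by (rule sum.cong[OF refl], rule const) simp
    moreover have "(\<Sum>i<p. Poly_Mapping.lookup m0 i) = (\<Sum>i<p. r)"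
      by (rule sum.cong[OF refl], rule low) simp
    ultimately have r: "Poly_Mapping.lookup m 0 = r" using p0 by simp
    have high: "Poly_Mapping.lookup m j = Poly_Mapping.lookup m0 j" if "j \<ge> p" for j
      using lookup_merge_vars(2)[OF p0 that] eq by metis
    show ?thesis
    proof (rule poly_mapping_eqI)
      fix i
      show "Poly_Mapping.lookup m i = Poly_Mapping.lookup m0 i"
      proof (cases "i < p")
        case True show ?thesis unfolding const[OF True] r low[OF True] ..
      qed (simp add: high)
    qed
  qed
  have "permute_list (rotate_vars p) (replicate p r @ l) = replicate p r @ l"
    using rot len p0 by (intro nth_equalityI) (auto simp: permute_list_nth rotate_vars_def nth_append)
  then have "\<kappa> m0 = m0"
    using mon_rename_list_mon_permute[of "rotate_vars p" "replicate p r @ l"] rot len by (simp add: \<kappa>_def m0_def)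
  then have fixed_eq: "{m \<in> X. \<kappa> m = m} = {m0}"
    using fixed nz by (auto simp: X_def in_keys_iff m0_def)
  have "Poly_Mapping.lookup (rename (merge_vars p) g) (mon_rename (merge_vars p) m0) = sum (Poly_Mapping.lookup g) X"
    by (simp add: lookup_rename X_def)
  also have "\<dots> = sum (Poly_Mapping.lookup g) {m \<in> X. \<kappa> m = m}"
  proof (rule sum_eq_sum_fixed_points[OF char p(1)])
    show "\<kappa> m \<in> X" if "m \<in> X" for m
      using that inv[of m] by (simp add: X_def in_keys_iff \<kappa>_def mon_rename_comp merge_rot del: o_apply)
    show "(\<kappa> ^^ p) m = m" for m
    proof -
      have "rotate_vars p ^^ p = id" by (simp add: fun_eq_iff funpow_rotate_vars)
      then show ?thesis by (simp add: \<kappa>_def funpow_mon_rename id_def)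
    qed
  qed (simp_all add: X_def inv)
  finally show False using nz by (simp add: fixed_eq merge m0_def)
qed

text \<open>By symmetry \<open>p\<close> equal parts can be moved to the front. In top degree the
  wheel locus degenerates to the diagonal of the first \<open>p\<close> variables, which leaves the
  case of an equal block.\<close>

lemma lookup_not_restricted_eq_0:
  fixes f :: "'k::field mpoly" and p :: nat
  assumes inf: "infinite (UNIV :: 'k set)" and char: "CHAR('k) = p" and p: "prime p"
    and sym: "sym_poly n f" and deg: "\<And>m. m \<in> Poly_Mapping.keys f \<Longrightarrow> mon_degree m \<le> d"
    and van: "\<And>a. n \<ge> p \<Longrightarrow> \<forall>i<p. a i + of_nat i = a 0 \<Longrightarrow> meval a f = 0"
    and l: "length l = n" "sum_list l = d" "\<not> p_restricted p l"
  shows "Poly_Mapping.lookup f (list_mon l) = 0"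
proof -
  obtain r where r: "mult_part l r \<ge> p" using l(3) by (auto simp: p_restricted_def not_less)
  have pn: "n \<ge> p" using r count_le_length[of l r] l(1) by (simp add: mult_part_def)
  obtain l' where l': "mset l' = mset l - replicate_mset p r" using ex_mset by blast
  have "replicate_mset p r \<subseteq># mset l"
    using r by (simp add: count_le_replicate_mset_subset_eq[symmetric] mult_part_def count_mset)
  then have ms: "mset (replicate p r @ l') = mset l" by (simp add: l')
  have len: "length (replicate p r @ l') = n" using mset_eq_length[OF ms] l(1) by simp
  have sm: "sum_list (replicate p r @ l') = d"
    using arg_cong[OF ms, of sum_mset] l(2) by (simp only: sum_mset_sum_list)
  let ?g = "hom_part d f"
  have symg: "sym_poly n ?g" by (rule sym_poly_hom_part[OF sym])
  have "rename (merge_vars p) ?g = 0"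
  proof (rule meval_eq_0_imp_eq_0[OF inf])
    show "meval a (rename (merge_vars p) ?g) = 0" for a
      unfolding meval_rename
    proof (rule meval_hom_part_eq_0[OF inf deg])
      fix T
      \<comment> \<open>The offsets -i and the common direction of the first \<open>p\<close>
        coordinates keep this line on the wheel locus for every \<open>T\<close>.\<close>
      show "meval (\<lambda>i. (if i < p then - of_nat i else 0) + T * (a \<circ> merge_vars p) i) f = 0"
        using p by (intro van[OF pn]) (simp add: merge_vars_def prime_gt_0_nat)
    qed
    show "in_vars n (rename (merge_vars p) ?g)"
      using symg by (intro in_vars_rename[of n]) (auto simp: sym_poly_def merge_vars_def)
  qed
  then have "Poly_Mapping.lookup ?g (list_mon (replicate p r @ l')) = 0"
    using len by (intro lookup_equal_block_eq_0[OF char p pn symg])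
  then have "Poly_Mapping.lookup f (list_mon (replicate p r @ l')) = 0"
    using sm by (simp add: lookup_hom_part)
  moreover have "Poly_Mapping.lookup f (list_mon (replicate p r @ l')) = Poly_Mapping.lookup f (list_mon l)"
    using sym l(1) ms by (intro lookup_sym_poly_mset) simp_all
  ultimately show ?thesis by simp
qed

section \<open>The basis of the image\<close>

lemma lookup_mconst_mult:
  "Poly_Mapping.lookup (mconst c * f) m = c * Poly_Mapping.lookup (f :: 'a::comm_ring_1 mpoly) m"
  unfolding mconst_def mult_map_scale_conv_mult[symmetric] by (simp add: Poly_Mapping.map.rep_eq when_def)

lemma of_nat_mul_part_nonzero:
  fixes p :: nat
  assumes "CHAR('k::field) = p" "prime p" "p_restricted p l"
  shows "(of_nat (mul_part l) :: 'k) \<noteq> 0"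
proof -
  have "\<not> p dvd fact (mult_part l i)" for i
    using assms(2,3) by (simp add: prime_dvd_fact_iff p_restricted_def not_le)
  then have "\<not> p dvd mul_part l"
    unfolding mul_part_def using assms(2) by (simp add: prime_dvd_prod_iff)
  then show ?thesis by (simp add: of_nat_eq_0_iff_char_dvd assms(1))
qed

lemma P_poly_eq:
  fixes p :: nat
  assumes two: "(2::'k::field) \<noteq> 0" and char: "CHAR('k) = p" and p: "prime p"
    and l: "is_partition l" "p_restricted p l"
  shows "(P_poly l :: 'k mpoly) = mconst (1 / of_nat (mul_part l)) * symmetrize (length l) (mmono l)"
proof -
  let ?c = "of_nat (mul_part l) :: 'k"
  have "mconst (1 / ?c) * (P_poly l * of_nat (mul_part l)) = P_poly l * (mconst (1 / ?c) * mconst ?c)"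
    by (simp add: ac_simps)
  also have "mconst (1 / ?c) * mconst ?c = 1"
    using of_nat_mul_part_nonzero[OF char p l(2)] by (simp add: mconst.mult[symmetric] del: mconst.of_nat)
  finally show ?thesis by (simp add: P_poly_spec[OF two l(1)])
qed

lemma lookup_P_poly:
  fixes p :: nat
  assumes two: "(2::'k::field) \<noteq> 0" and char: "CHAR('k) = p" and p: "prime p"
    and l: "is_partition l" "p_restricted p l" and deg: "sum_list l \<le> mon_degree m"
  shows "Poly_Mapping.lookup (P_poly l :: 'k mpoly) m = 1 / of_nat (mul_part l) *
    of_nat (card {\<sigma>. \<sigma> permutes {..<length l} \<and> mon_rename \<sigma> (list_mon l) = m})"
  by (simp add: P_poly_eq[OF two char p l] lookup_mconst_mult lookup_symmetrize_mmono[OF two deg])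

lemma mon_degree_P_poly:
  fixes p :: nat
  assumes two: "(2::'k::field) \<noteq> 0" and char: "CHAR('k) = p" and p: "prime p"
    and l: "is_partition l" "p_restricted p l" and m: "m \<in> Poly_Mapping.keys (P_poly l :: 'k mpoly)"
  shows "mon_degree m \<le> sum_list l"
proof (rule ccontr)
  assume "\<not> mon_degree m \<le> sum_list l"
  then have "sum_list l < mon_degree m" by simp
  then have "{\<sigma>. \<sigma> permutes {..<length l} \<and> mon_rename \<sigma> (list_mon l) = m} = {}"
    using mon_degree_mon_rename[of _ "list_mon l"] by fastforce
  with lookup_P_poly[OF two char p l, of m] \<open>sum_list l < mon_degree m\<close> m show False
    by (simp only: in_keys_iff card.empty) simp
qed

text \<open>The coefficient is the order of the stabilizer of the exponents divided by
  \<open>mul_part l\<close>; both are prime to \<open>p\<close> for restricted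
  \<open>l\<close>.\<close>

lemma lookup_P_poly_self:
  fixes p :: nat
  assumes two: "(2::'k::field) \<noteq> 0" and char: "CHAR('k) = p" and p: "prime p"
    and l: "is_partition l" "p_restricted p l"
  shows "Poly_Mapping.lookup (P_poly l :: 'k mpoly) (list_mon l) \<noteq> 0"
proof -
  have "(of_nat (card {\<sigma>. \<sigma> permutes {..<length l} \<and> mon_rename \<sigma> (list_mon l) = list_mon l}) :: 'k) \<noteq> 0"
    using prime_not_dvd_card_list_stabilizer[OF p l(2)] by (simp only: of_nat_eq_0_iff_char_dvd char) simp
  then show ?thesis
    using lookup_P_poly[OF two char p l, of "list_mon l"] of_nat_mul_part_nonzero[OF char p l(2)] by simp
qed

text \<open>Distinct partitions are not rearrangements of each other, so the coefficients are
  triangular with respect to size.\<close>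

lemma lookup_P_poly_other:
  fixes p :: nat
  assumes two: "(2::'k::field) \<noteq> 0" and char: "CHAR('k) = p" and p: "prime p"
    and l: "is_partition l" "p_restricted p l" and l': "is_partition l'" "length l' = length l"
    and deg: "sum_list l \<le> sum_list l'" and neq: "l \<noteq> l'"
  shows "Poly_Mapping.lookup (P_poly l :: 'k mpoly) (list_mon l') = 0"
proof -
  have "\<not> (\<sigma> permutes {..<length l} \<and> mon_rename \<sigma> (list_mon l) = list_mon l')" for \<sigma>
    using list_mon_eq_mon_rename_imp_mset[of \<sigma> l l'] partition_mset_unique[OF l(1) l'(1)] neq l'(2) by metis
  then have "{\<sigma>. \<sigma> permutes {..<length l} \<and> mon_rename \<sigma> (list_mon l) = list_mon l'} = {}" by blast
  then show ?thesis
    using lookup_P_poly[OF two char p l, of "list_mon l'"] deg by (simp only: mon_degree_list_mon card.empty) simp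
qed

text \<open>The points \<open>a\<close> have coordinates at all indices, even beyond
  \<open>n\<close>, so the case \<open>n < p\<close> has to be exempted explicitly.\<close>

definition wheel_vanishing :: "nat \<Rightarrow> nat \<Rightarrow> 'a::comm_ring_1 mpoly \<Rightarrow> bool" where
  "wheel_vanishing p n f \<longleftrightarrow> (n \<ge> p \<longrightarrow> (\<forall>a. (\<forall>i<p. a i + of_nat i = a 0) \<longrightarrow> meval a f = 0))"

lemma sym_poly_P_poly:
  fixes p :: nat
  assumes two: "(2::'k::field) \<noteq> 0" and char: "CHAR('k) = p" and p: "prime p"
    and l: "is_partition l" "p_restricted p l"
  shows "sym_poly (length l) (P_poly l :: 'k mpoly)" "wheel_vanishing p (length l) (P_poly l :: 'k mpoly)"
proof -
  let ?f = "mconst (1 / of_nat (mul_part l)) * mmono l :: 'k mpoly"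
  have eq: "(P_poly l :: 'k mpoly) = symmetrize (length l) ?f"
    by (simp add: P_poly_eq[OF two char p l] symmetrize_mconst[OF two])
  have "in_vars (length l) ?f" by (intro in_vars_mult in_vars_mmono) simp
  then show "sym_poly (length l) (P_poly l :: 'k mpoly)"
    unfolding eq by (rule sym_poly_symmetrize[OF two])
  show "wheel_vanishing p (length l) (P_poly l :: 'k mpoly)"
    unfolding eq wheel_vanishing_def
    by (auto intro!: meval_symmetrize_wheel[OF char prime_gt_1_nat[OF p] _ two])
qed

lemma sym_poly_diff: "sym_poly n f \<Longrightarrow> sym_poly n g \<Longrightarrow> sym_poly n (f - g :: 'a::comm_ring_1 mpoly)"
  by (auto simp: sym_poly_def rename.diff intro: in_vars_diff)

lemma sym_poly_lincomb:
  "(\<And>x. x \<in> A \<Longrightarrow> sym_poly n (f x)) \<Longrightarrow> sym_poly n (\<Sum>x\<in>A. mconst (c x) * f x :: 'a::comm_ring_1 mpoly)"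
  by (auto simp: sym_poly_def rename.sum rename.mult intro!: in_vars_sum in_vars_mult)

text \<open>Induction on a strict degree bound, so that the base case is the zero polynomial. In
  degree \<open>d\<close> the restricted coefficients are removed by the choice of \<open>c\<close>,
  the others vanish because \<open>f'\<close> still satisfies the wheel condition.\<close>

lemma restricted_span:
  fixes f :: "'k::field mpoly" and p :: nat
  assumes inf: "infinite (UNIV :: 'k set)" and two: "(2::'k) \<noteq> 0" and char: "CHAR('k) = p" and p: "prime p"
    and "sym_poly n f" "wheel_vanishing p n f" "\<And>m. m \<in> Poly_Mapping.keys f \<Longrightarrow> mon_degree m < d"
  shows "\<exists>S c. finite S \<and> (\<forall>l\<in>S. is_partition l \<and> p_restricted p l \<and> length l = n)
    \<and> f = (\<Sum>l\<in>S. mconst (c l) * P_poly l)"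
  using assms(5-)
proof (induction d arbitrary: f)
  case 0
  then have "f = 0" using keys_eq_empty by blast
  then show ?case by (intro exI[of _ "{}"]) simp
next
  case (Suc d)
  define R where "R = {l. is_partition l \<and> p_restricted p l \<and> length l = n \<and> sum_list l = d}"
  have "R \<subseteq> {l. set l \<subseteq> {..d} \<and> length l = n}"
    using member_le_sum_list by (auto simp: R_def)
  then have finR: "finite R" by (rule finite_subset) (rule finite_lists_length_eq, simp)
  define P where "P = (P_poly :: nat list \<Rightarrow> 'k mpoly)"
  \<comment> \<open>No linear system has to be solved: for different \<open>l\<close> and
    \<open>l'\<close> in \<open>R\<close>, \<open>P l'\<close> has coefficient zero at
    \<open>list_mon l\<close>.\<close>
  define c where "c l = Poly_Mapping.lookup f (list_mon l) / Poly_Mapping.lookup (P l) (list_mon l)" for l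
  define f' where "f' = f - (\<Sum>l\<in>R. mconst (c l) * P l)"
  have lookup_f': "Poly_Mapping.lookup f' m = Poly_Mapping.lookup f m - (\<Sum>l\<in>R. c l * Poly_Mapping.lookup (P l) m)" for m
    by (simp add: f'_def lookup_minus lookup_sum lookup_mconst_mult)
  have symP: "sym_poly n (P l)" "wheel_vanishing p n (P l)" if "l \<in> R" for l
    using sym_poly_P_poly[OF two char p, of l] that by (auto simp: R_def P_def)
  have sym': "sym_poly n f'"
    unfolding f'_def by (intro sym_poly_diff Suc.prems sym_poly_lincomb symP)
  have van': "wheel_vanishing p n f'"
    using Suc.prems(2) symP(2)
    by (auto simp: wheel_vanishing_def f'_def meval.diff meval.sum meval.mult)
  have le_d: "mon_degree m \<le> d" if "m \<in> Poly_Mapping.keys f'" for m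
  proof (rule ccontr)
    assume *: "\<not> mon_degree m \<le> d"
    then have "Poly_Mapping.lookup f m = 0" using Suc.prems(3)[of m] by (auto simp: in_keys_iff)
    moreover have "Poly_Mapping.lookup (P l) m = 0" if "l \<in> R" for l
      using mon_degree_P_poly[OF two char p, of l m] that * by (auto simp: R_def P_def in_keys_iff)
    ultimately show False using that by (simp add: in_keys_iff lookup_f')
  qed
  have less_d: "mon_degree m < d" if m: "m \<in> Poly_Mapping.keys f'" for m
  proof (rule ccontr)
    assume "\<not> mon_degree m < d"
    with le_d[OF m] have deg: "mon_degree m = d" by simp
    have "Poly_Mapping.keys m \<subseteq> {..<n}" using sym' m by (auto simp: sym_poly_def in_vars_def)
    then have lm: "list_mon (map (Poly_Mapping.lookup m) [0..<n]) = m" by (rule list_mon_of_mon)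
    obtain l where l: "is_partition l" "mset l = mset (map (Poly_Mapping.lookup m) [0..<n])"
      using partition_exists by metis
    have len: "length l = n" using mset_eq_length[OF l(2)] by simp
    have "sum_list l = sum_list (map (Poly_Mapping.lookup m) [0..<n])"
      using arg_cong[OF l(2), of sum_mset] by (simp only: sum_mset_sum_list)
    also have "\<dots> = mon_degree m" by (metis lm mon_degree_list_mon)
    finally have sum: "sum_list l = d" by (simp add: deg)
    have eq: "Poly_Mapping.lookup f' m = Poly_Mapping.lookup f' (list_mon l)"
      using lookup_sym_poly_mset[of l f', OF _ l(2)] sym' len lm by simp
    have "Poly_Mapping.lookup f' (list_mon l) = 0"
    proof (cases "p_restricted p l")
      case False
      show ?thesis
        by (rule lookup_not_restricted_eq_0[OF inf char p sym' le_d _ len sum False])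
           (use van' in \<open>auto simp: wheel_vanishing_def\<close>)
    next
      case True
      then have lR: "l \<in> R" using l len sum by (simp add: R_def)
      have nz: "Poly_Mapping.lookup (P l) (list_mon l) \<noteq> 0"
        unfolding P_def by (rule lookup_P_poly_self[OF two char p l(1) True])
      have "(\<Sum>l'\<in>R. c l' * Poly_Mapping.lookup (P l') (list_mon l))
          = (\<Sum>l'\<in>R. if l' = l then c l * Poly_Mapping.lookup (P l) (list_mon l) else 0)"
      proof (rule sum.cong[OF refl])
        fix l' assume "l' \<in> R"
        then have "Poly_Mapping.lookup (P l') (list_mon l) = 0" if "l' \<noteq> l"
          unfolding P_def using that l(1) len sum
          by (intro lookup_P_poly_other[OF two char p]) (auto simp: R_def)
        then show "c l' * Poly_Mapping.lookup (P l') (list_mon l)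
            = (if l' = l then c l * Poly_Mapping.lookup (P l) (list_mon l) else 0)" by auto
      qed
      also have "\<dots> = Poly_Mapping.lookup f (list_mon l)"
        using lR finR nz by (simp add: c_def)
      finally show ?thesis by (simp add: lookup_f')
    qed
    then show False using m eq by (simp add: in_keys_iff)
  qed
  obtain S e where S: "finite S" "\<forall>l\<in>S. is_partition l \<and> p_restricted p l \<and> length l = n"
    and f': "f' = (\<Sum>l\<in>S. mconst (e l) * P l)"
    using Suc.IH[OF sym' van' less_d] unfolding P_def by blast
  \<comment> \<open>Extension by zero to the union, which allows for an overlap of \<open>S\<close>
    and \<open>R\<close>.\<close>
  let ?e = "\<lambda>l. if l \<in> S then e l else 0" and ?c = "\<lambda>l. if l \<in> R then c l else 0"
  have "f = f' + (\<Sum>l\<in>R. mconst (c l) * P l)" by (simp add: f'_def)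
  also have "(\<Sum>l\<in>R. mconst (c l) * P l) = (\<Sum>l\<in>S \<union> R. mconst (?c l) * P l)"
    using S(1) finR by (intro sum.mono_neutral_cong_left) auto
  also have "f' = (\<Sum>l\<in>S \<union> R. mconst (?e l) * P l)"
    unfolding f' using S(1) finR by (intro sum.mono_neutral_cong_left) auto
  finally have "f = (\<Sum>l\<in>S \<union> R. mconst (?e l + ?c l) * P l)"
    by (simp only: mconst.add distrib_right sum.distrib)
  moreover have "finite (S \<union> R)" using S finR by simp
  moreover have "\<forall>l\<in>S \<union> R. is_partition l \<and> p_restricted p l \<and> length l = n"
    using S by (auto simp: R_def)
  ultimately show ?case unfolding P_def
    by (intro exI[of _ "S \<union> R"] exI[of _ "\<lambda>l. ?e l + ?c l"] conjI)
qed

lemma P_W_in_im_Psi: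
  fixes p :: nat
  assumes two: "(2::'k::field) \<noteq> 0" and char: "CHAR('k) = p" and p: "prime p"
    and l: "is_partition l" "p_restricted p l"
  shows "(P_W l :: nat \<Rightarrow> 'k mpoly) \<in> im_Psi"
proof -
  have "P_W l = W_smult (1 / of_nat (mul_part l)) (sym_W l :: nat \<Rightarrow> 'k mpoly)"
    by (auto simp: P_W_def W_smult_def sym_W_def P_poly_eq[OF two char p l] fun_eq_iff)
  then show ?thesis using sym_W_in_im_Psi[OF two] by (simp add: im_Psi.smult)
qed

lemma lincomb_in_im_Psi:
  fixes c :: "'b \<Rightarrow> 'k::field"
  assumes "\<And>x. x \<in> S \<Longrightarrow> w x \<in> im_Psi"
  shows "(\<lambda>n. \<Sum>x\<in>S. mconst (c x) * w x n) \<in> im_Psi"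
  using assms
proof (induction S rule: infinite_finite_induct)
  case (insert x S)
  have "(\<lambda>n. \<Sum>x\<in>insert x S. mconst (c x) * w x n)
      = W_add (W_smult (c x) (w x)) (\<lambda>n. \<Sum>x\<in>S. mconst (c x) * w x n)"
    using insert(1,2) by (simp add: W_add_def W_smult_def)
  then show ?case using insert by (auto intro!: im_Psi.add im_Psi.smult)
next
  have "(\<lambda>n. 0) = W_smult 0 (W_one :: nat \<Rightarrow> 'k mpoly)" by (simp add: W_smult_def)
  then have 0: "(\<lambda>n. 0 :: 'k mpoly) \<in> im_Psi" by (simp add: im_Psi.smult im_Psi.one)
  {
    case (infinite S) then show ?case using 0 by simp
  next
    case empty then show ?case using 0 by simp
  }
qed

text \<open>Among the partitions with nonzero coefficient, one of maximal size is isolated: the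
  others miss its leading monomial, by length or by triangularity.\<close>

lemma P_W_linear_independent:
  fixes p :: nat and c :: "nat list \<Rightarrow> 'k::field"
  assumes two: "(2::'k) \<noteq> 0" and char: "CHAR('k) = p" and p: "prime p"
    and S: "finite S" "\<forall>l\<in>S. is_partition l \<and> p_restricted p l"
    and 0: "(\<lambda>n. \<Sum>l\<in>S. mconst (c l) * P_W l n) = (\<lambda>n. 0)"
  shows "\<forall>l\<in>S. c l = 0"
proof (rule ccontr)
  assume "\<not> (\<forall>l\<in>S. c l = 0)"
  define N where "N = {l \<in> S. c l \<noteq> 0}"
  have N: "finite N" "N \<noteq> {}" using S(1) \<open>\<not> (\<forall>l\<in>S. c l = 0)\<close> by (auto simp: N_def)
  define M where "M = Max (sum_list ` N)"
  have "M \<in> sum_list ` N" unfolding M_def using N by (intro Max_in) auto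
  then obtain l where l: "l \<in> N" "sum_list l = M" by auto
  have max: "sum_list l' \<le> sum_list l" if "l' \<in> N" for l'
    unfolding l(2) M_def using N that by (intro Max_ge) auto
  have lS: "l \<in> S" "c l \<noteq> 0" "is_partition l" "p_restricted p l" using l(1) S(2) by (auto simp: N_def)
  have "0 = Poly_Mapping.lookup (\<Sum>l'\<in>S. mconst (c l') * P_W l' (length l)) (list_mon l)"
    using fun_cong[OF 0, of "length l"] by simp
  also have "\<dots> = (\<Sum>l'\<in>S. c l' * Poly_Mapping.lookup (P_W l' (length l)) (list_mon l))"
    by (simp add: lookup_sum lookup_mconst_mult)
  also have "\<dots> = (\<Sum>l'\<in>S. if l' = l then c l * Poly_Mapping.lookup (P_poly l) (list_mon l) else 0)"
  proof (rule sum.cong[OF refl])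
    fix l' assume l': "l' \<in> S"
    have "Poly_Mapping.lookup (P_W l' (length l) :: 'k mpoly) (list_mon l) = 0" if "l' \<noteq> l" "c l' \<noteq> 0"
    proof (cases "length l' = length l")
      case True
      have "Poly_Mapping.lookup (P_poly l' :: 'k mpoly) (list_mon l) = 0"
        by (rule lookup_P_poly_other[OF two char p]) (use l' lS S(2) True max[of l'] that in \<open>auto simp: N_def\<close>)
      then show ?thesis using True by (simp add: P_W_def)
    qed (simp add: P_W_def)
    then show "c l' * Poly_Mapping.lookup (P_W l' (length l)) (list_mon l)
        = (if l' = l then c l * Poly_Mapping.lookup (P_poly l) (list_mon l) else 0)"
      by (cases "l' = l"; cases "c l' = 0") (auto simp: P_W_def)
  qed
  also have "\<dots> = c l * Poly_Mapping.lookup (P_poly l) (list_mon l)"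
    using lS S(1) by simp
  finally show False using lookup_P_poly_self[OF two char p lS(3,4)] lS(2) by simp
qed

lemma wheel_vanishing_span:
  fixes w :: "nat \<Rightarrow> 'k::field mpoly" and p :: nat
  assumes inf: "infinite (UNIV :: 'k set)" and two: "(2::'k) \<noteq> 0" and char: "CHAR('k) = p" and p: "prime p"
    and W: "in_W w" and van: "\<And>n. wheel_vanishing p n (w n)"
  shows "\<exists>S (c :: nat list \<Rightarrow> 'k). finite S \<and> (\<forall>l\<in>S. is_partition l \<and> p_restricted p l)
    \<and> w = (\<lambda>n. \<Sum>l\<in>S. mconst (c l) * P_W l n)"
proof -
  have "\<exists>S c. finite S \<and> (\<forall>l\<in>S. is_partition l \<and> p_restricted p l \<and> length l = n)
    \<and> w n = (\<Sum>l\<in>S. mconst (c l) * P_poly l)" for n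
  proof (rule restricted_span[OF inf two char p])
    show "sym_poly n (w n)" using W by (simp add: in_W_def)
    show "wheel_vanishing p n (w n)" by (rule van)
    show "mon_degree m < Suc (Max (mon_degree ` Poly_Mapping.keys (w n)))" if "m \<in> Poly_Mapping.keys (w n)" for m
      using that by (intro le_imp_less_Suc Max_ge) auto
  qed
  then obtain S c where S: "\<And>n. finite (S n)" "\<And>n l. l \<in> S n \<Longrightarrow> is_partition l \<and> p_restricted p l \<and> length l = n"
    and w: "\<And>n. w n = (\<Sum>l\<in>S n. mconst (c n l) * P_poly l)" by metis
  \<comment> \<open>Only the finitely many nonzero components are collected. Since
    \<open>length l\<close> recovers \<open>n\<close>, the pieces are disjoint and their
    coefficients glue to \<open>e\<close>.\<close>
  define T where "T = (\<Union>n\<in>{n. w n \<noteq> 0}. S n)"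
  define e where "e l = c (length l) l" for l
  have finT: "finite T" using W S(1) by (auto simp: T_def in_W_def)
  have "w n = (\<Sum>l\<in>T. mconst (e l) * P_W l n)" for n
  proof (cases "w n = 0")
    case True
    have "length l \<noteq> n" if "l \<in> T" for l using that S(2) True by (auto simp: T_def)
    then have "(\<Sum>l\<in>T. mconst (e l) * P_W l n) = 0" by (intro sum.neutral) (auto simp: P_W_def)
    then show ?thesis using True by simp
  next
    case False
    have "w n = (\<Sum>l\<in>S n. mconst (e l) * P_W l n)"
      unfolding w[of n] using S(2) by (intro sum.cong) (auto simp: e_def P_W_def)
    also have "\<dots> = (\<Sum>l\<in>T. mconst (e l) * P_W l n)"
    proof (rule sum.mono_neutral_left[OF finT])
      show "S n \<subseteq> T" using False by (auto simp: T_def)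
      show "\<forall>l\<in>T - S n. mconst (e l) * P_W l n = 0"
        using S(2) by (auto simp: T_def P_W_def)
    qed
    finally show ?thesis .
  qed
  moreover have "\<forall>l\<in>T. is_partition l \<and> p_restricted p l" using S(2) by (auto simp: T_def)
  ultimately show ?thesis using finT by (intro exI[of _ T] exI[of _ e]) auto
qed

theorem theorem3p3:
  fixes p :: nat
  assumes alg_closed: "\<forall>q :: 'k::field poly. degree q \<ge> 1 \<longrightarrow> (\<exists>x. poly q x = 0)"
    and char: "CHAR('k) = p" and prime: "prime p" and p_gt: "p > 2"
  shows "(im_Psi :: (nat \<Rightarrow> 'k mpoly) set) =
           {w. in_W w \<and> (\<forall>k\<ge>p. \<forall>a::nat \<Rightarrow> 'k.
                 (\<forall>i<p. a i + of_nat i = a 0) \<longrightarrow> meval a (w k) = 0)}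
    \<and> (\<forall>l. is_partition l \<and> p_restricted p l \<longrightarrow> (P_W l :: nat \<Rightarrow> 'k mpoly) \<in> im_Psi)
    \<and> (\<forall>S (c :: nat list \<Rightarrow> 'k). finite S \<and> (\<forall>l\<in>S. is_partition l \<and> p_restricted p l)
          \<and> (\<lambda>n. \<Sum>l\<in>S. mconst (c l) * P_W l n) = (\<lambda>n. 0) \<longrightarrow> (\<forall>l\<in>S. c l = 0))
    \<and> (\<forall>w \<in> (im_Psi :: (nat \<Rightarrow> 'k mpoly) set). \<exists>S (c :: nat list \<Rightarrow> 'k).
          finite S \<and> (\<forall>l\<in>S. is_partition l \<and> p_restricted p l)
          \<and> w = (\<lambda>n. \<Sum>l\<in>S. mconst (c l) * P_W l n))"
proof -
  let ?V = "{w. in_W w \<and> (\<forall>k\<ge>p. \<forall>a::nat \<Rightarrow> 'k. (\<forall>i<p. a i + of_nat i = a 0) \<longrightarrow> meval a (w k) = 0)}"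
  have inf: "infinite (UNIV :: 'k set)" by (rule infinite_field[OF alg_closed])
  have "(of_nat 2 :: 'k) \<noteq> 0"
    unfolding of_nat_eq_0_iff_char_dvd char using p_gt by (auto dest: dvd_imp_le)
  then have two: "(2::'k) \<noteq> 0" by simp
  have im_V: "w \<in> ?V" if "w \<in> im_Psi" for w :: "nat \<Rightarrow> 'k mpoly"
  proof -
    from im_Psi_symmetrize[OF two that]
    have fin: "finite {k. w k \<noteq> 0}" and sym: "\<And>n. \<exists>f. in_vars n f \<and> w n = symmetrize n f" by auto
    have "sym_poly n (w n)" for n using sym[of n] sym_poly_symmetrize[OF two] by metis
    moreover have "meval a (w n) = 0" if "n \<ge> p" "\<forall>i<p. a i + of_nat i = a 0" for n a
      using sym[of n] meval_symmetrize_wheel[OF char _ that(1) two that(2)] p_gt by auto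
    ultimately show ?thesis using fin by (simp add: in_W_def)
  qed
  have V_span: "\<exists>S (c :: nat list \<Rightarrow> 'k). finite S \<and> (\<forall>l\<in>S. is_partition l \<and> p_restricted p l)
          \<and> w = (\<lambda>n. \<Sum>l\<in>S. mconst (c l) * P_W l n)" if "w \<in> ?V" for w
    using that by (intro wheel_vanishing_span[OF inf two char prime]) (auto simp: wheel_vanishing_def)
  have P_im: "(P_W l :: nat \<Rightarrow> 'k mpoly) \<in> im_Psi" if "is_partition l" "p_restricted p l" for l
    by (rule P_W_in_im_Psi[OF two char prime that])
  \<comment> \<open>This inclusion goes through the spanning set: an element of \<open>?V\<close> is
    a combination of elements \<open>P_W l\<close>, each of which lies in the image.\<close>
  have V_im: "w \<in> im_Psi" if V: "w \<in> ?V" for w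
  proof -
    obtain S and c :: "nat list \<Rightarrow> 'k" where S: "\<forall>l\<in>S. is_partition l \<and> p_restricted p l"
      and w: "w = (\<lambda>n. \<Sum>l\<in>S. mconst (c l) * P_W l n)"
      using V_span[OF V] by blast
    show ?thesis unfolding w by (rule lincomb_in_im_Psi) (use S P_im in blast)
  qed
  show ?thesis
  proof (intro conjI)
    show "im_Psi = ?V" using im_V V_im by blast
    show "\<forall>l. is_partition l \<and> p_restricted p l \<longrightarrow> (P_W l :: nat \<Rightarrow> 'k mpoly) \<in> im_Psi"
      using P_im by blast
    show "\<forall>S (c :: nat list \<Rightarrow> 'k). finite S \<and> (\<forall>l\<in>S. is_partition l \<and> p_restricted p l)
          \<and> (\<lambda>n. \<Sum>l\<in>S. mconst (c l) * P_W l n) = (\<lambda>n. 0) \<longrightarrow> (\<forall>l\<in>S. c l = 0)"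
      by (intro allI impI, elim conjE) (rule P_W_linear_independent[OF two char prime])
    show "\<forall>w \<in> (im_Psi :: (nat \<Rightarrow> 'k mpoly) set). \<exists>S (c :: nat list \<Rightarrow> 'k).
          finite S \<and> (\<forall>l\<in>S. is_partition l \<and> p_restricted p l)
          \<and> w = (\<lambda>n. \<Sum>l\<in>S. mconst (c l) * P_W l n)"
      by (intro ballI V_span im_V)
  qed
qed

end
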